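(* Let $n$ be a positive integer, $\beta>n/2$, and $\phi_\beta(\mathbf{x})=(1+|\mathbf{x}|^2)^{-\beta}$ on $\mathbb{R}^n$. (i) The Hilbert space of functions on $\mathbb{R}^n$ with reproducing kernel $\phi_\beta(\mathbf{x}-\mathbf{y})$ coincides with $\mathcal{K}_{\beta-n/2}(\mathbb{R}^n)$ equipped with the inner product $$(f,g)_{\mathcal{K}_{\beta-n/2}(\mathbb{R}^n)} = (2\pi)^{-2n}\int_{\mathbb{R}^n}\frac{\widehat f(\xi)\,\overline{\widehat g(\xi)}}{G_\beta(\xi)}\,d\xi.$$ (ii) Let $X=\{\mathbf{x}_j\in\mathbb{R}^n: j\in\mathbb{N}\}$ be a set of distinct points with $\delta(X)=\inf_{j\neq k}|\mathbf{x}_j-\mathbf{x}_k|>0$. Then $\{\phi_\beta(\mathbf{x}-\mathbf{x}_j)\}_{j\in\mathbb{N}}$ is a Riesz sequence in $\mathcal{K}_{\beta-n/2}(\mathbb{R}^n)$ for every $n\ge 2$, and for $n=1$ under the additional assumption $\delta(X)>2B(\beta-1/2,1/2)$.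
   Context: Fourier transform: $\widehat f(\xi)=\int_{\mathbb{R}^n}e^{-i\xi\cdot\mathbf{x}}f(\mathbf{x})d\mathbf{x}$. $K_\nu$ is the modified Bessel function of the second kind. For $\alpha>0$, $\mathcal{K}_\alpha(\mathbb{R}^n)=\{f\in C(\mathbb{R}^n)\cap L^2(\mathbb{R}^n): \int_{\mathbb{R}^n}\frac{|\widehat f(\xi)|^2}{K_\alpha(|\xi|)|\xi|^\alpha}d\xi<\infty\}$. For $\gamma>0$, $G_\gamma(\xi)=G_\gamma(|\xi|)$ with $G_\gamma(z)=\frac{1}{2^{\gamma-1+\frac n2}\pi^{\frac n2}\Gamma(\gamma)}K_{\gamma-\frac n2}(z)z^{\gamma-\frac n2}$ for $z>0$ (value at $0$ by continuity). $B$ is the Euler beta function. A system $\{f_j\}$ in a Hilbert space $H$ is a Riesz sequence if there are $0<A\le B'<\infty$ with $A\sum_j|c_j|^2\le\|\sum_jc_jf_j\|_H^2\le B'\sum_j|c_j|^2$ for all finitely supported complex sequences $(c_j)$ (equivalently, its Gramian matrix defines a bounded invertible operator on $\ell^2(\mathbb{N})$). *)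

theory Defs
  imports "HOL-Analysis.Analysis"
begin

text \<open>Modified Bessel function of the second kind, via the standard integral
  representation K_nu(z) = int_0^infty exp(-z cosh t) cosh(nu t) dt  (z > 0).\<close>
definition BesselK :: "real \<Rightarrow> real \<Rightarrow> real" where
  "BesselK nu z = integral {0..} (\<lambda>t. exp (- z * cosh t) * cosh (nu * t))"

definition square_integrable :: "('a::euclidean_space \<Rightarrow> complex) \<Rightarrow> bool" where
  "square_integrable f \<longleftrightarrow> f \<in> borel_measurable lborel \<and>
     integrable lborel (\<lambda>x. (cmod (f x))\<^sup>2)"

definition fourier_L1 :: "('a::euclidean_space \<Rightarrow> complex) \<Rightarrow> 'a \<Rightarrow> complex" where
  "fourier_L1 f \<xi> = (LINT x|lborel. exp (- \<i> * complex_of_real (\<xi> \<bullet> x)) * f x)"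

text \<open>Plancherel extension to L^2: g is the Fourier transform of f if the transforms
  of the truncations f * 1_{ball 0 R} converge to g in L^2.\<close>
definition has_L2_fourier :: "('a::euclidean_space \<Rightarrow> complex) \<Rightarrow> ('a \<Rightarrow> complex) \<Rightarrow> bool" where
  "has_L2_fourier f g \<longleftrightarrow> square_integrable g \<and>
     (\<lambda>R::nat. LINT \<xi>|lborel.
        (cmod (g \<xi> - fourier_L1 (\<lambda>x. indicator (ball 0 (real R)) x * f x) \<xi>))\<^sup>2)
       \<longlonglongrightarrow> 0"

definition fourier_L2 :: "('a::euclidean_space \<Rightarrow> complex) \<Rightarrow> 'a \<Rightarrow> complex" where
  "fourier_L2 f = (SOME g. has_L2_fourier f g)"

definition Kspace :: "real \<Rightarrow> ('a::euclidean_space \<Rightarrow> complex) set" where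
  "Kspace \<alpha> = {f. continuous_on UNIV f \<and> square_integrable f \<and>
      (\<exists>g. has_L2_fourier f g \<and>
         integrable lborel (\<lambda>\<xi>. (cmod (g \<xi>))\<^sup>2 / (BesselK \<alpha> (norm \<xi>) * norm \<xi> powr \<alpha>)))}"

definition Gform :: "nat \<Rightarrow> real \<Rightarrow> real \<Rightarrow> real" where
  "Gform n \<gamma> z = BesselK (\<gamma> - real n / 2) z * z powr (\<gamma> - real n / 2) /
     (2 powr (\<gamma> - 1 + real n / 2) * pi powr (real n / 2) * Gamma \<gamma>)"

definition Gfun :: "nat \<Rightarrow> real \<Rightarrow> real \<Rightarrow> real" where
  "Gfun n \<gamma> z = (if z > 0 then Gform n \<gamma> z else Lim (at_right 0) (Gform n \<gamma>))"

definition Kip :: "real \<Rightarrow> ('a::euclidean_space \<Rightarrow> complex) \<Rightarrow> ('a \<Rightarrow> complex) \<Rightarrow> complex" where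
  "Kip \<beta> f g = complex_of_real ((2 * pi) powr (- 2 * real DIM('a))) *
     (LINT \<xi>|lborel. fourier_L2 f \<xi> * cnj (fourier_L2 g \<xi>) /
        complex_of_real (Gfun DIM('a) \<beta> (norm \<xi>)))"

definition phi :: "real \<Rightarrow> 'a::euclidean_space \<Rightarrow> complex" where
  "phi \<beta> x = complex_of_real ((1 + (norm x)\<^sup>2) powr (- \<beta>))"

text \<open>H (with ip) is a Hilbert space of functions on 'a with reproducing kernel k.
  By the Moore-Aronszajn uniqueness theorem this says H is "the" RKHS of k.\<close>
definition is_rkhs :: "('a \<Rightarrow> complex) set \<Rightarrow> (('a \<Rightarrow> complex) \<Rightarrow> ('a \<Rightarrow> complex) \<Rightarrow> complex)
    \<Rightarrow> ('a \<Rightarrow> 'a \<Rightarrow> complex) \<Rightarrow> bool" where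
  "is_rkhs H ip k \<longleftrightarrow>
     (\<lambda>_. 0) \<in> H \<and>
     (\<forall>f\<in>H. \<forall>g\<in>H. (\<lambda>x. f x + g x) \<in> H) \<and>
     (\<forall>f\<in>H. \<forall>c. (\<lambda>x. c * f x) \<in> H) \<and>
     (\<forall>f\<in>H. \<forall>g\<in>H. \<forall>h\<in>H. \<forall>a b.
         ip (\<lambda>x. a * f x + b * g x) h = a * ip f h + b * ip g h) \<and>
     (\<forall>f\<in>H. \<forall>g\<in>H. ip g f = cnj (ip f g)) \<and>
     (\<forall>f\<in>H. Im (ip f f) = 0 \<and> Re (ip f f) \<ge> 0) \<and>
     (\<forall>f\<in>H. ip f f = 0 \<longrightarrow> f = (\<lambda>_. 0)) \<and>
     (\<forall>s. (\<forall>m. s m \<in> H) \<and>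
          (\<forall>e>0. \<exists>N. \<forall>m\<ge>N. \<forall>p\<ge>N.
              Re (ip (\<lambda>x. s m x - s p x) (\<lambda>x. s m x - s p x)) < e)
        \<longrightarrow> (\<exists>f\<in>H. (\<lambda>m. Re (ip (\<lambda>x. s m x - f x) (\<lambda>x. s m x - f x))) \<longlonglongrightarrow> 0)) \<and>
     (\<forall>y. (\<lambda>x. k x y) \<in> H) \<and>
     (\<forall>f\<in>H. \<forall>y. ip f (\<lambda>x. k x y) = f y)"

definition riesz_sequence :: "('a \<Rightarrow> complex) set \<Rightarrow> (('a \<Rightarrow> complex) \<Rightarrow> ('a \<Rightarrow> complex) \<Rightarrow> complex)
    \<Rightarrow> (nat \<Rightarrow> 'a \<Rightarrow> complex) \<Rightarrow> bool" where
  "riesz_sequence H ip v \<longleftrightarrow> (\<forall>j. v j \<in> H) \<and>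
     (\<exists>A B. 0 < A \<and> A \<le> B \<and>
        (\<forall>F c. finite F \<longrightarrow>
           A * (\<Sum>j\<in>F. (cmod (c j))\<^sup>2)
             \<le> Re (ip (\<lambda>x. \<Sum>j\<in>F. c j * v j x) (\<lambda>x. \<Sum>j\<in>F. c j * v j x)) \<and>
           Re (ip (\<lambda>x. \<Sum>j\<in>F. c j * v j x) (\<lambda>x. \<Sum>j\<in>F. c j * v j x))
             \<le> B * (\<Sum>j\<in>F. (cmod (c j))\<^sup>2)))"

definition sep_dist :: "(nat \<Rightarrow> 'a::metric_space) \<Rightarrow> real" where
  "sep_dist X = Inf {dist (X j) (X k) | j k. j \<noteq> k}"

end

theory Submission
  imports Defs "HOL-Probability.Probability" "HOL-Real_Asymp.Real_Asymp"
begin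

text \<open>
  The function \<^term>\<open>phi \<beta>\<close> is a mixture of Gaussians with a Gamma distributed scale. Integrating
  the Gaussian Fourier transform against the mixing weight and substituting
  \<open>t = (\<bar>\<xi>\<bar> / 2) exp s\<close> gives the Bessel formula: the transform of \<^term>\<open>phi \<beta>\<close> is
  \<open>(2 \<pi>)^n G_\<beta>\<close>, which is positive, bounded and integrable. Hence \<open>f \<mapsto> f^ / sqrt G_\<beta>\<close> maps
  the native space isometrically (up to a constant) onto all of \<open>L^2\<close>: if \<open>u\<close> is square integrable,
  then \<open>u sqrt G_\<beta>\<close> lies in \<open>L^1 \<inter> L^2\<close> and its inverse transform is continuous. Completeness
  is then Riesz--Fischer, and the reproducing property is Fourier inversion.

  For part (ii) the Gram matrix has entries \<open>phi \<beta> (x_i - x_j)\<close>. Its row sums are bounded by a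
  packing argument, which gives the upper bound. For the lower bound, every Gaussian in the mixture has a
  positive semidefinite Gram matrix, and the sufficiently narrow ones have a diagonally dominant one
  because the points are separated.
\<close>

section \<open>Gaussians and their Fourier transforms\<close>

text \<open>The L^2 transform is specified as a limit of transforms of truncations, so an L^2 theory
  has to stand before the native space can be treated. A Plancherel inequality carries it: it gives
  the Cauchy property and the limits. Parseval's equality is never called upon, because
  \<open>Kip\<close> already defines the norm as a weighted L^2 norm of the transform. Its usual
  role is taken by inversion: a heat kernel is the transform of an explicit integrable function, so
  testing against such functions recovers a continuous function pointwise and shows that an
  integrable function with zero transform vanishes.

  The transform of \<open>phi \<beta>\<close> is kept as a mixture integral
  \<open>phi_symbol\<close>, which is meaningful at the origin too; the Bessel formula is
  established for nonzero frequencies, a set of full measure.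

  The lower Riesz constant is half the normalised Gamma mass beyond a threshold \<open>T\<close>,
  chosen so that the off-diagonal row sums of every Gaussian Gram matrix with parameter at least
  \<open>T\<close> are at most 1/2. Smaller parameters contribute a nonnegative amount.\<close>

definition osc :: "'a::euclidean_space \<Rightarrow> 'a \<Rightarrow> complex" where
  "osc \<xi> x = exp (- \<i> * complex_of_real (\<xi> \<bullet> x))"

definition gauss :: "real \<Rightarrow> 'a::euclidean_space \<Rightarrow> real" where
  "gauss t x = exp (- t * (norm x)\<^sup>2)"

lemma fourier_L1_osc: "fourier_L1 f \<xi> = (LINT x|lborel. osc \<xi> x * f x)"
  by (simp add: fourier_L1_def osc_def)

lemma norm_osc [simp]: "cmod (osc \<xi> x) = 1"
  by (simp add: osc_def)

lemma osc_zero [simp]: "osc 0 x = 1" "osc \<xi> 0 = 1"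
  by (simp_all add: osc_def)

lemma osc_measurable [measurable (raw)]:
  assumes "f \<in> borel_measurable M" "g \<in> borel_measurable M"
  shows "(\<lambda>x. osc (f x) (g x)) \<in> borel_measurable M"
  unfolding osc_def using assms by measurable

lemma osc_commute: "osc x y = osc y x"
  by (simp add: osc_def inner_commute)

lemma osc_minus: "osc (- x) y = cnj (osc x y)" "osc x (- y) = cnj (osc x y)"
  by (simp_all add: osc_def exp_cnj)

lemma osc_add: "osc x (y + z) = osc x y * osc x z" "osc (y + z) x = osc y x * osc z x"
  by (simp_all add: osc_def inner_add_right inner_add_left ring_distribs exp_add exp_diff exp_minus field_simps)

lemma osc_diff: "osc x (y - z) = osc x y * cnj (osc x z)" "osc (y - z) x = osc y x * cnj (osc z x)"
  using osc_add(1)[of x y "- z"] osc_add(2)[of y "-z" x] by (simp_all add: osc_minus)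

lemma gauss_pos [simp]: "0 < gauss t x" "0 \<le> gauss t x"
  by (simp_all add: gauss_def)

lemma gauss_le_1: "0 \<le> t \<Longrightarrow> gauss t x \<le> 1"
  by (simp add: gauss_def)

lemma gauss_measurable [measurable]: "(\<lambda>x. gauss t x) \<in> borel_measurable borel"
  unfolding gauss_def by measurable

lemma gauss_diff_commute: "gauss t (x - y) = gauss t (y - x)"
  by (simp add: gauss_def norm_minus_commute)

lemma gauss_mult: "gauss s x * gauss t x = gauss (s + t) x"
  by (simp add: gauss_def exp_add [symmetric] algebra_simps)

lemma gauss_prod: "gauss t x = (\<Prod>b\<in>Basis. gauss t (x \<bullet> b))"
proof -
  have "(norm x)\<^sup>2 = (\<Sum>b\<in>Basis. (x \<bullet> b)\<^sup>2)"
    unfolding power2_norm_eq_inner by (subst euclidean_inner) (simp add: power2_eq_square)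
  then show ?thesis
    by (simp add: gauss_def sum_distrib_left exp_sum flip: sum_negf)
qed

lemma osc_prod: "osc \<xi> x = (\<Prod>b\<in>Basis. osc (\<xi> \<bullet> b) (x \<bullet> b))"
proof -
  have "\<xi> \<bullet> x = (\<Sum>b\<in>Basis. (\<xi> \<bullet> b) * (x \<bullet> b))"
    by (rule euclidean_inner)
  then show ?thesis
    by (simp add: osc_def exp_sum [symmetric] sum_distrib_left sum_negf mult.commute)
qed

text \<open>Lebesgue measure on the Euclidean space is the image of the product measure over
  \<open>Basis\<close>, so Fubini splits the integral by coordinates. This reduces the Gaussian
  transform to dimension one.\<close>

lemma integral_prod_Basis:
  fixes f :: "'a::euclidean_space \<Rightarrow> real \<Rightarrow> complex"
  assumes "\<And>b. b \<in> Basis \<Longrightarrow> integrable lborel (f b)"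
  shows "integrable lborel (\<lambda>x::'a. \<Prod>b\<in>Basis. f b (x \<bullet> b))"
    and "(LINT x|lborel. (\<Prod>b\<in>Basis. f b (x \<bullet> b))) = (\<Prod>b\<in>Basis. LINT u|lborel. f b u)"
proof -
  interpret product_sigma_finite "\<lambda>b::'a. lborel :: real measure"
    by standard
  have [measurable]: "b \<in> Basis \<Longrightarrow> f b \<in> borel_measurable borel" for b
    using assms[of b] by (auto dest: borel_measurable_integrable)
  have T: "(\<lambda>g. \<Sum>b\<in>Basis. g b *\<^sub>R b) \<in> (\<Pi>\<^sub>M b\<in>(Basis::'a set). lborel) \<rightarrow>\<^sub>M (borel :: 'a measure)"
    by measurable
  have m: "(\<lambda>x::'a. \<Prod>b\<in>Basis. f b (x \<bullet> b)) \<in> borel_measurable borel"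
    by measurable
  have s: "(\<Prod>b\<in>Basis. f b ((\<Sum>c\<in>Basis. g c *\<^sub>R c) \<bullet> b)) = (\<Prod>b\<in>Basis. f b (g b))" for g
    by (intro prod.cong refl) simp
  show "integrable lborel (\<lambda>x::'a. \<Prod>b\<in>Basis. f b (x \<bullet> b))"
    apply (subst lborel_eq)
    by (subst integrable_distr_eq [OF T m], unfold s)
       (intro product_integrable_prod finite_Basis assms)
  show "(LINT x|lborel. (\<Prod>b\<in>Basis. f b (x \<bullet> b))) = (\<Prod>b\<in>Basis. LINT u|lborel. f b u)"
    apply (subst lborel_eq)
    apply (subst integral_distr [OF T m], unfold s)
    by (intro product_integral_prod finite_Basis assms)
qed

lemma gauss_fourier_real:
  fixes \<xi> :: real
  assumes t: "t > 0"
  shows "integrable lborel (\<lambda>x::real. osc \<xi> x * gauss t x)"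
    and "(LINT x|lborel. osc \<xi> x * gauss t x) = complex_of_real (sqrt (pi / t) * gauss (1 / (4 * t)) \<xi>)"
proof -
  \<comment> \<open>Since \<open>c^2 / 2 = t\<close>, the standard normal density at
    \<open>c * x\<close> is a multiple of \<open>gauss t x\<close>, and the known characteristic
    function of the normal law gives the transform.\<close>
  define c where "c = sqrt (2 * t)"
  have c: "c > 0" "c\<^sup>2 = 2 * t" using t by (auto simp: c_def)
  let ?g = "\<lambda>x::real. std_normal_density x *\<^sub>R iexp ((- \<xi> / c) * x)"
  interpret P: prob_space std_normal_distribution by (rule prob_space_normal_density) simp
  have "integrable std_normal_distribution (\<lambda>x. iexp ((- \<xi> / c) * x))"
    by (rule P.integrable_iexp) auto
  then have i: "integrable lborel ?g"
    by (subst (asm) integrable_density) (auto simp: normal_density_nonneg)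
  have eq: "?g (0 + c * x) = (1 / sqrt (2 * pi)) *\<^sub>R (osc \<xi> x * gauss t x)" for x
    using c by (simp add: std_normal_density_def osc_def gauss_def power_mult_distrib scaleR_conv_of_real
        exp_of_real [symmetric] mult.commute)
  have "integrable lborel (\<lambda>x. ?g (0 + c * x))"
    using lborel_integrable_real_affine[OF i, of c 0] c by simp
  then have "integrable lborel (\<lambda>x. (1 / sqrt (2 * pi)) *\<^sub>R (osc \<xi> x * gauss t x))"
    unfolding eq .
  from integrable_scaleR_right [OF this, of "sqrt (2 * pi)"]
  show "integrable lborel (\<lambda>x::real. osc \<xi> x * gauss t x)"
    by simp
  have "complex_of_real (exp (- ((- \<xi> / c)\<^sup>2) / 2)) = char std_normal_distribution (- \<xi> / c)"
    by (simp add: char_std_normal_distribution)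
  also have "\<dots> = (LINT x|lborel. ?g x)"
    unfolding char_def by (subst integral_density) (auto simp: normal_density_nonneg)
  also have "\<dots> = c *\<^sub>R (LINT x|lborel. ?g (0 + c * x))"
    using lborel_integral_real_affine[of c ?g 0] c by simp
  also have "\<dots> = (c / sqrt (2 * pi)) *\<^sub>R (LINT x|lborel. osc \<xi> x * gauss t x)"
    unfolding eq by simp
  finally have "(LINT x|lborel. osc \<xi> x * gauss t x) =
     complex_of_real ((sqrt (2 * pi) / c) * exp (- ((- \<xi> / c)\<^sup>2) / 2))"
    using c by (simp add: scaleR_conv_of_real field_simps)
  also have "sqrt (2 * pi) / c = sqrt (pi / t)"
    unfolding c_def by (simp add: real_sqrt_divide [symmetric])
  also have "exp (- ((- \<xi> / c)\<^sup>2) / 2) = gauss (1 / (4 * t)) \<xi>"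
    using c by (simp add: gauss_def power_divide)
  finally show "(LINT x|lborel. osc \<xi> x * gauss t x) =
    complex_of_real (sqrt (pi / t) * gauss (1 / (4 * t)) \<xi>)" .
qed

lemma gauss_fourier:
  fixes \<xi> :: "'a::euclidean_space"
  assumes t: "t > 0"
  shows "integrable lborel (\<lambda>x. osc \<xi> x * gauss t x)"
    and "(LINT x|lborel. osc \<xi> x * gauss t x) =
      complex_of_real ((pi / t) powr (real DIM('a) / 2) * gauss (1 / (4 * t)) \<xi>)"
proof -
  have eq: "osc \<xi> x * gauss t x = (\<Prod>b\<in>Basis. osc (\<xi> \<bullet> b) (x \<bullet> b) * gauss t (x \<bullet> b))" for x
    by (simp add: osc_prod [of \<xi> x] gauss_prod [of t x] prod.distrib)
  have i: "integrable lborel (\<lambda>u. osc (\<xi> \<bullet> b) u * complex_of_real (gauss t u))" for b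
    by (rule gauss_fourier_real [OF t])
  show "integrable lborel (\<lambda>x. osc \<xi> x * gauss t x)"
    unfolding eq using integral_prod_Basis(1) [where f = "\<lambda>b u. osc (\<xi> \<bullet> b) u * complex_of_real (gauss t u)", OF i] .
  have "(LINT x|lborel. osc \<xi> x * gauss t x)
      = (\<Prod>b\<in>Basis. complex_of_real (sqrt (pi / t) * gauss (1 / (4 * t)) (\<xi> \<bullet> b)))"
    unfolding eq using integral_prod_Basis(2) [where f = "\<lambda>b u. osc (\<xi> \<bullet> b) u * complex_of_real (gauss t u)", OF i]
    by (simp add: gauss_fourier_real [OF t])
  also have "\<dots> = complex_of_real (sqrt (pi / t) ^ DIM('a) * gauss (1 / (4 * t)) \<xi>)"
    by (simp add: prod.distrib gauss_prod [of _ \<xi>])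
  also have "sqrt (pi / t) ^ DIM('a) = (pi / t) powr (real DIM('a) / 2)"
    using t by (simp add: powr_half_sqrt [symmetric] powr_realpow [symmetric] powr_powr)
  finally show "(LINT x|lborel. osc \<xi> x * gauss t x) =
      complex_of_real ((pi / t) powr (real DIM('a) / 2) * gauss (1 / (4 * t)) \<xi>)" .
qed

lemma gauss_integral:
  assumes t: "t > 0"
  shows "integrable lborel (gauss t :: 'a::euclidean_space \<Rightarrow> real)"
    and "(LINT x|lborel. gauss t (x::'a)) = (pi / t) powr (real DIM('a) / 2)"
proof -
  have "integrable lborel (\<lambda>x::'a. complex_of_real (gauss t x))"
    using gauss_fourier(1) [OF t, of 0] by simp
  then show "integrable lborel (gauss t :: 'a \<Rightarrow> real)"
    by (simp add: complex_of_real_integrable_eq)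
  have "complex_of_real (LINT x|lborel. gauss t (x::'a)) = complex_of_real ((pi / t) powr (real DIM('a) / 2))"
    using gauss_fourier(2) [OF t, of "0::'a"] by (simp add: gauss_def)
  then show "(LINT x|lborel. gauss t (x::'a)) = (pi / t) powr (real DIM('a) / 2)"
    using of_real_eq_iff by blast
qed

section \<open>Square integrable functions\<close>

text \<open>Fatou's lemma in the form needed twice: for the limit function in Riesz-Fischer, and for
  letting the Gaussian weight tend to 1 in the Plancherel inequality.\<close>

lemma fatou_bound:
  fixes u :: "nat \<Rightarrow> 'b \<Rightarrow> real"
  assumes u: "\<And>k. integrable M (u k)" "\<And>k x. 0 \<le> u k x" "\<And>k. integral\<^sup>L M (u k) \<le> C"
    and v [measurable]: "v \<in> borel_measurable M"
    and lim: "AE x in M. (\<lambda>k. u k x) \<longlonglongrightarrow> v x"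
  shows "integrable M v" and "integral\<^sup>L M v \<le> C"
proof -
  have [measurable]: "u k \<in> borel_measurable M" for k
    using u(1) by (rule borel_measurable_integrable)
  have C: "0 \<le> C"
    by (rule order_trans [OF _ u(3)[of 0]]) (simp add: u(2))
  have pos: "AE x in M. 0 \<le> v x"
    using lim by eventually_elim (rule LIMSEQ_le_const, auto simp: u(2))
  have "(\<integral>\<^sup>+x. ennreal (v x) \<partial>M) = (\<integral>\<^sup>+x. liminf (\<lambda>k. ennreal (u k x)) \<partial>M)"
    using lim by (intro nn_integral_cong_AE, eventually_elim)
      (auto intro!: lim_imp_Liminf [symmetric] tendsto_ennrealI)
  also have "\<dots> \<le> liminf (\<lambda>k. \<integral>\<^sup>+x. ennreal (u k x) \<partial>M)"
    by (rule nn_integral_liminf) simp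
  also have "\<dots> \<le> liminf (\<lambda>k::nat. ennreal C)"
    by (intro Liminf_mono always_eventually allI)
       (simp add: nn_integral_eq_integral u ennreal_leI)
  also have "\<dots> = ennreal C"
    by (simp add: Liminf_const)
  finally have le: "(\<integral>\<^sup>+x. ennreal (v x) \<partial>M) \<le> ennreal C" .
  show i: "integrable M v"
    using pos le by (intro integrableI_nonneg) (auto simp: le_less_trans)
  show "integral\<^sup>L M v \<le> C"
    using le C by (simp add: nn_integral_eq_integral [OF i pos])
qed

lemma integral_lborel_shift:
  fixes h :: "'a::euclidean_space \<Rightarrow> 'b::{banach, second_countable_topology}"
  assumes [measurable]: "h \<in> borel_measurable borel"
  shows "(LINT x|lborel. h (x - y)) = (LINT x|lborel. h x)"
    and "integrable lborel (\<lambda>x. h (x - y)) \<longleftrightarrow> integrable lborel h"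
proof -
  have "(LINT x|lborel. h x) = (LINT x|distr lborel borel ((+) (- y)). h x)"
    by (simp only: lborel_distr_plus)
  also have "\<dots> = (LINT x|lborel. h (x - y))"
    by (subst integral_distr) simp_all
  finally show "(LINT x|lborel. h (x - y)) = (LINT x|lborel. h x)" ..
  have "integrable lborel h \<longleftrightarrow> integrable (distr lborel borel ((+) (- y))) h"
    by (simp only: lborel_distr_plus)
  also have "\<dots> \<longleftrightarrow> integrable lborel (\<lambda>x. h (x - y))"
    by (subst integrable_distr_eq) simp_all
  finally show "integrable lborel (\<lambda>x. h (x - y)) \<longleftrightarrow> integrable lborel h" ..
qed

lemma square_integrable_measurable [measurable_dest]:
  "square_integrable f \<Longrightarrow> f \<in> borel_measurable borel"
  by (simp add: square_integrable_def)

lemma cmod_add_power2_le: "(cmod (a + b))\<^sup>2 \<le> 2 * (cmod a)\<^sup>2 + 2 * (cmod b)\<^sup>2"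
proof -
  have "(cmod (a + b))\<^sup>2 \<le> (cmod a + cmod b)\<^sup>2"
    by (intro power_mono norm_triangle_ineq) simp
  also have "\<dots> \<le> 2 * (cmod a)\<^sup>2 + 2 * (cmod b)\<^sup>2"
    using sum_squares_bound[of "cmod a" "cmod b"] by (simp add: power2_sum)
  finally show ?thesis .
qed

lemma cmod_mult_le_squares: "cmod (a * b) \<le> (cmod a)\<^sup>2 + (cmod b)\<^sup>2"
  using sum_squares_bound[of "cmod a" "cmod b"] zero_le_power2[of "cmod a"] zero_le_power2[of "cmod b"]
  unfolding norm_mult by linarith

lemma square_integrable_add:
  assumes f: "square_integrable f" and g: "square_integrable g"
  shows "square_integrable (\<lambda>x. f x + g x)"
    and "(LINT x|lborel. (cmod (f x + g x))\<^sup>2) \<le>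
      2 * (LINT x|lborel. (cmod (f x))\<^sup>2) + 2 * (LINT x|lborel. (cmod (g x))\<^sup>2)"
proof -
  note [measurable] = f g
  have i: "integrable lborel (\<lambda>x. 2 * (cmod (f x))\<^sup>2 + 2 * (cmod (g x))\<^sup>2)"
    using f g by (auto simp: square_integrable_def)
  have j: "integrable lborel (\<lambda>x. (cmod (f x + g x))\<^sup>2)"
    by (rule Bochner_Integration.integrable_bound [OF i])
       (auto simp: cmod_add_power2_le)
  then show "square_integrable (\<lambda>x. f x + g x)"
    by (simp add: square_integrable_def)
  have "(LINT x|lborel. (cmod (f x + g x))\<^sup>2) \<le> (LINT x|lborel. 2 * (cmod (f x))\<^sup>2 + 2 * (cmod (g x))\<^sup>2)"
    by (intro integral_mono i j cmod_add_power2_le)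
  also have "\<dots> = 2 * (LINT x|lborel. (cmod (f x))\<^sup>2) + 2 * (LINT x|lborel. (cmod (g x))\<^sup>2)"
    using f g by (subst Bochner_Integration.integral_add) (auto simp: square_integrable_def)
  finally show "(LINT x|lborel. (cmod (f x + g x))\<^sup>2) \<le>
      2 * (LINT x|lborel. (cmod (f x))\<^sup>2) + 2 * (LINT x|lborel. (cmod (g x))\<^sup>2)" .
qed

lemma square_integrable_cmult:
  "square_integrable f \<Longrightarrow> square_integrable (\<lambda>x. c * f x)"
  by (auto simp: square_integrable_def norm_mult power_mult_distrib)

lemma square_integrable_diff:
  assumes f: "square_integrable f" and g: "square_integrable g"
  shows "square_integrable (\<lambda>x. f x - g x)"
  using square_integrable_add(1) [OF f square_integrable_cmult [OF g, of "-1"]] by simp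

lemma square_integrable_diff_triangle:
  assumes f: "square_integrable f" and g: "square_integrable g" and h: "square_integrable h"
  shows "(LINT x|lborel. (cmod (f x - g x))\<^sup>2) \<le>
      2 * (LINT x|lborel. (cmod (f x - h x))\<^sup>2) + 2 * (LINT x|lborel. (cmod (g x - h x))\<^sup>2)"
  using square_integrable_add(2) [OF square_integrable_diff [OF f h] square_integrable_diff [OF h g]]
  by (simp add: norm_minus_commute)

lemma square_integrable_mult_integrable:
  assumes f: "square_integrable f" and g: "square_integrable g"
  shows "integrable lborel (\<lambda>x. f x * g x)"
proof (rule Bochner_Integration.integrable_bound)
  show "integrable lborel (\<lambda>x. (cmod (f x))\<^sup>2 + (cmod (g x))\<^sup>2)"
    using f g by (auto simp: square_integrable_def)
  show "(\<lambda>x. f x * g x) \<in> borel_measurable lborel"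
    using f g by (auto simp: square_integrable_def)
  show "AE x in lborel. cmod (f x * g x) \<le> norm ((cmod (f x))\<^sup>2 + (cmod (g x))\<^sup>2)"
    by (intro always_eventually allI order.trans[OF cmod_mult_le_squares]) simp
qed

text \<open>The integral of \<open>(|f| - r |g|)^2\<close> is a nonnegative quadratic polynomial in
  \<open>r\<close>; the bound follows by evaluating it at its minimiser
  \<open>r = c / b\<close>.\<close>

lemma integral_Cauchy_Schwarz:
  assumes f: "square_integrable f" and g: "square_integrable g"
  shows "(cmod (LINT x|lborel. f x * g x))\<^sup>2 \<le>
    (LINT x|lborel. (cmod (f x))\<^sup>2) * (LINT x|lborel. (cmod (g x))\<^sup>2)"
proof -
  define a where "a = (LINT x|lborel. (cmod (f x))\<^sup>2)"
  define b where "b = (LINT x|lborel. (cmod (g x))\<^sup>2)"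
  define c where "c = (LINT x|lborel. cmod (f x * g x))"
  have i: "integrable lborel (\<lambda>x. (cmod (f x))\<^sup>2)" "integrable lborel (\<lambda>x. (cmod (g x))\<^sup>2)"
    "integrable lborel (\<lambda>x. cmod (f x * g x))"
    using f g square_integrable_mult_integrable[OF f g] by (auto simp: square_integrable_def)
  have q: "0 \<le> a - 2 * r * c + r\<^sup>2 * b" for r
  proof -
    have "0 \<le> (LINT x|lborel. (cmod (f x) - r * cmod (g x))\<^sup>2)"
      by simp
    also have "\<dots> = (LINT x|lborel. ((cmod (f x))\<^sup>2 - (2 * r) * cmod (f x * g x)) + r\<^sup>2 * (cmod (g x))\<^sup>2)"
      by (simp add: power2_eq_square norm_mult algebra_simps)
    also have "\<dots> = a - 2 * r * c + r\<^sup>2 * b"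
      unfolding a_def b_def c_def using i
      by (subst Bochner_Integration.integral_add Bochner_Integration.integral_diff;
          (intro Bochner_Integration.integrable_diff integrable_mult_right)?; simp)+
    finally show ?thesis .
  qed
  have nn: "0 \<le> b" "0 \<le> c" "0 \<le> a" by (simp_all add: a_def b_def c_def)
  have "c\<^sup>2 \<le> a * b"
  proof (cases "b = 0")
    case True
    have "c = 0"
    proof (rule ccontr)
      assume "c \<noteq> 0"
      \<comment> \<open>When \<open>b = 0\<close> the polynomial is affine in \<open>r\<close>, and
        this choice of \<open>r\<close> gives it the value \<open>-1\<close>.\<close>
      then show False using q[of "(a + 1) / (2 * c)"] True by simp
    qed
    then show ?thesis using True by simp
  next
    case False
    with nn have "0 < b" by simp
    then show ?thesis using q[of "c / b"] by (simp add: field_simps power2_eq_square)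
  qed
  moreover have "(cmod (LINT x|lborel. f x * g x))\<^sup>2 \<le> c\<^sup>2"
    unfolding c_def by (intro power_mono integral_norm_bound) simp
  ultimately show ?thesis by (simp add: a_def b_def)
qed

lemma square_integrable_mult_tendsto:
  assumes s: "\<And>m. square_integrable (s m)" and f: "square_integrable f" and g: "square_integrable g"
    and lim: "(\<lambda>m. LINT x|lborel. (cmod (f x - s m x))\<^sup>2) \<longlonglongrightarrow> 0"
  shows "(\<lambda>m. LINT x|lborel. s m x * g x) \<longlonglongrightarrow> (LINT x|lborel. f x * g x)"
proof -
  let ?b = "LINT x|lborel. (cmod (g x))\<^sup>2"
  have e: "(LINT x|lborel. (f x - s m x) * g x) = (LINT x|lborel. f x * g x) - (LINT x|lborel. s m x * g x)" for m
    by (simp add: left_diff_distrib square_integrable_mult_integrable s f g)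
  have "(\<lambda>m. (LINT x|lborel. (cmod (f x - s m x))\<^sup>2) * ?b) \<longlonglongrightarrow> 0 * ?b"
    by (intro tendsto_mult lim tendsto_const)
  then have L: "(\<lambda>m. (LINT x|lborel. (cmod (f x - s m x))\<^sup>2) * ?b) \<longlonglongrightarrow> 0"
    by (simp only: mult_zero_left)
  have "(\<lambda>m. (cmod (LINT x|lborel. (f x - s m x) * g x))\<^sup>2) \<longlonglongrightarrow> 0"
  proof (rule tendsto_sandwich)
    show "\<forall>\<^sub>F m in sequentially. 0 \<le> (cmod (LINT x|lborel. (f x - s m x) * g x))\<^sup>2"
      by (rule always_eventually) simp
    show "\<forall>\<^sub>F m in sequentially. (cmod (LINT x|lborel. (f x - s m x) * g x))\<^sup>2
        \<le> (LINT x|lborel. (cmod (f x - s m x))\<^sup>2) * ?b"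
      by (rule always_eventually, rule allI, rule integral_Cauchy_Schwarz [OF square_integrable_diff [OF f s] g])
    show "(\<lambda>m. (LINT x|lborel. (cmod (f x - s m x))\<^sup>2) * ?b) \<longlonglongrightarrow> 0"
      by (rule L)
  qed (rule tendsto_const)
  then have "(\<lambda>m. LINT x|lborel. (f x - s m x) * g x) \<longlonglongrightarrow> 0"
    by (simp add: tendsto_norm_zero_iff)
  from tendsto_diff [OF tendsto_const [of "LINT x|lborel. f x * g x"] this]
  show ?thesis by (simp add: e)
qed

lemma square_integrable_zero_AE:
  assumes f: "square_integrable f" and z: "(LINT x|lborel. (cmod (f x))\<^sup>2) = 0"
  shows "AE x in lborel. f x = 0"
  using z f by (subst (asm) integral_nonneg_eq_0_iff_AE) (auto simp: square_integrable_def)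

lemma square_integrable_limit_unique:
  assumes s: "\<And>m. square_integrable (s m)" and f: "square_integrable f" and g: "square_integrable g"
    and "(\<lambda>m. LINT x|lborel. (cmod (f x - s m x))\<^sup>2) \<longlonglongrightarrow> 0"
    and "(\<lambda>m. LINT x|lborel. (cmod (g x - s m x))\<^sup>2) \<longlonglongrightarrow> 0"
  shows "AE x in lborel. f x = g x"
proof -
  have "(\<lambda>m. 2 * (LINT x|lborel. (cmod (f x - s m x))\<^sup>2) + 2 * (LINT x|lborel. (cmod (g x - s m x))\<^sup>2))
      \<longlonglongrightarrow> 2 * 0 + 2 * 0"
    by (intro tendsto_intros assms)
  then have "(\<lambda>m. 2 * (LINT x|lborel. (cmod (f x - s m x))\<^sup>2) + 2 * (LINT x|lborel. (cmod (g x - s m x))\<^sup>2))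
      \<longlonglongrightarrow> 0"
    by simp
  then have "(LINT x|lborel. (cmod (f x - g x))\<^sup>2) \<le> 0"
    by (rule LIMSEQ_le_const) (use square_integrable_diff_triangle [OF f g s] in auto)
  then have "(LINT x|lborel. (cmod (f x - g x))\<^sup>2) = 0"
    by (intro antisym) auto
  from square_integrable_zero_AE [OF square_integrable_diff [OF f g] this] show ?thesis
    by simp
qed

section \<open>Completeness of L^2\<close>

lemma ennreal_le_suminf: "u k \<le> (\<Sum>k. u k)" for u :: "nat \<Rightarrow> ennreal"
  using sum_le_suminf[of u "{k}"] by simp

text \<open>With weights \<open>2^k\<close> the squared increments still have integrals at most
  \<open>(1/2)^k\<close>, so their weighted sum is finite almost everywhere. At such a point the
  k-th increment is at most a constant times \<open>sqrt (1/2) ^ k\<close>, and the telescoping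
  series converges.\<close>

lemma AE_convergent_if_fast_Cauchy:
  fixes s :: "nat \<Rightarrow> 'a::euclidean_space \<Rightarrow> complex"
  assumes s: "\<And>m. square_integrable (s m)"
    and fast: "\<And>k. (LINT x|lborel. (cmod (s (Suc k) x - s k x))\<^sup>2) \<le> (1/4)^k"
  shows "AE x in lborel. convergent (\<lambda>k. s k x)"
proof -
  note [measurable] = s
  have i: "integrable lborel (\<lambda>x. (cmod (s (Suc k) x - s k x))\<^sup>2)" for k
    using square_integrable_diff [OF s s] by (simp add: square_integrable_def)
  let ?u = "\<lambda>k x. ennreal (2^k * (cmod (s (Suc k) x - s k x))\<^sup>2)"
  have "(\<integral>\<^sup>+x. (\<Sum>k. ?u k x) \<partial>lborel) = (\<Sum>k. \<integral>\<^sup>+x. ?u k x \<partial>lborel)"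
    by (rule nn_integral_suminf) measurable
  also have "\<dots> \<le> (\<Sum>k. ennreal ((1/2)^k))"
  proof (intro suminf_le summableI)
    fix k
    have "(\<integral>\<^sup>+x. ?u k x \<partial>lborel) = ennreal (2^k * (LINT x|lborel. (cmod (s (Suc k) x - s k x))\<^sup>2))"
      using i[of k] by (subst nn_integral_eq_integral) auto
    also have "\<dots> \<le> ennreal ((1/2)^k)"
    proof (rule ennreal_leI)
      have "2^k * (LINT x|lborel. (cmod (s (Suc k) x - s k x))\<^sup>2) \<le> 2^k * (1/4::real)^k"
        by (intro mult_left_mono fast) simp
      also have "\<dots> = (1/2)^k" by (simp flip: power_mult_distrib)
      finally show "2^k * (LINT x|lborel. (cmod (s (Suc k) x - s k x))\<^sup>2) \<le> (1/2)^k" .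
    qed
    finally show "(\<integral>\<^sup>+x. ?u k x \<partial>lborel) \<le> ennreal ((1/2)^k)" .
  qed
  also have "\<dots> = ennreal (\<Sum>k. (1/2)^k)"
    by (intro suminf_ennreal2) (auto intro: summable_geometric)
  also have "\<dots> < \<infinity>" by simp
  finally have "(\<integral>\<^sup>+x. (\<Sum>k. ?u k x) \<partial>lborel) \<noteq> \<infinity>" by simp
  then have "AE x in lborel. (\<Sum>k. ?u k x) \<noteq> \<infinity>"
    by (intro nn_integral_noteq_infinite) auto
  then show ?thesis
  proof eventually_elim
    fix x assume fin: "(\<Sum>k. ?u k x) \<noteq> \<infinity>"
    define S where "S = enn2real (\<Sum>k. ?u k x)"
    have S: "(\<Sum>k. ?u k x) = ennreal S"
      using fin by (simp add: S_def less_top)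
    have S0: "0 \<le> S" by (simp add: S_def)
    have bnd: "cmod (s (Suc k) x - s k x) \<le> sqrt S * (sqrt (1/2))^k" for k
    proof -
      have "?u k x \<le> (\<Sum>k. ?u k x)"
        by (rule ennreal_le_suminf)
      then have "2^k * (cmod (s (Suc k) x - s k x))\<^sup>2 \<le> S"
        unfolding S using S0 by simp
      then have "(cmod (s (Suc k) x - s k x))\<^sup>2 \<le> S * (1/2)^k"
        by (simp add: field_simps)
      from real_sqrt_le_mono [OF this] show ?thesis
        by (simp add: real_sqrt_mult real_sqrt_power)
    qed
    have "summable (\<lambda>k. sqrt S * (sqrt (1/2))^k)"
      by (intro summable_mult summable_geometric) (simp add: real_sqrt_lt_1_iff)
    then have "summable (\<lambda>k. s (Suc k) x - s k x)"
      by (rule summable_comparison_test' [where N = 0]) (rule bnd)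
    then have "(\<lambda>n. \<Sum>k<n. s (Suc k) x - s k x) \<longlonglongrightarrow> (\<Sum>k. s (Suc k) x - s k x)"
      by (rule summable_LIMSEQ)
    then have "(\<lambda>n. s n x - s 0 x) \<longlonglongrightarrow> (\<Sum>k. s (Suc k) x - s k x)"
      by (simp add: sum_lessThan_telescope [of "\<lambda>k. s k x"])
    from tendsto_add [OF this tendsto_const [of "s 0 x"]]
    show "convergent (\<lambda>k. s k x)"
      by (auto simp: convergent_def)
  qed
qed

theorem Riesz_Fischer:
  fixes s :: "nat \<Rightarrow> 'a::euclidean_space \<Rightarrow> complex"
  assumes s: "\<And>m. square_integrable (s m)"
    and Cauchy: "\<And>e. e > 0 \<Longrightarrow> \<exists>N. \<forall>m\<ge>N. \<forall>p\<ge>N. (LINT x|lborel. (cmod (s m x - s p x))\<^sup>2) < e"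
  obtains h where "square_integrable h" "(\<lambda>m. LINT x|lborel. (cmod (h x - s m x))\<^sup>2) \<longlonglongrightarrow> 0"
proof -
  note [measurable] = s
  have "\<forall>k. \<exists>N. \<forall>m\<ge>N. \<forall>p\<ge>N. (LINT x|lborel. (cmod (s m x - s p x))\<^sup>2) < (1/4)^k"
    by (intro allI Cauchy) simp
  then obtain N where N: "\<And>k m p. m \<ge> N k \<Longrightarrow> p \<ge> N k \<Longrightarrow> (LINT x|lborel. (cmod (s m x - s p x))\<^sup>2) < (1/4)^k"
    by metis
  \<comment> \<open>The partial sums make both \<open>r k\<close> and \<open>r (Suc k)\<close> at
    least \<open>N k\<close>, as a bound on consecutive increments requires; the summand
    \<open>k\<close> forces \<open>r\<close> to infinity.\<close>
  define r where "r k = (\<Sum>i\<le>k. N i) + k" for k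
  have r: "N k \<le> r k" "N k \<le> r (Suc k)" "k \<le> r k" for k
  proof -
    have "N k \<le> (\<Sum>i\<le>k. N i)" "(\<Sum>i\<le>k. N i) \<le> (\<Sum>i\<le>Suc k. N i)"
      by (auto intro: member_le_sum)
    then show "N k \<le> r k" "N k \<le> r (Suc k)" "k \<le> r k"
      by (simp_all add: r_def)
  qed
  have "AE x in lborel. convergent (\<lambda>k. s (r k) x)"
    by (rule AE_convergent_if_fast_Cauchy) (auto simp: s intro!: less_imp_le N r)
  then have conv: "AE x in lborel. (\<lambda>k. s (r k) x) \<longlonglongrightarrow> lim (\<lambda>k. s (r k) x)"
    by eventually_elim (simp add: convergent_LIMSEQ_iff)
  define h where "h x = lim (\<lambda>k. s (r k) x)" for x
  have [measurable]: "h \<in> borel_measurable borel"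
    unfolding h_def by measurable
  \<comment> \<open>Fatou along the subsequence with \<open>m\<close> fixed. Starting the
    subsequence at \<open>M\<close> guarantees indices \<open>r (k + M) \<ge> M\<close>, to which
    the assumed bound applies.\<close>
  have est: "integrable lborel (\<lambda>x. (cmod (h x - s m x))\<^sup>2)" "(LINT x|lborel. (cmod (h x - s m x))\<^sup>2) \<le> e"
    if "\<And>p. p \<ge> M \<Longrightarrow> (LINT x|lborel. (cmod (s p x - s m x))\<^sup>2) \<le> e" for M m e
  proof -
    have i: "integrable lborel (\<lambda>x. (cmod (s (r (k + M)) x - s m x))\<^sup>2)" for k
      using square_integrable_diff [OF s s] by (simp add: square_integrable_def)
    have b: "(LINT x|lborel. (cmod (s (r (k + M)) x - s m x))\<^sup>2) \<le> e" for k
      using r(3)[of "k + M"] by (intro that) simp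
    have l: "AE x in lborel. (\<lambda>k. (cmod (s (r (k + M)) x - s m x))\<^sup>2) \<longlonglongrightarrow> (cmod (h x - s m x))\<^sup>2"
      using conv unfolding h_def
      by eventually_elim (intro tendsto_intros LIMSEQ_ignore_initial_segment)
    show "integrable lborel (\<lambda>x. (cmod (h x - s m x))\<^sup>2)"
      by (rule fatou_bound(1) [OF i _ b _ l]) auto
    show "(LINT x|lborel. (cmod (h x - s m x))\<^sup>2) \<le> e"
      by (rule fatou_bound(2) [OF i _ b _ l]) auto
  qed
  show ?thesis
  proof
    have "integrable lborel (\<lambda>x. (cmod (h x - s (N 0) x))\<^sup>2)"
      by (rule est(1)[where M = "N 0" and e = 1]) (use N[of 0] in \<open>auto intro: less_imp_le\<close>)
    then have "square_integrable (\<lambda>x. h x - s (N 0) x)"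
      by (simp add: square_integrable_def)
    from square_integrable_add(1) [OF this s[of "N 0"]] show "square_integrable h"
      by simp
    show "(\<lambda>m. LINT x|lborel. (cmod (h x - s m x))\<^sup>2) \<longlonglongrightarrow> 0"
    proof (rule LIMSEQ_I)
      fix e :: real assume "e > 0"
      then obtain M where M: "\<And>m p. m \<ge> M \<Longrightarrow> p \<ge> M \<Longrightarrow> (LINT x|lborel. (cmod (s m x - s p x))\<^sup>2) < e / 2"
        using Cauchy[of "e / 2"] by auto
      have "norm ((LINT x|lborel. (cmod (h x - s m x))\<^sup>2) - 0) < e" if "m \<ge> M" for m
        using est(2)[of M m "e / 2"] M that \<open>e > 0\<close> by (force intro: less_imp_le)
      then show "\<exists>M. \<forall>m\<ge>M. norm ((LINT x|lborel. (cmod (h x - s m x))\<^sup>2) - 0) < e"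
        by blast
    qed
  qed
qed

section \<open>The Fourier transform on L1 and L2\<close>

lemma integrable_pair_mult:
  fixes f g :: "'a::euclidean_space \<Rightarrow> complex"
  assumes f: "integrable lborel f" and g: "integrable lborel g"
    and h [measurable]: "h \<in> borel_measurable (borel \<Otimes>\<^sub>M borel)"
    and bd: "\<And>p. cmod (h p) \<le> C"
  shows "integrable (lborel \<Otimes>\<^sub>M lborel) (\<lambda>(x, y). h (x, y) * (f x * g y))"
proof -
  have [measurable]: "f \<in> borel_measurable borel" "g \<in> borel_measurable borel"
    using f g by (auto dest: borel_measurable_integrable)
  have i: "integrable (lborel \<Otimes>\<^sub>M lborel) (\<lambda>(x, y). f x * g y)"
  proof (rule lborel_pair.Fubini_integrable)
    show "(\<lambda>(x, y). f x * g y) \<in> borel_measurable (lborel \<Otimes>\<^sub>M lborel)"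
      by measurable
    show "integrable lborel (\<lambda>x. LINT y|lborel. norm (case (x, y) of (x, y) \<Rightarrow> f x * g y))"
      using f by (simp add: norm_mult)
    show "AE x in lborel. integrable lborel (\<lambda>y. case (x, y) of (x, y) \<Rightarrow> f x * g y)"
      using g by simp
  qed
  have C: "0 \<le> C"
    using bd[of undefined] norm_ge_zero order_trans by blast
  show ?thesis
  proof (rule Bochner_Integration.integrable_bound)
    show "integrable (lborel \<Otimes>\<^sub>M lborel) (\<lambda>p. of_real C * (case p of (x, y) \<Rightarrow> f x * g y))"
      by (rule integrable_mult_right [OF i])
    show "(\<lambda>(x, y). h (x, y) * (f x * g y)) \<in> borel_measurable (lborel \<Otimes>\<^sub>M lborel)"
      by measurable
    show "AE p in lborel \<Otimes>\<^sub>M lborel. cmod (case p of (x, y) \<Rightarrow> h (x, y) * (f x * g y))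
        \<le> cmod (of_real C * (case p of (x, y) \<Rightarrow> f x * g y))"
      using bd C by (auto simp: norm_mult intro!: always_eventually mult_right_mono)
  qed
qed

lemma cnj_measurable [measurable (raw)]:
  "f \<in> borel_measurable M \<Longrightarrow> (\<lambda>x. cnj (f x)) \<in> borel_measurable M"
  by (rule measurable_compose [OF _ borel_measurable_continuous_onI]) (auto intro: continuous_intros)

lemma fourier_L1_measurable [measurable]:
  assumes [measurable]: "f \<in> borel_measurable borel"
  shows "fourier_L1 f \<in> borel_measurable borel"
  unfolding fourier_L1_osc [abs_def] by measurable

lemma integrable_osc_mult:
  assumes f: "integrable lborel f"
  shows "integrable lborel (\<lambda>x. osc \<xi> x * f x)"
proof (rule Bochner_Integration.integrable_bound [OF f])
  show "(\<lambda>x. osc \<xi> x * f x) \<in> borel_measurable lborel"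
    using borel_measurable_integrable [OF f] by measurable
qed (simp add: norm_mult)

lemma cmod_fourier_L1_le: "cmod (fourier_L1 f \<xi>) \<le> (LINT x|lborel. cmod (f x))"
  unfolding fourier_L1_osc by (rule order.trans [OF integral_norm_bound]) (simp add: norm_mult)

lemma fourier_L1_diff:
  "integrable lborel f \<Longrightarrow> integrable lborel g \<Longrightarrow>
    fourier_L1 (\<lambda>x. f x - g x) \<xi> = fourier_L1 f \<xi> - fourier_L1 g \<xi>"
  by (simp add: fourier_L1_osc right_diff_distrib integrable_osc_mult)

lemma fourier_L1_add:
  "integrable lborel f \<Longrightarrow> integrable lborel g \<Longrightarrow>
    fourier_L1 (\<lambda>x. f x + g x) \<xi> = fourier_L1 f \<xi> + fourier_L1 g \<xi>"
  by (simp add: fourier_L1_osc distrib_left integrable_osc_mult)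

lemma fourier_L1_cmult: "fourier_L1 (\<lambda>x. c * f x) \<xi> = c * fourier_L1 f \<xi>"
  by (simp add: fourier_L1_osc mult.left_commute)

lemma fourier_L1_cnj: "fourier_L1 (\<lambda>x. cnj (f x)) \<xi> = cnj (fourier_L1 f (- \<xi>))"
  by (simp add: fourier_L1_osc osc_minus Bochner_Integration.integral_cnj [symmetric] del: Bochner_Integration.integral_cnj)

lemma continuous_fourier_L1:
  assumes f: "integrable lborel f"
  shows "continuous_on UNIV (fourier_L1 f)"
  unfolding continuous_on_eq_continuous_within
proof
  fix \<xi> :: 'a
  have [measurable]: "f \<in> borel_measurable borel"
    using f by (auto dest: borel_measurable_integrable)
  show "isCont (fourier_L1 f) \<xi>"
    unfolding continuous_at_sequentially comp_def
  proof (intro allI impI)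
    fix X assume X: "X \<longlonglongrightarrow> \<xi>"
    show "(\<lambda>k. fourier_L1 f (X k)) \<longlonglongrightarrow> fourier_L1 f \<xi>"
      unfolding fourier_L1_osc
    proof (rule integral_dominated_convergence [where w = "\<lambda>x. cmod (f x)"])
      show "AE x in lborel. (\<lambda>k. osc (X k) x * f x) \<longlonglongrightarrow> osc \<xi> x * f x"
        unfolding osc_def by (intro always_eventually allI tendsto_intros X)
    qed (use f in \<open>auto simp: norm_mult\<close>)
  qed
qed

text \<open>Fubini, with the symmetry of \<open>osc\<close> in its two arguments. This duality is
  the source of Plancherel, inversion and injectivity below: each arises by choosing
  \<open>g\<close> with a known transform.\<close>

theorem fourier_L1_multiplication:
  assumes f: "integrable lborel f" and g: "integrable lborel g"
  shows "(LINT \<xi>|lborel. fourier_L1 f \<xi> * g \<xi>) = (LINT x|lborel. f x * fourier_L1 g x)"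
proof -
  have i: "integrable (lborel \<Otimes>\<^sub>M lborel) (\<lambda>(x, \<xi>). (\<lambda>(x, \<xi>). osc \<xi> x) (x, \<xi>) * (f x * g \<xi>))"
    by (rule integrable_pair_mult [OF f g, where C = 1]) (auto simp: split_beta)
  have "(LINT \<xi>|lborel. fourier_L1 f \<xi> * g \<xi>) = (LINT \<xi>|lborel. LINT x|lborel. osc \<xi> x * (f x * g \<xi>))"
    by (intro Bochner_Integration.integral_cong refl)
       (simp add: fourier_L1_osc mult.assoc flip: integral_mult_left_zero)
  also have "\<dots> = (LINT x|lborel. LINT \<xi>|lborel. osc \<xi> x * (f x * g \<xi>))"
    using lborel_pair.Fubini_integral [where f = "\<lambda>x \<xi>. osc \<xi> x * (f x * g \<xi>)"] i by simp
  also have "\<dots> = (LINT x|lborel. f x * fourier_L1 g x)"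
    by (intro Bochner_Integration.integral_cong refl)
       (simp add: fourier_L1_osc osc_commute mult.left_commute flip: integral_mult_right_zero)
  finally show ?thesis .
qed

section \<open>The Plancherel inequality\<close>

lemma fourier_L1_osc_gauss:
  fixes x :: "'a::euclidean_space"
  assumes "t > 0"
  shows "integrable lborel (\<lambda>\<xi>. osc y \<xi> * gauss t \<xi>)"
    and "fourier_L1 (\<lambda>\<xi>. osc y \<xi> * gauss t \<xi>) x =
      complex_of_real ((pi / t) powr (real DIM('a) / 2) * gauss (1 / (4 * t)) (x + y))"
  using gauss_fourier [OF assms, of y] gauss_fourier [OF assms, of "x + y"]
  by (simp_all add: fourier_L1_osc osc_add mult.assoc)

lemma square_integrable_osc_gauss:
  assumes "t > 0"
  shows "square_integrable (\<lambda>\<xi>. osc y \<xi> * complex_of_real (gauss t \<xi>))"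
  unfolding square_integrable_def
proof
  have "integrable lborel (gauss (2 * t) :: 'a \<Rightarrow> real)"
    using assms by (intro gauss_integral) simp
  moreover have "(cmod (osc y \<xi> * complex_of_real (gauss t \<xi>)))\<^sup>2 = gauss (2 * t) \<xi>" for \<xi>
    by (simp add: norm_mult power2_eq_square gauss_mult)
  ultimately show "integrable lborel (\<lambda>\<xi>. (cmod (osc y \<xi> * complex_of_real (gauss t \<xi>)))\<^sup>2)"
    by simp
qed measurable

lemma gauss_conv_integral:
  fixes u :: "'a::euclidean_space \<Rightarrow> real"
  assumes u: "integrable lborel u" and t: "t > 0"
  shows "integrable lborel (\<lambda>x. LINT y|lborel. u y * gauss t (x - y))"
    and "(LINT x|lborel. LINT y|lborel. u y * gauss t (x - y)) =
      (pi / t) powr (real DIM('a) / 2) * (LINT y|lborel. u y)"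
proof -
  have [measurable]: "u \<in> borel_measurable borel"
    using u by (auto dest: borel_measurable_integrable)
  have g: "integrable lborel (\<lambda>x. gauss t (x - y))" "(LINT x|lborel. gauss t (x - y)) = (pi / t) powr (real DIM('a) / 2)" for y :: 'a
    by (simp_all add: integral_lborel_shift gauss_integral [OF t])
  have i: "integrable (lborel \<Otimes>\<^sub>M lborel) (\<lambda>(y, x). u y * gauss t (x - y))"
  proof (rule lborel_pair.Fubini_integrable)
    show "(\<lambda>(y, x). u y * gauss t (x - y)) \<in> borel_measurable (lborel \<Otimes>\<^sub>M lborel)"
      unfolding gauss_def by measurable
    show "integrable lborel (\<lambda>y. LINT x|lborel. norm (case (y, x) of (y, x) \<Rightarrow> u y * gauss t (x - y)))"
      using u by (simp add: abs_mult g)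
    show "AE y in lborel. integrable lborel (\<lambda>x. case (y, x) of (y, x) \<Rightarrow> u y * gauss t (x - y))"
      by (simp add: g)
  qed
  show "integrable lborel (\<lambda>x. LINT y|lborel. u y * gauss t (x - y))"
    using lborel_pair.integrable_snd [OF i] .
  show "(LINT x|lborel. LINT y|lborel. u y * gauss t (x - y)) =
      (pi / t) powr (real DIM('a) / 2) * (LINT y|lborel. u y)"
    using lborel_pair.Fubini_integral [OF i] by (simp add: g mult.commute)
qed

text \<open>Transforming a Gaussian twice sends \<open>t\<close> to \<open>1 / (4 * t)\<close> and
  back; the two constants multiply to a power of \<open>(pi / t) * (4 * pi * t)\<close>, that is of
  \<open>(2 * pi)^2\<close>. Hence the factor \<open>(2 * pi)^n\<close> in Plancherel.\<close>

lemma gauss_fourier_constants: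
  assumes "t > 0"
  shows "(pi / t) powr a * (pi / (1 / (4 * t))) powr a = (2 * pi) powr (2 * a)"
proof -
  have "(pi / t) powr a * (pi / (1 / (4 * t))) powr a = ((2 * pi)\<^sup>2) powr a"
    using assms by (subst powr_mult [symmetric]) (auto simp: power2_eq_square field_simps)
  moreover have "(2 * pi)\<^sup>2 = (2 * pi) powr 2"
    by simp
  ultimately show ?thesis
    by (simp only: powr_powr)
qed

lemma integrable_bounded_mult:
  fixes f g :: "'b \<Rightarrow> complex"
  assumes f: "integrable M f" and g: "g \<in> borel_measurable M" and b: "\<And>x. cmod (g x) \<le> C"
  shows "integrable M (\<lambda>x. g x * f x)"
proof (rule Bochner_Integration.integrable_bound)
  show "integrable M (\<lambda>x. of_real C * f x)" by (intro integrable_mult_right f)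
  show "(\<lambda>x. g x * f x) \<in> borel_measurable M"
    using borel_measurable_integrable [OF f] g by measurable
  have "0 \<le> C" using b[of undefined] norm_ge_zero order_trans by blast
  then show "AE x in M. cmod (g x * f x) \<le> cmod (of_real C * f x)"
    using b by (auto simp: norm_mult intro!: always_eventually mult_right_mono)
qed

text \<open>The Gaussian weight makes Fubini applicable; Fatou's lemma removes it afterwards.\<close>
lemma plancherel_gauss_le:
  fixes f :: "'a::euclidean_space \<Rightarrow> complex"
  assumes f: "integrable lborel f" and f2: "square_integrable f" and e: "e > 0"
  shows "integrable lborel (\<lambda>\<xi>. (cmod (fourier_L1 f \<xi>))\<^sup>2 * gauss e \<xi>)"
    and "(LINT \<xi>|lborel. (cmod (fourier_L1 f \<xi>))\<^sup>2 * gauss e \<xi>) \<le>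
      (2 * pi) powr (real DIM('a)) * (LINT x|lborel. (cmod (f x))\<^sup>2)"
proof -
  note [measurable] = f2
  define M where "M = (LINT x|lborel. cmod (f x))"
  define s where "s = 1 / (4 * e)"
  define c where "c = (pi / e) powr (real DIM('a) / 2)"
  define J where "J = (pi / s) powr (real DIM('a) / 2)"
  have s: "s > 0" and c: "c > 0" using e by (simp_all add: s_def c_def)
  have cJ: "c * J = (2 * pi) powr (real DIM('a))"
    using gauss_fourier_constants [OF e, of "real DIM('a) / 2"] by (simp add: c_def J_def s_def)
  \<comment> \<open>Chosen so that pairing \<open>fourier_L1 f\<close> with \<open>w\<close> gives
    the weighted squared norm; duality then moves the transform onto \<open>w\<close>.\<close>
  define w where "w \<xi> = cnj (fourier_L1 f \<xi>) * complex_of_real (gauss e \<xi>)" for \<xi>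
  have g: "integrable lborel (\<lambda>\<xi>::'a. complex_of_real (gauss e \<xi>))"
    by (intro integrable_of_real gauss_integral e)
  have w: "integrable lborel w"
    unfolding w_def
    by (rule integrable_bounded_mult [OF g, where C = M])
       (auto simp: M_def cmod_fourier_L1_le)
  have "integrable lborel (\<lambda>\<xi>. fourier_L1 f \<xi> * w \<xi>)"
    by (rule integrable_bounded_mult [OF w, where C = M])
       (auto simp: M_def cmod_fourier_L1_le)
  moreover have eq: "fourier_L1 f \<xi> * w \<xi> = complex_of_real ((cmod (fourier_L1 f \<xi>))\<^sup>2 * gauss e \<xi>)" for \<xi>
    using complex_norm_square [of "fourier_L1 f \<xi>"] by (simp add: w_def mult.assoc [symmetric])
  ultimately show "integrable lborel (\<lambda>\<xi>. (cmod (fourier_L1 f \<xi>))\<^sup>2 * gauss e \<xi>)"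
    by (simp only: complex_of_real_integrable_eq)
  define I where "I = (LINT \<xi>|lborel. (cmod (fourier_L1 f \<xi>))\<^sup>2 * gauss e \<xi>)"
  \<comment> \<open>The transform of \<open>w\<close> is, up to conjugation, a Gaussian convolution
    of \<open>f\<close>: duality again, now against a modulated Gaussian.\<close>
  have what: "fourier_L1 w x = cnj (LINT y|lborel. f y * (c * gauss s (y - x)))" for x
  proof -
    have "fourier_L1 w x = cnj (LINT \<xi>|lborel. fourier_L1 f \<xi> * (osc (- x) \<xi> * gauss e \<xi>))"
      by (simp add: fourier_L1_osc [of w] w_def osc_minus mult_ac
          Bochner_Integration.integral_cnj [symmetric] del: Bochner_Integration.integral_cnj)
    also have "(LINT \<xi>|lborel. fourier_L1 f \<xi> * (osc (- x) \<xi> * gauss e \<xi>)) =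
        (LINT y|lborel. f y * (c * gauss s (y - x)))"
      using fourier_L1_multiplication [OF f fourier_L1_osc_gauss(1) [OF e, of "- x"]]
      by (simp add: fourier_L1_osc_gauss(2) [OF e] c_def s_def)
    finally show ?thesis .
  qed
  have i2: "integrable lborel (\<lambda>x. (cmod (f x))\<^sup>2)"
    using f2 by (simp add: square_integrable_def)
  have gs: "integrable lborel (\<lambda>y. gauss s (x - y))" "(LINT y|lborel. gauss s (x - y)) = J" for x :: 'a
    unfolding gauss_diff_commute [of s x]
    by (simp_all add: integral_lborel_shift gauss_integral [OF s] J_def)
  have i3: "integrable lborel (\<lambda>y. (cmod (f y))\<^sup>2 * gauss s (x - y))" for x
    by (rule Bochner_Integration.integrable_bound [OF i2])
       (use s in \<open>auto simp: abs_mult intro!: mult_left_le gauss_le_1\<close>)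
  \<comment> \<open>From \<open>|f x| |f y| \<le> (|f x|^2 + |f y|^2) / 2\<close>. After integration
    in \<open>x\<close> the two halves contribute equally, and together they give the constant
    \<open>c * J\<close>.\<close>
  have pt: "cmod (f x * fourier_L1 w x) \<le>
      c * J / 2 * (cmod (f x))\<^sup>2 + c / 2 * (LINT y|lborel. (cmod (f y))\<^sup>2 * gauss s (x - y))" for x
  proof -
    have "cmod (f x * fourier_L1 w x) = cmod (LINT y|lborel. f x * (f y * (c * gauss s (y - x))))"
      by (simp add: norm_mult what)
    also have "\<dots> \<le> (LINT y|lborel. (c / 2 * (cmod (f x))\<^sup>2) * gauss s (x - y) + c / 2 * ((cmod (f y))\<^sup>2 * gauss s (x - y)))"
    proof (rule order.trans [OF integral_norm_bound integral_mono'])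
      show "integrable lborel (\<lambda>y. (c / 2 * (cmod (f x))\<^sup>2) * gauss s (x - y) + c / 2 * ((cmod (f y))\<^sup>2 * gauss s (x - y)))"
        using gs(1) i3 by (intro Bochner_Integration.integrable_add integrable_mult_right) auto
      fix y
      have "cmod (f x) * cmod (f y) * (c * gauss s (x - y)) \<le> ((cmod (f x))\<^sup>2 + (cmod (f y))\<^sup>2) / 2 * (c * gauss s (x - y))"
        using c sum_squares_bound [of "cmod (f x)" "cmod (f y)"] by (intro mult_right_mono) auto
      then show "cmod (f x * (f y * (c * gauss s (y - x)))) \<le>
          (c / 2 * (cmod (f x))\<^sup>2) * gauss s (x - y) + c / 2 * ((cmod (f y))\<^sup>2 * gauss s (x - y))"
        using c by (simp add: norm_mult gauss_diff_commute [of s y] algebra_simps add_divide_distrib)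
    qed (use c in auto)
    also have "\<dots> = c * J / 2 * (cmod (f x))\<^sup>2 + c / 2 * (LINT y|lborel. (cmod (f y))\<^sup>2 * gauss s (x - y))"
      using gs i3 by (subst Bochner_Integration.integral_add) (auto simp: mult_ac)
    finally show ?thesis .
  qed
  have "I = cmod (complex_of_real I)"
    by (simp add: I_def)
  also have "complex_of_real I = (LINT \<xi>|lborel. fourier_L1 f \<xi> * w \<xi>)"
    by (simp only: I_def eq integral_complex_of_real)
  also have "\<dots> = (LINT x|lborel. f x * fourier_L1 w x)"
    by (rule fourier_L1_multiplication [OF f w])
  also have "cmod \<dots> \<le> (LINT x|lborel. c * J / 2 * (cmod (f x))\<^sup>2 + c / 2 * (LINT y|lborel. (cmod (f y))\<^sup>2 * gauss s (x - y)))"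
    using i2 gauss_conv_integral(1) [OF i2 s] c
    by (intro order.trans [OF integral_norm_bound integral_mono'] pt
        Bochner_Integration.integrable_add integrable_mult_right add_nonneg_nonneg mult_nonneg_nonneg Bochner_Integration.integral_nonneg)
       (auto simp: J_def)
  also have "\<dots> = c * J / 2 * (LINT x|lborel. (cmod (f x))\<^sup>2) + c / 2 * (J * (LINT x|lborel. (cmod (f x))\<^sup>2))"
    using i2 gauss_conv_integral [OF i2 s]
    by (subst Bochner_Integration.integral_add) (auto simp: J_def)
  also have "\<dots> = c * J * (LINT x|lborel. (cmod (f x))\<^sup>2)"
    by (simp add: field_simps)
  finally show "(LINT \<xi>|lborel. (cmod (fourier_L1 f \<xi>))\<^sup>2 * gauss e \<xi>) \<le>
      (2 * pi) powr (real DIM('a)) * (LINT x|lborel. (cmod (f x))\<^sup>2)"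
    by (simp add: I_def cJ)
qed

text \<open>The weights \<open>gauss (1 / (k + 1))\<close> tend to 1 pointwise while the bound does
  not depend on \<open>k\<close>, so Fatou applies.\<close>

theorem plancherel_le:
  fixes f :: "'a::euclidean_space \<Rightarrow> complex"
  assumes f: "integrable lborel f" and f2: "square_integrable f"
  shows "square_integrable (fourier_L1 f)"
    and "(LINT \<xi>|lborel. (cmod (fourier_L1 f \<xi>))\<^sup>2) \<le>
      (2 * pi) powr (real DIM('a)) * (LINT x|lborel. (cmod (f x))\<^sup>2)"
proof -
  note [measurable] = f2
  let ?u = "\<lambda>k \<xi>. (cmod (fourier_L1 f \<xi>))\<^sup>2 * gauss (1 / real (Suc k)) \<xi>"
  have lim: "(\<lambda>k. ?u k \<xi>) \<longlonglongrightarrow> (cmod (fourier_L1 f \<xi>))\<^sup>2" for \<xi>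
  proof -
    have "(\<lambda>k. 1 / real (Suc k)) \<longlonglongrightarrow> 0"
      using LIMSEQ_inverse_real_of_nat by (simp add: inverse_eq_divide)
    then have "(\<lambda>k. ?u k \<xi>) \<longlonglongrightarrow> (cmod (fourier_L1 f \<xi>))\<^sup>2 * exp (- 0 * (norm \<xi>)\<^sup>2)"
      unfolding gauss_def by (intro tendsto_intros)
    then show ?thesis by simp
  qed
  note p = plancherel_gauss_le [OF f f2, of "1 / real (Suc _)"]
  have "integrable lborel (\<lambda>\<xi>. (cmod (fourier_L1 f \<xi>))\<^sup>2)"
    using lim by (intro fatou_bound(1) [where u = ?u, OF p(1) _ p(2)]) auto
  then show "square_integrable (fourier_L1 f)"
    by (simp add: square_integrable_def)
  show "(LINT \<xi>|lborel. (cmod (fourier_L1 f \<xi>))\<^sup>2) \<le>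
      (2 * pi) powr (real DIM('a)) * (LINT x|lborel. (cmod (f x))\<^sup>2)"
    using lim by (intro fatou_bound(2) [where u = ?u, OF p(1) _ p(2)]) auto
qed

section \<open>Heat kernels as an approximate identity\<close>

text \<open>The heat kernel at time \<open>1 / (4 * t)\<close>: the parameter is an inverse time, so
  the unit mass concentrates at the origin as \<open>t\<close> grows.\<close>

definition heat_kernel :: "real \<Rightarrow> 'a::euclidean_space \<Rightarrow> real" where
  "heat_kernel t x = (t / pi) powr (real DIM('a) / 2) * gauss t x"

lemma heat_kernel_measurable [measurable]: "heat_kernel t \<in> borel_measurable borel"
  unfolding heat_kernel_def [abs_def] by measurable

lemma heat_kernel_nonneg [simp]: "0 \<le> heat_kernel t x"
  by (simp add: heat_kernel_def)

lemma heat_kernel_integral: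
  fixes y :: "'a::euclidean_space"
  assumes t: "t > 0"
  shows "integrable lborel (\<lambda>x. heat_kernel t (x - y))"
    and "(LINT x|lborel. heat_kernel t (x - y)) = 1"
proof -
  have "integrable lborel (heat_kernel t :: 'a \<Rightarrow> real)"
    using t by (auto simp: heat_kernel_def [abs_def] intro!: gauss_integral integrable_mult_right)
  then show "integrable lborel (\<lambda>x. heat_kernel t (x - y))"
    by (simp add: integral_lborel_shift)
  have "(LINT x|lborel. heat_kernel t (x::'a)) = (t / pi) powr (real DIM('a) / 2) * (pi / t) powr (real DIM('a) / 2)"
    by (simp add: heat_kernel_def gauss_integral [OF t])
  also have "\<dots> = 1"
    using t by (subst powr_mult [symmetric]) auto
  finally show "(LINT x|lborel. heat_kernel t (x - y)) = 1"
    by (simp add: integral_lborel_shift)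
qed

text \<open>Away from \<^term>\<open>y\<close> the kernel is dominated by a constant that tends to 0 times the
  fixed Gaussian \<^term>\<open>gauss 1 (x - y)\<close>, so that no global boundedness of \<^term>\<open>f\<close> is needed.\<close>
lemma heat_kernel_approximation:
  fixes f :: "'a::euclidean_space \<Rightarrow> complex"
  assumes f [measurable]: "f \<in> borel_measurable borel"
    and i: "integrable lborel (\<lambda>x. f x * gauss 1 (x - y))"
    and c: "isCont f y"
  shows "(\<lambda>k. LINT x|lborel. f x * heat_kernel (real (Suc k)) (x - y)) \<longlonglongrightarrow> f y"
proof (rule LIMSEQ_I)
  fix e :: real assume e: "e > 0"
  let ?a = "real DIM('a) / 2"
  obtain d where d: "d > 0" "\<And>x. dist x y < d \<Longrightarrow> dist (f x) (f y) < e / 2"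
    using c e unfolding continuous_at_eps_delta by (metis half_gt_zero)
  define C where "C = (LINT x|lborel. cmod (f x - f y) * gauss 1 (x - y))"
  have g1: "integrable lborel (\<lambda>x. gauss 1 (x - y))"
    by (simp add: integral_lborel_shift gauss_integral)
  have i': "integrable lborel (\<lambda>x. (f x - f y) * gauss 1 (x - y))"
    unfolding left_diff_distrib using i g1
    by (intro Bochner_Integration.integrable_diff integrable_mult_right integrable_of_real)
  have iC: "integrable lborel (\<lambda>x. cmod (f x - f y) * gauss 1 (x - y))"
    using integrable_norm [OF i'] by (simp add: norm_mult)
  \<comment> \<open>Outside the ball of radius \<open>d\<close>, factor \<open>gauss (k + 1)\<close>
    as \<open>gauss k * gauss 1\<close> and bound the first factor by
    \<open>exp (- k * d^2)\<close>; the power is the normalisation of the kernel.\<close>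
  define A where "A k = (real (Suc k) / pi) powr ?a * exp (- real k * d\<^sup>2)" for k
  have "A \<longlonglongrightarrow> 0"
  proof -
    have "(\<lambda>k. (real (Suc k) / pi) powr a * exp (- real k * b)) \<longlonglongrightarrow> 0" if "b > 0" for a b :: real
      using that by real_asymp
    from this [of "d\<^sup>2" ?a] show ?thesis
      using d by (simp add: A_def [abs_def])
  qed
  then have "(\<lambda>k. A k * C) \<longlonglongrightarrow> 0"
    by (rule tendsto_mult_left_zero)
  then obtain N where N: "\<And>k. k \<ge> N \<Longrightarrow> norm (A k * C) < e / 2"
    using LIMSEQ_D [of _ 0 "e / 2"] e by (metis diff_zero half_gt_zero)
  have "norm ((LINT x|lborel. f x * heat_kernel (real (Suc k)) (x - y)) - f y) < e" if k: "k \<ge> N" for k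
  proof -
    let ?h = "\<lambda>x. heat_kernel (real (Suc k)) (x - y)"
    have h: "integrable lborel ?h" "(LINT x|lborel. ?h x) = 1"
      by (rule heat_kernel_integral; simp)+
    have pt: "cmod ((f x - f y) * ?h x) \<le> e / 2 * ?h x + A k * (cmod (f x - f y) * gauss 1 (x - y))" for x
    proof (cases "dist x y < d")
      case True
      then have "cmod (f x - f y) * ?h x \<le> e / 2 * ?h x"
        using d(2)[of x] by (intro mult_right_mono) (auto simp: dist_norm)
      moreover have "0 \<le> A k * (cmod (f x - f y) * gauss 1 (x - y))"
        by (simp add: A_def)
      ultimately show ?thesis by (simp add: norm_mult)
    next
      case False
      have "d\<^sup>2 \<le> (norm (x - y))\<^sup>2"
        using False d by (intro power_mono) (auto simp: dist_norm)
      then have "gauss (real k) (x - y) \<le> exp (- real k * d\<^sup>2)"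
        by (simp add: gauss_def mult_left_mono)
      then have "gauss (real (Suc k)) (x - y) \<le> exp (- real k * d\<^sup>2) * gauss 1 (x - y)"
        using gauss_mult [of "real k" "x - y" 1] by (simp add: add.commute mult_right_mono flip: gauss_mult)
      then have "?h x \<le> A k * gauss 1 (x - y)"
        unfolding heat_kernel_def A_def mult.assoc by (intro mult_left_mono) auto
      then have "cmod (f x - f y) * ?h x \<le> A k * (cmod (f x - f y) * gauss 1 (x - y))"
        by (subst mult.left_commute) (rule mult_left_mono, auto)
      moreover have "0 \<le> e / 2 * ?h x" using e by simp
      ultimately show ?thesis by (simp add: norm_mult)
    qed
    have iR: "integrable lborel (\<lambda>x. e / 2 * ?h x + A k * (cmod (f x - f y) * gauss 1 (x - y)))"
      by (intro Bochner_Integration.integrable_add integrable_mult_right h iC)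
    have iL: "integrable lborel (\<lambda>x. (f x - f y) * ?h x)"
    proof (rule Bochner_Integration.integrable_bound [OF iR])
      show "AE x in lborel. cmod ((f x - f y) * ?h x)
          \<le> norm (e / 2 * ?h x + A k * (cmod (f x - f y) * gauss 1 (x - y)))"
        unfolding real_norm_def by (intro always_eventually allI) (rule order.trans [OF pt abs_ge_self])
    qed measurable
    have iy: "integrable lborel (\<lambda>x. f y * complex_of_real (?h x))"
      by (intro integrable_mult_right integrable_of_real h)
    have "integrable lborel (\<lambda>x. (f x - f y) * ?h x + f y * complex_of_real (?h x))"
      by (rule Bochner_Integration.integrable_add [OF iL iy])
    then have ix: "integrable lborel (\<lambda>x. f x * complex_of_real (?h x))"
      by (simp add: ring_distribs)
    have "(LINT x|lborel. f x * ?h x) - f y = (LINT x|lborel. f x * ?h x) - (LINT x|lborel. f y * complex_of_real (?h x))"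
      using h(2) by (simp del: of_nat_Suc)
    also have "\<dots> = (LINT x|lborel. (f x - f y) * ?h x)"
      by (simp add: left_diff_distrib ix iy del: of_nat_Suc)
    also have "cmod \<dots> \<le> (LINT x|lborel. e / 2 * ?h x + A k * (cmod (f x - f y) * gauss 1 (x - y)))"
      by (rule order.trans [OF integral_norm_bound integral_mono'])
         (rule iR, rule pt, rule order.trans [OF norm_ge_zero pt])
    also have "\<dots> = e / 2 + A k * C"
      using h iC by (subst Bochner_Integration.integral_add) (auto simp: C_def)
    also have "\<dots> < e" using N[OF k] by (simp add: abs_less_iff)
    finally show ?thesis .
  qed
  then show "\<exists>N. \<forall>k\<ge>N. norm ((LINT x|lborel. f x * heat_kernel (real (Suc k)) (x - y)) - f y) < e"
    by blast
qed

text \<open>A Gaussian cutoff of the character \<open>exp (i y . \<xi>)\<close>, hence both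
  integrable and square integrable. Its transform is \<open>(2 * pi)^n\<close> times the heat kernel
  centred at \<open>y\<close>, which makes it the test function for inversion at
  \<open>y\<close>.\<close>

definition heat_symbol :: "real \<Rightarrow> 'a::euclidean_space \<Rightarrow> 'a \<Rightarrow> complex" where
  "heat_symbol t y \<xi> = osc (- y) \<xi> * complex_of_real (gauss (1 / (4 * t)) \<xi>)"

lemma heat_symbol:
  fixes y :: "'a::euclidean_space"
  assumes t: "t > 0"
  shows "integrable lborel (heat_symbol t y)" "square_integrable (heat_symbol t y)"
    and "fourier_L1 (heat_symbol t y) x = complex_of_real ((2 * pi) powr real DIM('a) * heat_kernel t (x - y))"
proof -
  have "1 / (4 * t) > 0" using t by simp
  note * = fourier_L1_osc_gauss [OF this, of "- y"] square_integrable_osc_gauss [OF this, of "- y"]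
  show "integrable lborel (heat_symbol t y)" "square_integrable (heat_symbol t y)"
    using * by (simp_all add: heat_symbol_def [abs_def])
  have "(pi / (1 / (4 * t))) powr (real DIM('a) / 2) = ((2 * pi) powr 2 * (t / pi)) powr (real DIM('a) / 2)"
    by (simp add: power2_eq_square mult_ac)
  also have "\<dots> = (2 * pi) powr real DIM('a) * (t / pi) powr (real DIM('a) / 2)"
    using t by (subst powr_mult) (auto simp: powr_powr simp del: powr_numeral)
  finally show "fourier_L1 (heat_symbol t y) x = complex_of_real ((2 * pi) powr real DIM('a) * heat_kernel t (x - y))"
    using * by (simp add: heat_symbol_def [abs_def] heat_kernel_def)
qed

lemma heat_symbol_tendsto: "(\<lambda>k. heat_symbol (real (Suc k)) y \<xi>) \<longlonglongrightarrow> osc (- y) \<xi>"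
proof -
  have "(\<lambda>k. 1 / (4 * real (Suc k))) \<longlonglongrightarrow> 0"
    by real_asymp
  then have "(\<lambda>k. heat_symbol (real (Suc k)) y \<xi>) \<longlonglongrightarrow> osc (- y) \<xi> * complex_of_real (exp (- 0 * (norm \<xi>)\<^sup>2))"
    unfolding heat_symbol_def gauss_def by (intro tendsto_intros)
  then show ?thesis by simp
qed

lemma cmod_heat_symbol_le: "t > 0 \<Longrightarrow> cmod (heat_symbol t y \<xi>) \<le> 1"
  by (simp add: heat_symbol_def norm_mult gauss_le_1)

lemma integral_mult_heat_symbol_tendsto:
  assumes k: "integrable lborel k"
  shows "(\<lambda>m. LINT \<xi>|lborel. k \<xi> * heat_symbol (real (Suc m)) y \<xi>) \<longlonglongrightarrow> fourier_L1 k (- y)"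
  unfolding fourier_L1_osc mult.commute [of "osc _ _"]
proof (rule integral_dominated_convergence [where w = "\<lambda>\<xi>. cmod (k \<xi>)"])
  have [measurable]: "k \<in> borel_measurable borel"
    using k by (auto dest: borel_measurable_integrable)
  show "(\<lambda>\<xi>. k \<xi> * osc (- y) \<xi>) \<in> borel_measurable lborel"
    "(\<lambda>\<xi>. k \<xi> * heat_symbol (real (Suc m)) y \<xi>) \<in> borel_measurable lborel" for m
    unfolding heat_symbol_def by measurable
  show "AE \<xi> in lborel. (\<lambda>m. k \<xi> * heat_symbol (real (Suc m)) y \<xi>) \<longlonglongrightarrow> k \<xi> * osc (- y) \<xi>"
    by (intro always_eventually allI tendsto_intros heat_symbol_tendsto)
  show "AE \<xi> in lborel. norm (k \<xi> * heat_symbol (real (Suc m)) y \<xi>) \<le> cmod (k \<xi>)" for m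
    by (intro always_eventually allI) (simp add: norm_mult mult_left_le cmod_heat_symbol_le del: of_nat_Suc)
qed (use k in simp)

section \<open>The L^2 transform: duality and pointwise inversion\<close>

definition truncate :: "nat \<Rightarrow> ('a::euclidean_space \<Rightarrow> complex) \<Rightarrow> 'a \<Rightarrow> complex" where
  "truncate m f x = indicator (ball 0 (real m)) x * f x"

lemma has_L2_fourier_truncate:
  "has_L2_fourier f g \<longleftrightarrow> square_integrable g \<and>
    (\<lambda>m. LINT \<xi>|lborel. (cmod (g \<xi> - fourier_L1 (truncate m f) \<xi>))\<^sup>2) \<longlonglongrightarrow> 0"
  by (simp add: has_L2_fourier_def truncate_def [abs_def])

lemma cmod_truncate_le: "cmod (truncate m f x) \<le> cmod (f x)"
  by (simp add: truncate_def norm_mult indicator_def)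

lemma truncate_measurable:
  "f \<in> borel_measurable borel \<Longrightarrow> truncate m f \<in> borel_measurable borel"
  unfolding truncate_def [abs_def] by (intro borel_measurable_times borel_measurable_indicator) auto

lemma truncate_tendsto: "(\<lambda>m. truncate m f x) \<longlonglongrightarrow> f x"
proof (rule tendsto_eventually)
  obtain N :: nat where "norm x < real N" using reals_Archimedean2 by blast
  then show "\<forall>\<^sub>F m in sequentially. truncate m f x = f x"
    unfolding eventually_sequentially truncate_def by (intro exI[of _ N]) (auto simp: indicator_def)
qed

lemma truncate_integrable:
  fixes f :: "'a::euclidean_space \<Rightarrow> complex"
  assumes f: "square_integrable f"
  shows "square_integrable (truncate m f)" "integrable lborel (truncate m f)"
proof -
  note [measurable] = f
  have [measurable]: "truncate m f \<in> borel_measurable borel"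
    by (rule truncate_measurable) measurable
  have "integrable lborel (\<lambda>x. (cmod (f x))\<^sup>2)"
    using f by (simp add: square_integrable_def)
  then have "integrable lborel (\<lambda>x. (cmod (truncate m f x))\<^sup>2)"
    by (rule Bochner_Integration.integrable_bound) (auto intro!: power_mono cmod_truncate_le)
  then show "square_integrable (truncate m f)"
    by (simp add: square_integrable_def)
  have "square_integrable (indicator (ball 0 (real m)) :: 'a \<Rightarrow> complex)"
  proof -
    have "(\<lambda>x::'a. (cmod (indicator (ball 0 (real m)) x))\<^sup>2) = indicator (ball 0 (real m))"
      by (auto simp: indicator_def)
    then show ?thesis
      unfolding square_integrable_def
      using emeasure_bounded_finite [of "ball 0 (real m) :: 'a set"]
      by (auto simp: integrable_indicator_iff less_top intro!: borel_measurable_indicator)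
  qed
  from square_integrable_mult_integrable [OF this f]
  show "integrable lborel (truncate m f)"
    by (simp add: truncate_def [abs_def])
qed

text \<open>The duality holds for every truncation of \<open>f\<close>. The left side passes to the
  limit by Cauchy-Schwarz, the right side by domination with \<open>|f * fourier_L1 w|\<close>,
  which is integrable because the Plancherel bound puts \<open>fourier_L1 w\<close> in L^2.\<close>

lemma has_L2_fourier_multiplication:
  assumes fg: "has_L2_fourier f g" and f: "square_integrable f"
    and w: "integrable lborel w" "square_integrable w"
  shows "(LINT \<xi>|lborel. g \<xi> * w \<xi>) = (LINT x|lborel. f x * fourier_L1 w x)"
proof (rule LIMSEQ_unique)
  note t = truncate_integrable [OF f]
  have [measurable]: "f \<in> borel_measurable borel" "w \<in> borel_measurable borel"
    using f w(2) by (simp_all add: square_integrable_def)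
  have [measurable]: "truncate m f \<in> borel_measurable borel" for m
    by (rule truncate_measurable) measurable
  show "(\<lambda>m. LINT \<xi>|lborel. fourier_L1 (truncate m f) \<xi> * w \<xi>) \<longlonglongrightarrow> (LINT \<xi>|lborel. g \<xi> * w \<xi>)"
    using fg w by (intro square_integrable_mult_tendsto plancherel_le(1) t)
       (auto simp: has_L2_fourier_truncate)
  have "(\<lambda>m. LINT x|lborel. truncate m f x * fourier_L1 w x) \<longlonglongrightarrow> (LINT x|lborel. f x * fourier_L1 w x)"
  proof (rule integral_dominated_convergence [where w = "\<lambda>x. cmod (f x * fourier_L1 w x)"])
    show "integrable lborel (\<lambda>x. cmod (f x * fourier_L1 w x))"
      by (intro integrable_norm square_integrable_mult_integrable f plancherel_le(1) w)
    show "(\<lambda>x. truncate m f x * fourier_L1 w x) \<in> borel_measurable lborel" for m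
      by measurable
    show "AE x in lborel. (\<lambda>m. truncate m f x * fourier_L1 w x) \<longlonglongrightarrow> f x * fourier_L1 w x"
      by (intro always_eventually allI tendsto_intros truncate_tendsto)
    show "AE x in lborel. norm (truncate m f x * fourier_L1 w x) \<le> cmod (f x * fourier_L1 w x)" for m
      by (intro always_eventually allI) (auto simp: norm_mult intro!: mult_right_mono cmod_truncate_le)
  qed measurable
  then show "(\<lambda>m. LINT \<xi>|lborel. fourier_L1 (truncate m f) \<xi> * w \<xi>) \<longlonglongrightarrow> (LINT x|lborel. f x * fourier_L1 w x)"
    by (simp add: fourier_L1_multiplication t w)
qed

text \<open>Pair \<open>g\<close> with heat symbols at \<open>y\<close>. As the cutoff disappears
  the pairing tends to \<open>fourier_L1 g (- y)\<close>; by duality it is also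
  \<open>(2 * pi)^n\<close> times a heat kernel average of \<open>f\<close>, which tends to
  \<open>f y\<close> by continuity.\<close>

theorem has_L2_fourier_inversion:
  fixes f :: "'a::euclidean_space \<Rightarrow> complex"
  assumes fg: "has_L2_fourier f g" and f: "square_integrable f" and c: "isCont f y"
    and g: "integrable lborel g"
  shows "fourier_L1 g (- y) = complex_of_real ((2 * pi) powr real DIM('a)) * f y"
proof (rule LIMSEQ_unique)
  note [measurable] = f
  show "(\<lambda>m. LINT \<xi>|lborel. g \<xi> * heat_symbol (real (Suc m)) y \<xi>) \<longlonglongrightarrow> fourier_L1 g (- y)"
    by (rule integral_mult_heat_symbol_tendsto [OF g])
  \<comment> \<open>\<open>f\<close> is only known to be in L^2; a square integrable Gaussian
    supplies the weighted integrability that the approximation lemma asks for.\<close>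
  have "square_integrable (\<lambda>x. complex_of_real (gauss 1 (x - y)))"
  proof -
    have "integrable lborel (gauss 2 :: 'a \<Rightarrow> real)"
      by (intro gauss_integral) simp
    then have "integrable lborel (\<lambda>x. gauss 2 (x - y))"
      by (simp add: integral_lborel_shift)
    moreover have "(cmod (complex_of_real (gauss 1 (x - y))))\<^sup>2 = gauss 2 (x - y)" for x
      by (simp add: power2_eq_square gauss_mult)
    ultimately show ?thesis
      by (simp add: square_integrable_def)
  qed
  from square_integrable_mult_integrable [OF f this]
  have "(\<lambda>k. LINT x|lborel. f x * heat_kernel (real (Suc k)) (x - y)) \<longlonglongrightarrow> f y"
    using c by (intro heat_kernel_approximation) auto
  then have "(\<lambda>k. complex_of_real ((2 * pi) powr real DIM('a)) * (LINT x|lborel. f x * heat_kernel (real (Suc k)) (x - y)))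
     \<longlonglongrightarrow> complex_of_real ((2 * pi) powr real DIM('a)) * f y"
    by (intro tendsto_mult tendsto_const)
  moreover have "(LINT \<xi>|lborel. g \<xi> * heat_symbol (real (Suc k)) y \<xi>) =
      complex_of_real ((2 * pi) powr real DIM('a)) * (LINT x|lborel. f x * heat_kernel (real (Suc k)) (x - y))" for k
    by (subst has_L2_fourier_multiplication [OF fg f])
       (simp_all add: heat_symbol mult.left_commute [of "f _"] integral_mult_right_zero del: of_nat_Suc)
  ultimately show "(\<lambda>m. LINT \<xi>|lborel. g \<xi> * heat_symbol (real (Suc m)) y \<xi>) \<longlonglongrightarrow>
      complex_of_real ((2 * pi) powr real DIM('a)) * f y"
    by simp
qed

section \<open>Injectivity of the transform on L^1\<close>

lemma AE_notin_frontier_box: "AE x in lborel. x \<notin> frontier (box a b :: 'a::euclidean_space set)"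
proof -
  have "negligible (frontier (box a b :: 'a set))"
    by (simp add: negligible_convex_frontier)
  then have "emeasure lebesgue (frontier (box a b)) = 0"
    by (simp add: negligible_iff_emeasure0 lmeasurable_iff_integrable negligible_imp_sets)
  then have "emeasure lborel (frontier (box a b)) = 0"
    by simp
  then show ?thesis
    by (intro AE_I[of _ _ "frontier (box a b)"]) auto
qed

lemma isCont_indicator_box:
  assumes "x \<notin> frontier (box a b :: 'a::euclidean_space set)"
  shows "isCont (indicator (box a b) :: 'a \<Rightarrow> complex) x"
proof -
  let ?S = "box a b :: 'a set"
  have "x \<in> ?S \<or> x \<in> - closure ?S"
    using assms by (auto simp: frontier_def interior_open [OF open_box])
  then show ?thesis
  proof
    assume x: "x \<in> ?S"
    have "eventually (\<lambda>y. y \<in> ?S) (nhds x)"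
      using x by (intro eventually_nhds_in_open) auto
    then have "eventually (\<lambda>y. (indicator ?S y :: complex) = 1) (nhds x)"
      by eventually_elim simp
    then have "isCont (indicator ?S :: 'a \<Rightarrow> complex) x \<longleftrightarrow> isCont (\<lambda>_. 1 :: complex) x"
      by (rule isCont_cong)
    then show ?thesis by simp
  next
    assume x: "x \<in> - closure ?S"
    have "eventually (\<lambda>y. y \<in> - closure ?S) (nhds x)"
      using x by (intro eventually_nhds_in_open) auto
    then have "eventually (\<lambda>y. (indicator ?S y :: complex) = 0) (nhds x)"
      by eventually_elim (use closure_subset [of ?S] in \<open>auto simp: indicator_def simp del: closure_box\<close>)
    then have "isCont (indicator ?S :: 'a \<Rightarrow> complex) x \<longleftrightarrow> isCont (\<lambda>_. 0 :: complex) x"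
      by (rule isCont_cong)
    then show ?thesis by simp
  qed
qed

lemma integrable_indicator_box: "integrable lborel (indicator (box a b :: 'a::euclidean_space set) :: 'a \<Rightarrow> complex)"
proof -
  have "integrable lborel (indicator (box a b) :: 'a \<Rightarrow> real)"
    using emeasure_bounded_finite [of "box a b"] by (simp add: less_top)
  then have "integrable lborel (\<lambda>x. complex_of_real (indicator (box a b) x))"
    by (rule integrable_of_real)
  moreover have "complex_of_real (indicator (box a b) x) = indicator (box a b) x" for x
    by (simp add: indicator_def)
  ultimately show ?thesis by simp
qed

text \<open>Smooth the indicator of the box with heat kernels. By Fubini the smoothing can be moved
  to \<open>k\<close>, where it gives 0; the smoothed indicators are bounded by 1 and converge off
  the frontier of the box, a null set.\<close>

lemma fourier_L1_zero_box_integral: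
  fixes k :: "'a::euclidean_space \<Rightarrow> complex"
  assumes k: "integrable lborel k" and z: "\<And>\<xi>. fourier_L1 k \<xi> = 0"
  shows "(LINT x|lborel. k x * indicator (box a b) x) = 0"
proof -
  let ?u = "indicator (box a b) :: 'a \<Rightarrow> complex"
  have [measurable]: "k \<in> borel_measurable borel"
    using k by (auto dest: borel_measurable_integrable)
  have [measurable]: "?u \<in> borel_measurable borel"
    by (rule borel_measurable_indicator) simp
  note u = integrable_indicator_box [of a b]
  \<comment> \<open>The heat kernel is a multiple of the transform of an integrable function, so
    duality with the vanishing transform of \<open>k\<close> applies.\<close>
  have conv0: "(LINT x|lborel. k x * heat_kernel t (x - y)) = 0" if "t > 0" for t y
  proof -
    have "(LINT x|lborel. k x * fourier_L1 (heat_symbol t y) x) = 0"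
      using fourier_L1_multiplication [OF k heat_symbol(1) [OF that, of y]] by (simp add: z)
    then show ?thesis
      by (simp add: heat_symbol [OF that] mult.left_commute [of "k _"])
  qed
  define v where "v m x = (LINT y|lborel. ?u y * heat_kernel (real (Suc m)) (y - x))" for m x
  have v_meas: "v m \<in> borel_measurable borel" for m
    unfolding v_def [abs_def] by measurable
  have v_le: "cmod (v m x) \<le> 1" for m x
  proof -
    have "cmod (v m x) \<le> (LINT y|lborel. heat_kernel (real (Suc m)) (y - x))"
      unfolding v_def
      by (rule order.trans [OF integral_norm_bound integral_mono'])
         (auto simp: norm_mult indicator_def simp del: of_nat_Suc intro!: heat_kernel_integral)
    also have "\<dots> = 1"
      by (intro heat_kernel_integral) simp
    finally show ?thesis .
  qed
  have "(\<lambda>m. LINT x|lborel. k x * v m x) \<longlonglongrightarrow> (LINT x|lborel. k x * ?u x)"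
  proof (rule integral_dominated_convergence [where w = "\<lambda>x. cmod (k x)"])
    show "AE x in lborel. (\<lambda>m. k x * v m x) \<longlonglongrightarrow> k x * ?u x"
      using AE_notin_frontier_box [of a b]
    proof eventually_elim
      fix x :: 'a assume x: "x \<notin> frontier (box a b)"
      have "integrable lborel (\<lambda>y. complex_of_real (gauss 1 (y - x)) * ?u y)"
        by (rule integrable_bounded_mult [OF u, where C = 1]) (auto simp: gauss_le_1)
      then have "integrable lborel (\<lambda>y. ?u y * complex_of_real (gauss 1 (y - x)))"
        by (simp add: mult.commute)
      then have "(\<lambda>m. v m x) \<longlonglongrightarrow> ?u x"
        unfolding v_def using isCont_indicator_box [OF x] by (intro heat_kernel_approximation) auto
      then show "(\<lambda>m. k x * v m x) \<longlonglongrightarrow> k x * ?u x"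
        by (intro tendsto_intros)
    qed
    show "AE x in lborel. norm (k x * v m x) \<le> cmod (k x)" for m
      by (intro always_eventually allI) (simp add: norm_mult mult_left_le v_le)
  qed (use k v_meas in auto)
  moreover have "(LINT x|lborel. k x * v m x) = 0" for m
  proof -
    let ?h = "\<lambda>(x, y). complex_of_real (heat_kernel (real (Suc m)) (y - x :: 'a))"
    have i: "integrable (lborel \<Otimes>\<^sub>M lborel) (\<lambda>(x, y). ?h (x, y) * (k x * ?u y))"
    proof (rule integrable_pair_mult [OF k u])
      show "?h \<in> borel_measurable (borel \<Otimes>\<^sub>M borel)" by measurable
      show "cmod (?h p) \<le> (real (Suc m) / pi) powr (real DIM('a) / 2)" for p
        by (auto simp: split_beta heat_kernel_def norm_mult intro!: mult_left_le gauss_le_1)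
    qed
    have "(LINT x|lborel. k x * v m x) =
        (LINT x|lborel. LINT y|lborel. complex_of_real (heat_kernel (real (Suc m)) (y - x)) * (k x * ?u y))"
      unfolding v_def by (intro Bochner_Integration.integral_cong refl)
        (simp add: mult_ac flip: integral_mult_right_zero)
    also have "\<dots> = (LINT y|lborel. LINT x|lborel. complex_of_real (heat_kernel (real (Suc m)) (y - x)) * (k x * ?u y))"
      using lborel_pair.Fubini_integral
        [where f = "\<lambda>x y. complex_of_real (heat_kernel (real (Suc m)) (y - x)) * (k x * ?u y)"] i
      by simp
    also have "\<dots> = (LINT y|lborel. ?u y * (LINT x|lborel. k x * heat_kernel (real (Suc m)) (x - y)))"
    proof (intro Bochner_Integration.integral_cong refl)
      fix y :: 'a
      have "heat_kernel (real (Suc m)) (y - x) = heat_kernel (real (Suc m)) (x - y)" for x :: 'a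
        by (simp add: heat_kernel_def gauss_diff_commute [of _ y])
      then show "(LINT x|lborel. complex_of_real (heat_kernel (real (Suc m)) (y - x)) * (k x * ?u y)) =
          ?u y * (LINT x|lborel. k x * heat_kernel (real (Suc m)) (x - y))"
        by (simp add: mult_ac flip: integral_mult_right_zero)
    qed
    also have "\<dots> = 0"
      by (simp add: conv0 del: of_nat_Suc)
    finally show ?thesis .
  qed
  ultimately show ?thesis
    by (simp add: LIMSEQ_const_iff)
qed

text \<open>For a real function, the set where it is positive shows that its positive part has
  integral 0; the same applied to the negative, and then to real and imaginary parts.\<close>

lemma AE_zero_if_integral_zero:
  fixes k :: "'b \<Rightarrow> complex"
  assumes k: "integrable M k" and z: "\<And>A. A \<in> sets M \<Longrightarrow> (LINT x:A|M. k x) = 0"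
  shows "AE x in M. k x = 0"
proof -
  have [measurable]: "k \<in> borel_measurable M"
    using k by (rule borel_measurable_integrable)
  have *: "AE x in M. f x = 0" if f: "integrable M f" and zf: "\<And>A. A \<in> sets M \<Longrightarrow> (LINT x:A|M. f x) = 0"
    for f :: "'b \<Rightarrow> real"
  proof -
    have [measurable]: "f \<in> borel_measurable M"
      using f by (rule borel_measurable_integrable)
    have "AE x in M. max 0 (f x) = 0" if f: "integrable M f" and zf: "\<And>A. A \<in> sets M \<Longrightarrow> (LINT x:A|M. f x) = 0"
      for f :: "'b \<Rightarrow> real"
    proof -
      have [measurable]: "f \<in> borel_measurable M"
        using f by (rule borel_measurable_integrable)
      have "{x \<in> space M. 0 < f x} \<in> sets M" by measurable
      from zf [OF this] have "(LINT x|M. max 0 (f x)) = 0"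
        unfolding set_lebesgue_integral_def
        by (subst (asm) Bochner_Integration.integral_cong [where g = "\<lambda>x. max 0 (f x)" and N = M])
           (auto simp: indicator_def max_def)
      then show ?thesis
        using f by (subst (asm) integral_nonneg_eq_0_iff_AE) auto
    qed
    note m = this
    have "(LINT x:A|M. - f x) = 0" if "A \<in> sets M" for A
      using zf [OF that] by (simp add: set_lebesgue_integral_def)
    with m [OF f zf] m [of "\<lambda>x. - f x"] f have "AE x in M. max 0 (f x) = 0" "AE x in M. max 0 (- f x) = 0"
      by auto
    then show ?thesis
      by eventually_elim (auto simp: max_def split: if_splits)
  qed
  have ki: "integrable M (\<lambda>x. indicator A x *\<^sub>R k x)" if "A \<in> sets M" for A
    using integrable_mult_indicator [OF that k] .
  have "AE x in M. Re (k x) = 0"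
  proof (rule *)
    show "(LINT x:A|M. Re (k x)) = 0" if "A \<in> sets M" for A
      using z [OF that] integral_Re [OF ki [OF that]]
      by (simp add: set_lebesgue_integral_def)
  qed (use k in simp)
  moreover have "AE x in M. Im (k x) = 0"
  proof (rule *)
    show "(LINT x:A|M. Im (k x)) = 0" if "A \<in> sets M" for A
      using z [OF that] integral_Im [OF ki [OF that]]
      by (simp add: set_lebesgue_integral_def)
  qed (use k in simp)
  ultimately show ?thesis
    by eventually_elim (simp add: complex_eq_iff)
qed

text \<open>Vanishing integrals pass from boxes, which are stable under intersection and generate
  the Borel sets, to all Borel sets by Dynkin induction. The complement step needs the total
  integral, which is the transform at 0.\<close>

theorem fourier_L1_injective:
  fixes k :: "'a::euclidean_space \<Rightarrow> complex"
  assumes k: "integrable lborel k" and z: "\<And>\<xi>. fourier_L1 k \<xi> = 0"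
  shows "AE x in lborel. k x = 0"
proof (rule AE_zero_if_integral_zero [OF k])
  fix A :: "'a set" assume A: "A \<in> sets lborel"
  have si: "set_integrable lborel B k" if "B \<in> sets borel" for B
    using integrable_mult_indicator [of B lborel k] that k by (simp add: set_integrable_def)
  have tot: "(LINT x|lborel. k x) = 0"
    using z [of 0] by (simp add: fourier_L1_osc)
  have s: "sigma_sets UNIV (range (\<lambda>(a, b). box a b)) = sets (borel :: 'a measure)"
    by (subst borel_eq_box) (simp add: sets_measure_of)
  have "Int_stable (range (\<lambda>(a, b). box a b :: 'a set))"
    by (auto simp: Int_stable_def box_Int_box)
  moreover have "range (\<lambda>(a, b). box a b :: 'a set) \<subseteq> Pow UNIV" by simp
  moreover have "A \<in> sigma_sets UNIV (range (\<lambda>(a, b). box a b))" using A s by simp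
  ultimately show "(LINT x:A|lborel. k x) = 0"
  proof (induction rule: sigma_sets_induct_disjoint)
    case (basic B)
    then obtain a b where B: "B = box a b" by auto
    have "indicator B x *\<^sub>R k x = k x * indicator (box a b) x" for x
      by (simp add: B indicator_def)
    then show ?case
      using fourier_L1_zero_box_integral [OF k z, of a b] by (simp add: set_lebesgue_integral_def)
  next
    case empty
    show ?case by (simp add: set_lebesgue_integral_def)
  next
    case (compl B)
    then have "B \<in> sets borel" using s by simp
    have "indicator (UNIV - B) x *\<^sub>R k x = k x - indicator B x *\<^sub>R k x" for x
      by (simp add: indicator_def)
    then show ?case
      using si [OF \<open>B \<in> sets borel\<close>] k tot compl(2)
      by (simp add: set_lebesgue_integral_def set_integrable_def)
  next
    case (union B)
    have "(LINT x:(\<Union>i. B i)|lborel. k x) = (\<Sum>i. LINT x:B i|lborel. k x)"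
    proof (rule lebesgue_integral_countable_add)
      show B: "B i \<in> sets lborel" for i
        using union(2) s by auto
      show "i \<noteq> j \<Longrightarrow> B i \<inter> B j = {}" for i j
        using union(1) by (auto simp: disjoint_family_on_def)
      show "set_integrable lborel (\<Union>i. B i) k"
        using B by (intro si) auto
    qed
    then show ?case by (simp add: union)
  qed
qed

section \<open>Existence and uniqueness of the L^2 transform\<close>

lemma truncate_L2_tendsto:
  assumes f: "square_integrable f"
  shows "(\<lambda>m. LINT x|lborel. (cmod (f x - truncate m f x))\<^sup>2) \<longlonglongrightarrow> 0"
proof -
  have [measurable]: "f \<in> borel_measurable borel" "truncate m f \<in> borel_measurable borel" for m
    using f truncate_integrable(1) [OF f, of m] by (auto simp: square_integrable_def)
  have "(\<lambda>m. LINT x|lborel. (cmod (f x - truncate m f x))\<^sup>2) \<longlonglongrightarrow> (LINT x|(lborel :: 'a measure). 0)"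
  proof (rule integral_dominated_convergence [where w = "\<lambda>x. (cmod (f x))\<^sup>2"])
    show "AE x in lborel. (\<lambda>m. (cmod (f x - truncate m f x))\<^sup>2) \<longlonglongrightarrow> 0"
    proof (intro always_eventually allI)
      fix x
      have "(\<lambda>m. (cmod (f x - truncate m f x))\<^sup>2) \<longlonglongrightarrow> (cmod (f x - f x))\<^sup>2"
        by (intro tendsto_intros truncate_tendsto)
      then show "(\<lambda>m. (cmod (f x - truncate m f x))\<^sup>2) \<longlonglongrightarrow> 0" by simp
    qed
    show "AE x in lborel. norm ((cmod (f x - truncate m f x))\<^sup>2) \<le> (cmod (f x))\<^sup>2" for m
      by (auto simp: truncate_def indicator_def intro!: always_eventually)
  qed (use f in \<open>auto simp: square_integrable_def\<close>)
  then show ?thesis by simp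
qed

text \<open>The truncations are Cauchy in L^2, the Plancherel inequality carries this over to their
  transforms, and Riesz-Fischer provides the limit.\<close>

theorem has_L2_fourier_exists:
  assumes f: "square_integrable f"
  obtains g where "has_L2_fourier f g"
proof -
  note t = truncate_integrable [OF f]
  define K where "K = (2 * pi) powr real DIM('a)"
  have K: "K > 0" by (simp add: K_def)
  define E where "E m = (LINT x|lborel. (cmod (f x - truncate m f x))\<^sup>2)" for m
  have E: "E \<longlonglongrightarrow> 0"
    unfolding E_def [abs_def] by (rule truncate_L2_tendsto [OF f])
  have bd: "(LINT \<xi>|lborel. (cmod (fourier_L1 (truncate m f) \<xi> - fourier_L1 (truncate p f) \<xi>))\<^sup>2)
      \<le> K * (2 * E m + 2 * E p)" for m p
  proof -
    have "(LINT \<xi>|lborel. (cmod (fourier_L1 (\<lambda>x. truncate m f x - truncate p f x) \<xi>))\<^sup>2)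
        \<le> K * (LINT x|lborel. (cmod (truncate m f x - truncate p f x))\<^sup>2)"
      unfolding K_def
      by (intro plancherel_le Bochner_Integration.integrable_diff square_integrable_diff t)
    also have "\<dots> \<le> K * (2 * E m + 2 * E p)"
      using square_integrable_diff_triangle [OF t(1) t(1) f, of m p] K
      by (intro mult_left_mono) (simp_all add: E_def norm_minus_commute)
    finally show ?thesis
      by (simp add: fourier_L1_diff t)
  qed
  obtain g where "square_integrable g"
    "(\<lambda>m. LINT \<xi>|lborel. (cmod (g \<xi> - fourier_L1 (truncate m f) \<xi>))\<^sup>2) \<longlonglongrightarrow> 0"
  proof (rule Riesz_Fischer)
    show "square_integrable (fourier_L1 (truncate m f))" for m
      by (intro plancherel_le t)
    fix e :: real assume e: "e > 0"
    then have "e / (4 * K) > 0" using K by simp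
    from LIMSEQ_D [OF E this] obtain N where N: "\<And>m. m \<ge> N \<Longrightarrow> E m < e / (4 * K)"
      by (auto simp: abs_less_iff)
    show "\<exists>N. \<forall>m\<ge>N. \<forall>p\<ge>N. (LINT \<xi>|lborel. (cmod (fourier_L1 (truncate m f) \<xi> - fourier_L1 (truncate p f) \<xi>))\<^sup>2) < e"
    proof (intro exI allI impI)
      fix m p assume "m \<ge> N" "p \<ge> N"
      then have "2 * E m + 2 * E p < e / K"
        using N[of m] N[of p] K by (simp add: field_simps)
      then have "K * (2 * E m + 2 * E p) < e"
        using K by (simp add: field_simps)
      with bd show "(LINT \<xi>|lborel. (cmod (fourier_L1 (truncate m f) \<xi> - fourier_L1 (truncate p f) \<xi>))\<^sup>2) < e"
        by (rule le_less_trans)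
    qed
  qed
  then show ?thesis
    by (intro that) (simp add: has_L2_fourier_truncate)
qed

lemma has_L2_fourier_unique:
  assumes f: "square_integrable f" and g: "has_L2_fourier f g" and h: "has_L2_fourier f h"
  shows "AE \<xi> in lborel. g \<xi> = h \<xi>"
  using g h unfolding has_L2_fourier_truncate
  by (intro square_integrable_limit_unique [where s = "\<lambda>m. fourier_L1 (truncate m f)"])
     (auto intro: plancherel_le truncate_integrable f)

text \<open>An L^2 transform is determined only up to null sets; this permits a change of
  representative.\<close>

lemma has_L2_fourier_cong_AE:
  assumes f: "square_integrable f" and g: "has_L2_fourier f g" and h: "square_integrable h"
    and gh: "AE \<xi> in lborel. g \<xi> = h \<xi>"
  shows "has_L2_fourier f h"
proof -
  have [measurable]: "h \<in> borel_measurable borel" "g \<in> borel_measurable borel"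
    "fourier_L1 (truncate m f) \<in> borel_measurable borel" for m
    using h g truncate_integrable(1) [OF f, of m]
    by (auto simp: square_integrable_def has_L2_fourier_def)
  have "(LINT \<xi>|lborel. (cmod (h \<xi> - fourier_L1 (truncate m f) \<xi>))\<^sup>2) =
    (LINT \<xi>|lborel. (cmod (g \<xi> - fourier_L1 (truncate m f) \<xi>))\<^sup>2)" for m
    by (rule integral_cong_AE) (use gh in auto)
  with g h show ?thesis
    by (simp add: has_L2_fourier_truncate)
qed

section \<open>The inverse transform\<close>

definition inverse_fourier :: "('a::euclidean_space \<Rightarrow> complex) \<Rightarrow> 'a \<Rightarrow> complex" where
  "inverse_fourier g x = fourier_L1 g (- x) / complex_of_real ((2 * pi) powr real DIM('a))"

lemma inverse_fourier_cnj:
  "inverse_fourier g x = cnj (fourier_L1 (\<lambda>\<xi>. cnj (g \<xi>)) x) / complex_of_real ((2 * pi) powr real DIM('a))"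
  for g :: "'a::euclidean_space \<Rightarrow> complex"
  by (simp add: inverse_fourier_def fourier_L1_cnj)

lemma continuous_inverse_fourier:
  assumes "integrable lborel g"
  shows "continuous_on UNIV (inverse_fourier g)"
proof -
  have "continuous_on UNIV (\<lambda>x. fourier_L1 g (- x))"
    by (rule continuous_on_compose2 [OF continuous_fourier_L1 [OF assms]]) (auto intro: continuous_intros)
  then show ?thesis
    unfolding inverse_fourier_def [abs_def] by (intro continuous_intros) auto
qed

text \<open>Conjugation turns the inverse transform into a forward one, so the Plancherel bound puts
  it in L^2 and it has some transform \<open>h\<close>. Two uses of duality show that
  \<open>h\<close> and \<open>g\<close> have the same integrals against all heat symbols, and
  injectivity on L^1 then identifies them.\<close>

theorem inverse_fourier_L2:
  fixes g :: "'a::euclidean_space \<Rightarrow> complex"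
  assumes g: "integrable lborel g" and g2: "square_integrable g"
  shows "square_integrable (inverse_fourier g)" and "has_L2_fourier (inverse_fourier g) g"
proof -
  define K where "K = (2 * pi) powr real DIM('a)"
  have K: "K > 0" by (simp add: K_def)
  have [measurable]: "g \<in> borel_measurable borel"
    using g2 by (simp add: square_integrable_def)
  let ?c = "\<lambda>\<xi>. cnj (g \<xi>)"
  have c: "integrable lborel ?c" "square_integrable ?c"
    using g g2 by (auto simp: square_integrable_def)
  let ?f = "inverse_fourier g"
  have "square_integrable (fourier_L1 ?c)"
    by (intro plancherel_le c)
  then have "square_integrable (\<lambda>x. cnj (fourier_L1 ?c x))"
    by (auto simp: square_integrable_def)
  from square_integrable_cmult [OF this, of "1 / complex_of_real K"] show f: "square_integrable ?f"
    by (simp add: inverse_fourier_cnj [abs_def] K_def)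
  then obtain h where h: "has_L2_fourier ?f h"
    by (rule has_L2_fourier_exists)
  then have h2: "square_integrable h" by (simp add: has_L2_fourier_def)
  have [measurable]: "h \<in> borel_measurable borel"
    using h2 by (simp add: square_integrable_def)
  define w where "w y = heat_symbol 1 y" for y :: 'a
  have w: "integrable lborel (w y)" "square_integrable (w y)" 
    "fourier_L1 (w y) x = complex_of_real (K * heat_kernel 1 (x - y))" for x y
    by (simp_all add: w_def heat_symbol K_def)
  \<comment> \<open>A double transform is \<open>K\<close> times reflection; for \<open>w y\<close>,
    a character times an even real Gaussian, reflection is conjugation.\<close>
  have whh: "fourier_L1 (fourier_L1 (w y)) \<xi> = complex_of_real K * cnj (w y \<xi>)" for y \<xi>
  proof -
    have "fourier_L1 (fourier_L1 (w y)) \<xi> = (LINT x|lborel. osc \<xi> x * complex_of_real (K * heat_kernel 1 (x - y)))"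
      by (simp add: fourier_L1_osc [of "fourier_L1 _"] w)
    also have "\<dots> = (LINT x|lborel. (\<lambda>x. osc \<xi> (x + y) * complex_of_real (K * heat_kernel 1 x)) (x - y))"
      by simp
    also have "\<dots> = (LINT x|lborel. osc \<xi> (x + y) * complex_of_real (K * heat_kernel 1 x))"
      by (rule integral_lborel_shift) measurable
    also have "\<dots> = (complex_of_real (K * (1 / pi) powr (real DIM('a) / 2)) * osc \<xi> y) *
        (LINT x|lborel. osc \<xi> x * gauss 1 x)"
    proof -
      have "osc \<xi> (x + y) * complex_of_real (K * heat_kernel 1 x) =
        (complex_of_real (K * (1 / pi) powr (real DIM('a) / 2)) * osc \<xi> y) * (osc \<xi> x * gauss 1 x)" for x
        by (simp add: osc_add heat_kernel_def mult_ac)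
      then show ?thesis
        by (simp only: integral_mult_right_zero)
    qed
    also have "\<dots> = complex_of_real K * (complex_of_real ((1 / pi) powr (real DIM('a) / 2) * pi powr (real DIM('a) / 2))
         * (osc \<xi> y * gauss (1 / 4) \<xi>))"
      by (simp add: gauss_fourier mult_ac)
    also have "(1 / pi) powr (real DIM('a) / 2) * pi powr (real DIM('a) / 2) = 1"
      by (subst powr_mult [symmetric]) auto
    also have "osc \<xi> y * complex_of_real (gauss (1 / 4) \<xi>) = cnj (w y \<xi>)"
      by (simp add: w_def heat_symbol_def osc_minus osc_commute [of y])
    finally show ?thesis
      by simp
  qed
  have hw: "(LINT \<xi>|lborel. h \<xi> * w y \<xi>) = (LINT \<xi>|lborel. g \<xi> * w y \<xi>)" for y
  proof -
    have what: "integrable lborel (fourier_L1 (w y))"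
    proof -
      have "integrable lborel (\<lambda>x. complex_of_real (K * heat_kernel 1 (x - y)))"
        by (intro integrable_of_real integrable_mult_right heat_kernel_integral) simp
      then show ?thesis by (simp add: w(3) [abs_def])
    qed
    have "(LINT \<xi>|lborel. h \<xi> * w y \<xi>) = (LINT x|lborel. ?f x * fourier_L1 (w y) x)"
      by (rule has_L2_fourier_multiplication [OF h f w(1,2)])
    also have "\<dots> = (LINT x|lborel. cnj (fourier_L1 ?c x * fourier_L1 (w y) x) / complex_of_real K)"
      by (simp add: inverse_fourier_cnj w K_def)
    also have "\<dots> = cnj (LINT x|lborel. fourier_L1 ?c x * fourier_L1 (w y) x) / complex_of_real K"
      by (simp only: integral_divide_zero Bochner_Integration.integral_cnj)
    also have "(LINT x|lborel. fourier_L1 ?c x * fourier_L1 (w y) x) = (LINT x|lborel. ?c x * fourier_L1 (fourier_L1 (w y)) x)"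
      by (rule fourier_L1_multiplication [OF c(1) what])
    also have "\<dots> = complex_of_real K * cnj (LINT x|lborel. g x * w y x)"
      unfolding whh
      by (simp add: mult.left_commute Bochner_Integration.integral_cnj [symmetric] del: Bochner_Integration.integral_cnj)
    finally show ?thesis using K by simp
  qed
  \<comment> \<open>Multiplying by the Gaussian \<open>w 0\<close> makes the L^2 difference
    integrable, so injectivity on L^1 becomes available; nothing is lost, since the Gaussian never
    vanishes. Its transform at \<open>y\<close> is the pairing of \<open>h - g\<close> with
    \<open>w (- y)\<close>.\<close>
  define k where "k \<xi> = (h \<xi> - g \<xi>) * w 0 \<xi>" for \<xi>
  have k: "integrable lborel k"
    unfolding k_def by (intro square_integrable_mult_integrable square_integrable_diff h2 g2 w)
  have "fourier_L1 k y = 0" for y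
  proof -
    have "fourier_L1 k y = (LINT \<xi>|lborel. (h \<xi> - g \<xi>) * w (- y) \<xi>)"
      by (simp add: fourier_L1_osc k_def w_def heat_symbol_def mult_ac)
    also have "\<dots> = 0"
      unfolding left_diff_distrib
      by (subst Bochner_Integration.integral_diff) (auto intro: square_integrable_mult_integrable h2 g2 w simp: hw)
    finally show ?thesis .
  qed
  from fourier_L1_injective [OF k this] have "AE \<xi> in lborel. h \<xi> = g \<xi>"
    by eventually_elim (auto simp: k_def w_def heat_symbol_def osc_def gauss_def)
  with has_L2_fourier_cong_AE [OF f h g2] show "has_L2_fourier ?f g"
    by blast
qed

section \<open>The transform of the kernel as a Bessel function\<close>

text \<open>The integrand of Euler's Gamma integral, written in the shape of
  \<open>Gamma_conv_nn_integral_real\<close>.\<close>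

definition gamma_weight :: "real \<Rightarrow> real \<Rightarrow> real" where
  "gamma_weight a t = indicator {0..} t * t powr (a - 1) / exp t"

lemma gamma_weight_measurable [measurable]: "gamma_weight a \<in> borel_measurable borel"
  unfolding gamma_weight_def [abs_def] by measurable

lemma gamma_weight_nonneg [simp]: "0 \<le> gamma_weight a t"
  by (simp add: gamma_weight_def)

lemma gamma_weight_nonpos [simp]: "t \<le> 0 \<Longrightarrow> gamma_weight a t = 0"
  by (auto simp: gamma_weight_def indicator_def)

lemma gamma_weight_pos: "t > 0 \<Longrightarrow> gamma_weight a t = t powr (a - 1) * exp (- t)"
  by (simp add: gamma_weight_def exp_minus field_simps)

text \<open>Absorbs the constant of the Gaussian transform into the Gamma parameter. With
  \<open>b = n / 2\<close> this is where the Bessel index \<open>\<beta> - n / 2\<close>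
  originates.\<close>

lemma gamma_weight_shift:
  "(pi / t) powr b * gamma_weight a t = pi powr b * gamma_weight (a - b) t"
proof (cases "t > 0")
  case True
  then show ?thesis
    by (simp add: gamma_weight_pos powr_divide powr_diff powr_mult_base field_simps)
qed simp

lemma gamma_weight_integral:
  assumes "a > 0"
  shows "integrable lborel (gamma_weight a)" "(LINT t|lborel. gamma_weight a t) = Gamma a"
proof -
  have "has_bochner_integral lborel (gamma_weight a) (Gamma a)"
    using Gamma_conv_nn_integral_real [OF assms] assms
    by (intro has_bochner_integral_nn_integral) (auto simp: gamma_weight_def [abs_def] Gamma_real_nonneg)
  then show "integrable lborel (gamma_weight a)" "(LINT t|lborel. gamma_weight a t) = Gamma a"
    by (auto simp: has_bochner_integral_iff)
qed

lemma integrable_gamma_weight_gauss: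
  assumes "a > 0" "\<And>t. t > 0 \<Longrightarrow> 0 \<le> u t"
    and [measurable]: "u \<in> borel_measurable borel"
  shows "integrable lborel (\<lambda>t. gamma_weight a t * gauss (u t) x)"
proof (rule Bochner_Integration.integrable_bound [OF gamma_weight_integral(1) [OF assms(1)]])
  show "(\<lambda>t. gamma_weight a t * gauss (u t) x) \<in> borel_measurable lborel"
    unfolding gauss_def by measurable
  have "gamma_weight a t * gauss (u t) x \<le> gamma_weight a t" for t
    by (cases "t > 0") (auto intro!: mult_left_le gauss_le_1 assms)
  then show "AE t in lborel. norm (gamma_weight a t * gauss (u t) x) \<le> norm (gamma_weight a t)"
    by (simp add: abs_mult)
qed

text \<open>Substitute \<open>t\<close> by \<open>(1 + |x|^2) * t\<close> in the integral for
  \<open>Gamma \<beta>\<close>.\<close>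

lemma phi_gaussian_mixture:
  assumes b: "\<beta> > 0"
  shows "(LINT t|lborel. gamma_weight \<beta> t * gauss t x) = Gamma \<beta> * (1 + (norm x)\<^sup>2) powr (- \<beta>)"
proof -
  define a where "a = 1 + (norm x)\<^sup>2"
  have a: "a > 0" by (simp add: a_def add_pos_nonneg)
  have eq: "gamma_weight \<beta> (0 + a * t) = a powr (\<beta> - 1) * (gamma_weight \<beta> t * gauss t x)" for t
  proof (cases "t > 0")
    case True
    have "exp (- (a * t)) = exp (- t) * gauss t x"
      by (simp add: a_def gauss_def algebra_simps flip: exp_add)
    with True a show ?thesis
      by (simp add: gamma_weight_pos powr_mult)
  next
    case False
    then have "a * t \<le> 0" using a by (simp add: mult_le_0_iff)
    with False show ?thesis by simp
  qed
  have "Gamma \<beta> = a * (LINT t|lborel. gamma_weight \<beta> (0 + a * t))"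
    using lborel_integral_real_affine [of a "gamma_weight \<beta>" 0] a gamma_weight_integral(2) [OF b] by simp
  also have "\<dots> = a powr \<beta> * (LINT t|lborel. gamma_weight \<beta> t * gauss t x)"
    unfolding eq using a by (simp add: powr_diff)
  finally show ?thesis
    using a by (simp add: a_def [symmetric] powr_minus field_simps)
qed

text \<open>The transform of \<open>phi \<beta>\<close> as a mixture of the transformed Gaussians.
  It is defined at the origin as well, so its positivity and boundedness can be shown without Bessel
  asymptotics.\<close>

definition phi_symbol :: "real \<Rightarrow> 'a::euclidean_space \<Rightarrow> real" where
  "phi_symbol \<beta> \<xi> = pi powr (real DIM('a) / 2) / Gamma \<beta> *
     (LINT t|lborel. gamma_weight (\<beta> - real DIM('a) / 2) t * gauss (1 / (4 * t)) \<xi>)"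

lemma phi_symbol_measurable [measurable]: "phi_symbol \<beta> \<in> borel_measurable borel"
  unfolding phi_symbol_def [abs_def] gauss_def by measurable

text \<open>Fubini for the mixture. Integrating out \<open>x\<close> leaves a multiple of
  \<open>gamma_weight (\<beta> - n / 2)\<close>, and \<open>\<beta> > n / 2\<close> makes this
  integrable.\<close>

lemma phi_integrable_fourier:
  fixes \<xi> :: "'a::euclidean_space"
  assumes b: "\<beta> > real DIM('a) / 2"
  shows "integrable lborel (phi \<beta> :: 'a \<Rightarrow> complex)"
    and "fourier_L1 (phi \<beta>) \<xi> = complex_of_real (phi_symbol \<beta> \<xi>)"
proof -
  have b0: "\<beta> > 0" using b by (smt (verit) DIM_positive divide_pos_pos of_nat_0_less_iff)
  have G: "Gamma \<beta> > 0" using b0 by (rule Gamma_real_pos)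
  let ?n = "real DIM('a) / 2"
  let ?F = "\<lambda>(t, x::'a). complex_of_real (gamma_weight \<beta> t * gauss t x)"
  have shift: "gamma_weight \<beta> t * (pi / t) powr ?n = pi powr ?n * gamma_weight (\<beta> - ?n) t" for t
    using gamma_weight_shift [of t ?n \<beta>] by (simp add: mult.commute)
  have Fm [measurable]: "?F \<in> borel_measurable (borel \<Otimes>\<^sub>M borel)"
    unfolding gauss_def by measurable
  have F: "integrable (lborel \<Otimes>\<^sub>M lborel) ?F"
  proof (rule lborel_pair.Fubini_integrable)
    show "?F \<in> borel_measurable (lborel \<Otimes>\<^sub>M lborel)" by measurable
    have eq: "(LINT x|lborel. norm (?F (t, x))) = pi powr ?n * gamma_weight (\<beta> - ?n) t" for t
    proof (cases "t > 0")
      case True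
      then show ?thesis
        by (simp add: norm_mult gauss_integral shift)
    qed simp
    show "integrable lborel (\<lambda>t. LINT x|lborel. norm (?F (t, x)))"
      unfolding eq using b by (intro integrable_mult_right gamma_weight_integral) simp
    have "integrable lborel (\<lambda>x. ?F (t, x))" for t
    proof (cases "t > 0")
      case True
      then show ?thesis
        by (auto intro!: integrable_mult_right integrable_of_real gauss_integral)
    qed simp
    then show "AE t in lborel. integrable lborel (\<lambda>x. ?F (t, x))" by simp
  qed
  have mix: "(LINT t|lborel. ?F (t, x)) = complex_of_real (Gamma \<beta>) * phi \<beta> x" for x
    using phi_gaussian_mixture [OF b0, of x] by (simp add: phi_def flip: of_real_mult)
  have "integrable lborel (\<lambda>x. LINT t|lborel. ?F (t, x))"
    using lborel_pair.integrable_snd [of "\<lambda>t x. complex_of_real (gamma_weight \<beta> t * gauss t x)"] F by simp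
  then have "integrable lborel (\<lambda>x::'a. complex_of_real (Gamma \<beta>) * phi \<beta> x)"
    unfolding mix .
  from integrable_mult_right [OF this, of "1 / complex_of_real (Gamma \<beta>)"]
  show "integrable lborel (phi \<beta> :: 'a \<Rightarrow> complex)"
    using G by simp
  let ?H = "\<lambda>(t, x). osc \<xi> x * complex_of_real (gamma_weight \<beta> t * gauss t x)"
  have H: "integrable (lborel \<Otimes>\<^sub>M lborel) ?H"
  proof (rule Bochner_Integration.integrable_bound [OF F])
    show "?H \<in> borel_measurable (lborel \<Otimes>\<^sub>M lborel)"
      unfolding gauss_def by measurable
  qed (auto simp: norm_mult)
  have "complex_of_real (Gamma \<beta>) * fourier_L1 (phi \<beta>) \<xi> = fourier_L1 (\<lambda>x. complex_of_real (Gamma \<beta>) * phi \<beta> x) \<xi>"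
    by (simp add: fourier_L1_cmult)
  also have "\<dots> = (LINT x|lborel. LINT t|lborel. osc \<xi> x * complex_of_real (gamma_weight \<beta> t * gauss t x))"
    unfolding fourier_L1_osc mix [symmetric] by (simp only: prod.case integral_mult_right_zero)
  also have "\<dots> = (LINT t|lborel. LINT x|lborel. osc \<xi> x * complex_of_real (gamma_weight \<beta> t * gauss t x))"
    using lborel_pair.Fubini_integral [where f = "\<lambda>t x. osc \<xi> x * complex_of_real (gamma_weight \<beta> t * gauss t x)"] H
    by simp
  also have "\<dots> = (LINT t|lborel. complex_of_real (pi powr ?n * (gamma_weight (\<beta> - ?n) t * gauss (1 / (4 * t)) \<xi>)))"
  proof (intro Bochner_Integration.integral_cong refl)
    fix t :: real
    show "(LINT x|lborel. osc \<xi> x * complex_of_real (gamma_weight \<beta> t * gauss t x)) =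
        complex_of_real (pi powr ?n * (gamma_weight (\<beta> - ?n) t * gauss (1 / (4 * t)) \<xi>))"
    proof (cases "t > 0")
      case True
      have "(LINT x|lborel. osc \<xi> x * complex_of_real (gamma_weight \<beta> t * gauss t x)) =
          complex_of_real (gamma_weight \<beta> t) * (LINT x|lborel. osc \<xi> x * complex_of_real (gauss t x))"
        by (simp add: mult.left_commute flip: integral_mult_right_zero)
      also have "\<dots> = complex_of_real ((gamma_weight \<beta> t * (pi / t) powr ?n) * gauss (1 / (4 * t)) \<xi>)"
        using gauss_fourier(2) [OF True, of \<xi>] by simp
      finally show ?thesis
        by (simp only: shift mult.assoc)
    qed simp
  qed
  also have "\<dots> = complex_of_real (Gamma \<beta>) * complex_of_real (phi_symbol \<beta> \<xi>)"
    unfolding integral_complex_of_real integral_mult_right_zero phi_symbol_def using G by simp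
  finally show "fourier_L1 (phi \<beta>) \<xi> = complex_of_real (phi_symbol \<beta> \<xi>)"
    using G by simp
qed

text \<open>The integrand is nonnegative and strictly positive on \<open>{1..2}\<close>, which has
  positive measure.\<close>

lemma phi_symbol_pos:
  fixes \<xi> :: "'a::euclidean_space"
  assumes b: "\<beta> > real DIM('a) / 2"
  shows "phi_symbol \<beta> \<xi> > 0"
proof -
  have b0: "\<beta> > 0" using b by (smt (verit) DIM_positive divide_pos_pos of_nat_0_less_iff)
  let ?f = "\<lambda>t. gamma_weight (\<beta> - real DIM('a) / 2) t * gauss (1 / (4 * t)) \<xi>"
  have i: "integrable lborel ?f"
    using b by (intro integrable_gamma_weight_gauss) auto
  have "(LINT t|lborel. ?f t) \<noteq> 0"
  proof
    assume "(LINT t|lborel. ?f t) = 0"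
    then have "AE t in lborel. ?f t = 0"
      using i by (subst (asm) integral_nonneg_eq_0_iff_AE) auto
    then have "AE t::real in lborel. t \<notin> {1..2}"
      by eventually_elim (auto simp: gamma_weight_pos gauss_def)
    then have "{1..2::real} \<in> null_sets lborel"
      by (subst AE_iff_null_sets) auto
    then show False by (simp add: null_sets_def)
  qed
  moreover have "(LINT t|lborel. ?f t) \<ge> 0" by simp
  ultimately have "(LINT t|lborel. ?f t) > 0" by linarith
  then show ?thesis
    using Gamma_real_pos [OF b0] by (simp add: phi_symbol_def)
qed

lemma phi_symbol_le:
  fixes \<xi> :: "'a::euclidean_space"
  assumes b: "\<beta> > real DIM('a) / 2"
  shows "phi_symbol \<beta> \<xi> \<le> (LINT x|lborel. cmod (phi \<beta> (x::'a)))"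
  using cmod_fourier_L1_le [of "phi \<beta>" \<xi>] phi_symbol_pos [OF b, of \<xi>]
  by (simp add: phi_integrable_fourier [OF b])

text \<open>Integrating out the frequency gives the factor \<open>(4 * pi * t)^(n/2)\<close>, which
  raises the Gamma parameter from \<open>\<beta> - n / 2\<close> back to
  \<open>\<beta>\<close>.\<close>

lemma phi_symbol_integrable:
  assumes b: "\<beta> > real DIM('a::euclidean_space) / 2"
  shows "integrable lborel (phi_symbol \<beta> :: 'a \<Rightarrow> real)"
proof -
  let ?n = "real DIM('a) / 2"
  have b0: "\<beta> > 0" using b by (smt (verit) DIM_positive divide_pos_pos of_nat_0_less_iff)
  let ?F = "\<lambda>(t, \<xi>::'a). gamma_weight (\<beta> - ?n) t * gauss (1 / (4 * t)) \<xi>"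
  have eq: "(LINT \<xi>|lborel. norm (?F (t, \<xi>))) = (4 * pi) powr ?n * gamma_weight \<beta> t" for t
  proof (cases "t > 0")
    case True
    then have "1 / (4 * t) > 0" by simp
    from gauss_integral [OF this, where 'a = 'a]
    have "(LINT \<xi>|lborel. norm (?F (t, \<xi>))) = gamma_weight (\<beta> - ?n) t * (4 * pi * t) powr ?n"
      by (simp add: abs_mult mult_ac)
    also have "\<dots> = (4 * pi) powr ?n * gamma_weight \<beta> t"
    proof -
      have "t powr ?n * t powr (\<beta> - ?n - 1) = t powr (\<beta> - 1)"
        by (simp flip: powr_add)
      then show ?thesis
        using True by (simp add: gamma_weight_pos powr_mult mult_ac)
    qed
    finally show ?thesis .
  qed simp
  have "integrable (lborel \<Otimes>\<^sub>M lborel) ?F"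
  proof (rule lborel_pair.Fubini_integrable)
    show "?F \<in> borel_measurable (lborel \<Otimes>\<^sub>M lborel)"
      unfolding gauss_def by measurable
    show "integrable lborel (\<lambda>t. LINT \<xi>|lborel. norm (?F (t, \<xi>)))"
      unfolding eq using b0 by (intro integrable_mult_right gamma_weight_integral)
    have "integrable lborel (\<lambda>\<xi>. ?F (t, \<xi>))" for t
    proof (cases "t > 0")
      case True
      then show ?thesis
        by (auto intro!: integrable_mult_right gauss_integral)
    qed simp
    then show "AE t in lborel. integrable lborel (\<lambda>\<xi>. ?F (t, \<xi>))" by simp
  qed
  then have "integrable lborel (\<lambda>\<xi>::'a. LINT t|lborel. gamma_weight (\<beta> - ?n) t * gauss (1 / (4 * t)) \<xi>)"
    using lborel_pair.integrable_snd [of "\<lambda>t \<xi>. gamma_weight (\<beta> - ?n) t * gauss (1 / (4 * t)) (\<xi>::'a)"] by simp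
  then show ?thesis
    unfolding phi_symbol_def [abs_def] by (intro integrable_mult_right)
qed

section \<open>The Bessel formula\<close>

text \<open>Links Lebesgue integrals over the line to the gauge integral over the half-line in
  \<open>BesselK\<close>.\<close>

lemma integral_even:
  fixes h :: "real \<Rightarrow> real"
  assumes h: "integrable lborel h" and even: "\<And>s. h (- s) = h s"
  shows "(LINT s|lborel. h s) = 2 * integral {0..} h"
proof -
  have [measurable]: "h \<in> borel_measurable borel"
    using h by (auto dest: borel_measurable_integrable)
  have i: "integrable lborel (\<lambda>s. indicator A s * h s)" if "A \<in> sets borel" for A
    using integrable_mult_indicator [of A lborel h] h that by simp
  have s: "set_integrable lborel {0..} h"
    using i [of "{0..}"] by (simp add: set_integrable_def)
  have "(LINT s|lborel. h s) = (LINT s|lborel. indicator {0..} s * h s + indicator {..<0} s * h s)"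
    by (intro Bochner_Integration.integral_cong) (auto simp: indicator_def)
  also have "\<dots> = (LINT s|lborel. indicator {0..} s * h s) + (LINT s|lborel. indicator {..<0} s * h s)"
    by (intro Bochner_Integration.integral_add i) auto
  also have "(LINT s|lborel. indicator {..<0} s * h s) = (LINT s|lborel. indicator {..<0} (0 + (-1) * s) * h (0 + (-1) * s))"
    using lborel_integral_real_affine [of "-1" "\<lambda>s. indicator {..<0} s * h s" 0] by simp
  also have "\<dots> = (LINT s|lborel. indicator {0..} s * h s)"
  proof (rule integral_cong_AE)
    show "AE s in lborel. indicator {..<0} (0 + (-1) * s) * h (0 + (-1) * s) = indicator {0..} s * h s"
      using AE_lborel_singleton [of "0::real"] by eventually_elim (auto simp: indicator_def even)
  qed measurable
  also have "(LINT s|lborel. indicator {0..} s * h s) = integral {0..} h"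
    using set_borel_integral_eq_integral(2) [OF s] by (simp add: set_lebesgue_integral_def)
  finally show ?thesis by simp
qed

text \<open>The substitution \<^term>\<open>t = z / 2 * exp s\<close> symmetrises the integral.\<close>
lemma gamma_weight_BesselK:
  assumes a: "a > 0" and z: "z > 0"
  shows "(LINT t|lborel. gamma_weight a t * exp (- (z\<^sup>2 / (4 * t)))) = 2 * (z / 2) powr a * BesselK a z"
proof -
  let ?f = "\<lambda>t. t powr (a - 1) * exp (- t) * exp (- (z\<^sup>2 / (4 * t)))"
  let ?q = "\<lambda>s. (z / 2) powr a * exp (a * s - z * cosh s)"
  let ?h = "\<lambda>s. exp (- z * cosh s) * cosh (a * s)"
  have ind: "indicator {0<..} t * ?f t = gamma_weight a t * exp (- (z\<^sup>2 / (4 * t)))" for t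
    by (cases "t > 0") (auto simp: gamma_weight_pos)
  have "integrable lborel (\<lambda>t. gamma_weight a t * exp (- (z\<^sup>2 / (4 * t))))"
    using integrable_gamma_weight_gauss [OF a, of "\<lambda>t. 1 / (4 * t)" z] by (simp add: gauss_def)
  then have "set_integrable lborel {0<..} ?f"
    by (simp add: set_integrable_def ind)
  then have fa: "?f absolutely_integrable_on {0<..}"
    and fi: "(LINT t|lborel. gamma_weight a t * exp (- (z\<^sup>2 / (4 * t)))) = integral {0<..} ?f"
    using set_borel_integral_eq_integral(2) [of "{0<..}" ?f]
    by (auto simp: set_lebesgue_integral_def ind set_integrable_def intro!: integrable_completion [THEN iffD2])
  have img: "(\<lambda>s::real. z / 2 * exp s) ` UNIV = {0<..}"
  proof (intro equalityI subsetI)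
    fix t :: real assume "t \<in> {0<..}"
    then have "t = z / 2 * exp (ln (2 * t / z))" using z by simp
    then show "t \<in> (\<lambda>s::real. z / 2 * exp s) ` UNIV" by blast
  qed (use z in auto)
  \<comment> \<open>With \<open>t = (z / 2) * exp s\<close> one has
    \<open>t + z^2 / (4 * t) = z * cosh s\<close>, and the Jacobian \<open>t\<close> raises the
    power \<open>a - 1\<close> to \<open>a\<close>.\<close>
  have qf: "\<bar>z / 2 * exp s\<bar> * ?f (z / 2 * exp s) = ?q s" for s
  proof -
    have "(z / 2 * exp s) powr a = (z / 2) powr a * exp (a * s)"
      using z by (subst powr_mult) (auto simp: powr_def [of "exp s"])
    moreover have "z\<^sup>2 / (4 * (z / 2 * exp s)) = z / 2 * exp (- s)"
      using z by (simp add: exp_minus field_simps power2_eq_square)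
    moreover have "(z / 2 * exp s) * (z / 2 * exp s) powr (a - 1) = (z / 2 * exp s) powr a"
      using z by (simp add: powr_diff)
    moreover have "exp (- (z / 2 * exp s)) * exp (- (z / 2 * exp (- s))) = exp (- (z * cosh s))"
      by (simp add: cosh_def algebra_simps flip: exp_add)
    ultimately show ?thesis
      using z by (simp add: exp_diff exp_minus mult_ac) (simp add: field_simps)
  qed
  have "(\<lambda>s. \<bar>z / 2 * exp s\<bar> * ?f (z / 2 * exp s)) absolutely_integrable_on UNIV \<and>
      integral UNIV (\<lambda>s. \<bar>z / 2 * exp s\<bar> * ?f (z / 2 * exp s)) = integral {0<..} ?f"
  proof (rule has_absolute_integral_change_of_variables_1' [where S = UNIV and f = ?f
        and g = "\<lambda>s. z / 2 * exp s" and g' = "\<lambda>s. z / 2 * exp s", THEN iffD2])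
    show "((\<lambda>s. z / 2 * exp s) has_real_derivative z / 2 * exp s) (at s)" for s
      by (auto intro!: derivative_eq_intros)
    show "inj (\<lambda>s. z / 2 * exp s)"
      using z by (auto simp: inj_on_def)
    show "?f absolutely_integrable_on range (\<lambda>s. z / 2 * exp s) \<and>
        integral (range (\<lambda>s. z / 2 * exp s)) ?f = integral {0<..} ?f"
      unfolding img using fa by simp
  qed simp
  then have qa: "?q absolutely_integrable_on UNIV" and qi: "integral UNIV ?q = integral {0<..} ?f"
    unfolding qf by auto
  have "integrable lborel ?q"
  proof -
    have "?q \<in> borel_measurable lborel"
      unfolding cosh_def by measurable
    moreover have "integrable lebesgue ?q"
      using qa by (simp only: set_integrable_def indicator_UNIV scaleR_one)
    ultimately show ?thesis
      by (simp only: integrable_completion)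
  qed
  note q = this
  have qint: "(LINT s|lborel. ?q s) = integral {0<..} ?f"
    by (rule trans [OF integral_lborel [OF q, symmetric] qi])
  \<comment> \<open>Adding the reflected integrand replaces \<open>exp (a * s)\<close> by
    \<open>2 * cosh (a * s)\<close>, the even integrand of \<open>BesselK\<close>.\<close>
  have q': "integrable lborel (\<lambda>s. ?q (0 + (-1) * s))"
    using lborel_integrable_real_affine [OF q, of "-1" 0] by simp
  have "(LINT s|lborel. ?q s) = (LINT s|lborel. ?q (0 + (-1) * s))"
    using lborel_integral_real_affine [of "-1" ?q 0] by simp
  then have "2 * (LINT s|lborel. ?q s) = (LINT s|lborel. ?q s + ?q (0 + (-1) * s))"
    using Bochner_Integration.integral_add [OF q q'] by linarith
  also have eq: "?q s + ?q (0 + (-1) * s) = (2 * (z / 2) powr a) * ?h s" for s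
    by (simp add: cosh_def [of "a * s"] exp_diff exp_minus field_simps)
  have "integrable lborel (\<lambda>s. ?q s + ?q (0 + (-1) * s))"
    by (rule Bochner_Integration.integrable_add [OF q q'])
  then have "integrable lborel (\<lambda>s. (2 * (z / 2) powr a) * ?h s)"
    unfolding eq .
  from integrable_mult_right [OF this, of "1 / (2 * (z / 2) powr a)"]
  have h: "integrable lborel ?h" using z by simp
  have "(LINT s|lborel. ?q s + ?q (0 + (-1) * s)) = (2 * (z / 2) powr a) * (2 * integral {0..} ?h)"
    unfolding eq integral_mult_right_zero by (subst integral_even [OF h]) simp_all
  finally have "2 * (LINT s|lborel. ?q s) = (2 * (z / 2) powr a) * (2 * integral {0..} ?h)" .
  moreover have "2 * A = (2 * c) * (2 * I) \<Longrightarrow> A = 2 * c * I" for A c I :: real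
    by simp
  ultimately show ?thesis
    unfolding fi qint [symmetric] BesselK_def by blast
qed

text \<open>The same Bessel identity in two normalisations: the first serves the inner product
  \<open>Kip\<close>, the second the integrability condition in \<open>Kspace\<close>.\<close>

theorem phi_symbol_eq_Gfun:
  fixes \<xi> :: "'a::euclidean_space"
  assumes b: "\<beta> > real DIM('a) / 2" and x: "\<xi> \<noteq> 0"
  shows "phi_symbol \<beta> \<xi> = (2 * pi) powr real DIM('a) * Gfun DIM('a) \<beta> (norm \<xi>)"
    and "BesselK (\<beta> - real DIM('a) / 2) (norm \<xi>) * norm \<xi> powr (\<beta> - real DIM('a) / 2) =
      2 powr (\<beta> - 1 - real DIM('a) / 2) * pi powr (- real DIM('a) / 2) * Gamma \<beta> * phi_symbol \<beta> \<xi>"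
proof -
  have b0: "\<beta> > 0" using b by (smt (verit) DIM_positive divide_pos_pos of_nat_0_less_iff)
  have G: "Gamma \<beta> > 0" using b0 by (rule Gamma_real_pos)
  define n where "n = real DIM('a) / 2"
  define z where "z = norm \<xi>"
  define a where "a = \<beta> - n"
  have z: "z > 0" using x by (simp add: z_def)
  have a: "a > 0" using b by (simp add: a_def n_def)
  have P: "phi_symbol \<beta> \<xi> = pi powr n / Gamma \<beta> * (2 * (z / 2) powr a * BesselK a z)"
    using gamma_weight_BesselK [OF a z]
    by (simp add: phi_symbol_def n_def [symmetric] a_def [symmetric] gauss_def z_def [symmetric] mult.commute)
  have zz: "2 * (z / 2) powr a = 2 powr (1 - a) * z powr a"
    using z by (simp add: powr_divide powr_diff)
  have P': "phi_symbol \<beta> \<xi> = pi powr n * 2 powr (1 - a) / Gamma \<beta> * (BesselK a z * z powr a)"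
    unfolding P zz by simp
  have e1: "2 powr (\<beta> - 1 - n) * 2 powr (1 - a) = 1" "pi powr (- n) * pi powr n = 1"
    by (simp_all add: a_def flip: powr_add)
  have "2 powr (\<beta> - 1 - n) * pi powr (- n) * Gamma \<beta> * phi_symbol \<beta> \<xi>
      = (2 powr (\<beta> - 1 - n) * 2 powr (1 - a)) * (pi powr (- n) * pi powr n) * (BesselK a z * z powr a)"
    unfolding P' using G by simp
  then show "BesselK (\<beta> - real DIM('a) / 2) (norm \<xi>) * norm \<xi> powr (\<beta> - real DIM('a) / 2) =
      2 powr (\<beta> - 1 - real DIM('a) / 2) * pi powr (- real DIM('a) / 2) * Gamma \<beta> * phi_symbol \<beta> \<xi>"
    unfolding e1 by (simp add: n_def z_def a_def)
  have "Gfun DIM('a) \<beta> z = BesselK a z * z powr a / (2 powr (\<beta> - 1 + n) * pi powr n * Gamma \<beta>)"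
    using z by (simp add: Gfun_def Gform_def a_def n_def)
  then have "(2 * pi) powr (2 * n) * Gfun DIM('a) \<beta> z =
     ((2 * pi) powr (2 * n) / (2 powr (\<beta> - 1 + n) * pi powr n)) / Gamma \<beta> * (BesselK a z * z powr a)"
    by simp
  also have "(2 * pi) powr (2 * n) / (2 powr (\<beta> - 1 + n) * pi powr n) = pi powr n * 2 powr (1 - a)"
  proof -
    have "(2 * pi) powr (2 * n) = 2 powr (2 * n) * pi powr (2 * n)"
      by (simp add: powr_mult)
    also have "2 powr (2 * n) = 2 powr (1 - a) * 2 powr (\<beta> - 1 + n)"
      by (simp add: a_def flip: powr_add)
    also have "pi powr (2 * n) = pi powr n * pi powr n"
      by (simp flip: powr_add)
    finally have "(2 * pi) powr (2 * n) = 2 powr (1 - a) * 2 powr (\<beta> - 1 + n) * (pi powr n * pi powr n)" .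
    then show ?thesis
      by simp
  qed
  finally show "phi_symbol \<beta> \<xi> = (2 * pi) powr real DIM('a) * Gfun DIM('a) \<beta> (norm \<xi>)"
    unfolding P' by (simp add: n_def z_def)
qed

section \<open>The native space\<close>

lemma tendsto_zero_le:
  fixes g h :: "nat \<Rightarrow> real"
  assumes "h \<longlonglongrightarrow> 0" "\<And>m. 0 \<le> g m" "\<And>m. g m \<le> h m"
  shows "g \<longlonglongrightarrow> 0"
  using assms by (intro tendsto_sandwich [OF _ _ tendsto_const assms(1)] always_eventually) auto

text \<open>Consistency of the two transforms: the Plancherel inequality applied to \<open>f\<close>
  minus its truncation.\<close>

theorem has_L2_fourier_L1:
  assumes f: "integrable lborel f" and f2: "square_integrable f"
  shows "has_L2_fourier f (fourier_L1 f)"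
  unfolding has_L2_fourier_truncate
proof
  show "square_integrable (fourier_L1 f)"
    by (intro plancherel_le f f2)
  note t = truncate_integrable [OF f2]
  let ?K = "(2 * pi) powr real DIM('a)"
  let ?E = "\<lambda>m. LINT x|lborel. (cmod (f x - truncate m f x))\<^sup>2"
  have le: "(LINT \<xi>|lborel. (cmod (fourier_L1 f \<xi> - fourier_L1 (truncate m f) \<xi>))\<^sup>2) \<le> ?K * ?E m" for m
    using plancherel_le(2) [OF Bochner_Integration.integrable_diff [OF f t(2) [of m]] square_integrable_diff [OF f2 t(1) [of m]]]
    by (simp add: fourier_L1_diff f t)
  have "(\<lambda>m. ?K * ?E m) \<longlonglongrightarrow> 0"
    by (intro tendsto_mult_right_zero truncate_L2_tendsto f2)
  then show "(\<lambda>m. LINT \<xi>|lborel. (cmod (fourier_L1 f \<xi> - fourier_L1 (truncate m f) \<xi>))\<^sup>2) \<longlonglongrightarrow> 0"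
    by (rule tendsto_zero_le) (simp_all add: le)
qed

lemma truncate_add_cmult:
  "truncate m (\<lambda>x. a * f x + b * g x) = (\<lambda>x. a * truncate m f x + b * truncate m g x)"
  by (simp add: truncate_def fun_eq_iff algebra_simps)

lemma has_L2_fourier_linear:
  assumes f: "square_integrable f" and g: "square_integrable g"
    and F: "has_L2_fourier f F" and G: "has_L2_fourier g G"
  shows "has_L2_fourier (\<lambda>x. a * f x + b * g x) (\<lambda>\<xi>. a * F \<xi> + b * G \<xi>)"
  unfolding has_L2_fourier_truncate
proof
  have F2: "square_integrable F" and G2: "square_integrable G"
    using F G by (auto simp: has_L2_fourier_def)
  show "square_integrable (\<lambda>\<xi>. a * F \<xi> + b * G \<xi>)"
    by (intro square_integrable_add square_integrable_cmult F2 G2)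
  let ?dF = "\<lambda>m \<xi>. F \<xi> - fourier_L1 (truncate m f) \<xi>"
  let ?dG = "\<lambda>m \<xi>. G \<xi> - fourier_L1 (truncate m g) \<xi>"
  have dF: "square_integrable (?dF m)" and dG: "square_integrable (?dG m)" for m
    by (intro square_integrable_diff F2 G2 plancherel_le truncate_integrable f g)+
  have e: "a * F \<xi> + b * G \<xi> - fourier_L1 (truncate m (\<lambda>x. a * f x + b * g x)) \<xi> = a * ?dF m \<xi> + b * ?dG m \<xi>" for m \<xi>
    by (simp add: truncate_add_cmult fourier_L1_add fourier_L1_cmult truncate_integrable f g algebra_simps)
  have le: "(LINT \<xi>|lborel. (cmod (a * ?dF m \<xi> + b * ?dG m \<xi>))\<^sup>2) \<le>
      2 * (cmod a)\<^sup>2 * (LINT \<xi>|lborel. (cmod (?dF m \<xi>))\<^sup>2) + 2 * (cmod b)\<^sup>2 * (LINT \<xi>|lborel. (cmod (?dG m \<xi>))\<^sup>2)" for m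
    using square_integrable_add(2) [OF square_integrable_cmult [OF dF [of m], of a] square_integrable_cmult [OF dG [of m], of b]]
    by (simp add: norm_mult power_mult_distrib mult.assoc)
  have "(\<lambda>m. 2 * (cmod a)\<^sup>2 * (LINT \<xi>|lborel. (cmod (?dF m \<xi>))\<^sup>2) + 2 * (cmod b)\<^sup>2 * (LINT \<xi>|lborel. (cmod (?dG m \<xi>))\<^sup>2))
      \<longlonglongrightarrow> 2 * (cmod a)\<^sup>2 * 0 + 2 * (cmod b)\<^sup>2 * 0"
    using F G unfolding has_L2_fourier_truncate by (intro tendsto_intros) auto
  then have "(\<lambda>m. 2 * (cmod a)\<^sup>2 * (LINT \<xi>|lborel. (cmod (?dF m \<xi>))\<^sup>2) + 2 * (cmod b)\<^sup>2 * (LINT \<xi>|lborel. (cmod (?dG m \<xi>))\<^sup>2)) \<longlonglongrightarrow> 0"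
    by simp
  then show "(\<lambda>m. LINT \<xi>|lborel. (cmod (a * F \<xi> + b * G \<xi> - fourier_L1 (truncate m (\<lambda>x. a * f x + b * g x)) \<xi>))\<^sup>2) \<longlonglongrightarrow> 0"
    unfolding e by (rule tendsto_zero_le) (simp_all add: le)
qed

lemma has_L2_fourier_fourier_L2:
  "square_integrable f \<Longrightarrow> has_L2_fourier f (fourier_L2 f)"
  unfolding fourier_L2_def by (metis has_L2_fourier_exists someI)

lemma AE_nonzero: "AE \<xi> in lborel. (\<xi> :: 'a::euclidean_space) \<noteq> 0"
  using AE_lborel_singleton [of "0::'a"] .

text \<open>\<^term>\<open>u\<close> is the Fourier transform of \<^term>\<open>f\<close> divided by the square root of the symbol:
  this identifies the native space with the square integrable functions.\<close>
definition native_rep :: "real \<Rightarrow> ('a::euclidean_space \<Rightarrow> complex) \<Rightarrow> ('a \<Rightarrow> complex) \<Rightarrow> bool" where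
  "native_rep \<beta> f u \<longleftrightarrow> continuous_on UNIV f \<and> square_integrable f \<and> square_integrable u \<and>
     has_L2_fourier f (\<lambda>\<xi>. complex_of_real (sqrt (phi_symbol \<beta> \<xi>)) * u \<xi>)"

context
  fixes \<beta> :: real and dummy :: "'a::euclidean_space itself"
  assumes \<beta>: "\<beta> > real DIM('a) / 2"
begin

lemma sqrt_symbol:
  fixes \<xi> :: 'a
  shows "sqrt (phi_symbol \<beta> \<xi>) > 0" "(sqrt (phi_symbol \<beta> \<xi>))\<^sup>2 = phi_symbol \<beta> \<xi>"
  using phi_symbol_pos [OF \<beta>, of \<xi>] by auto

lemma square_integrable_sqrt_symbol:
  "square_integrable (\<lambda>\<xi>::'a. complex_of_real (sqrt (phi_symbol \<beta> \<xi>)))"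
  using phi_symbol_integrable [OF \<beta>] phi_symbol_pos [OF \<beta>]
  by (auto simp: square_integrable_def less_imp_le)

text \<open>Integrability of the symbol puts its root in L^2, so the product is in L^1; boundedness
  of the symbol keeps the product in L^2.\<close>

lemma sqrt_symbol_mult:
  fixes u :: "'a \<Rightarrow> complex"
  assumes u: "square_integrable u"
  shows "integrable lborel (\<lambda>\<xi>. complex_of_real (sqrt (phi_symbol \<beta> \<xi>)) * u \<xi>)"
    and "square_integrable (\<lambda>\<xi>. complex_of_real (sqrt (phi_symbol \<beta> \<xi>)) * u \<xi>)"
proof -
  have [measurable]: "u \<in> borel_measurable borel"
    using u by (simp add: square_integrable_def)
  show "integrable lborel (\<lambda>\<xi>. complex_of_real (sqrt (phi_symbol \<beta> \<xi>)) * u \<xi>)"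
    by (intro square_integrable_mult_integrable square_integrable_sqrt_symbol u)
  define C where "C = (LINT x|lborel. cmod (phi \<beta> (x::'a)))"
  have i: "integrable lborel (\<lambda>\<xi>. C * (cmod (u \<xi>))\<^sup>2)"
    using u by (auto simp: square_integrable_def)
  have le: "(cmod (complex_of_real (sqrt (phi_symbol \<beta> \<xi>)) * u \<xi>))\<^sup>2 \<le> C * (cmod (u \<xi>))\<^sup>2" for \<xi>
    using phi_symbol_le [OF \<beta>, of \<xi>] phi_symbol_pos [OF \<beta>, of \<xi>]
    by (auto simp: norm_mult power_mult_distrib C_def intro!: mult_right_mono)
  have "integrable lborel (\<lambda>\<xi>. (cmod (complex_of_real (sqrt (phi_symbol \<beta> \<xi>)) * u \<xi>))\<^sup>2)"
  proof (rule Bochner_Integration.integrable_bound [OF i])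
    show "AE \<xi> in lborel. norm ((cmod (complex_of_real (sqrt (phi_symbol \<beta> \<xi>)) * u \<xi>))\<^sup>2)
        \<le> norm (C * (cmod (u \<xi>))\<^sup>2)"
      unfolding real_norm_def
      by (intro always_eventually allI) (metis le abs_ge_self abs_of_nonneg order.trans zero_le_power2)
  qed measurable
  then show "square_integrable (\<lambda>\<xi>. complex_of_real (sqrt (phi_symbol \<beta> \<xi>)) * u \<xi>)"
    by (simp add: square_integrable_def)
qed

lemma native_rep_exists:
  fixes u :: "'a \<Rightarrow> complex"
  assumes u: "square_integrable u"
  obtains f where "native_rep \<beta> f u"
  using sqrt_symbol_mult [OF u] u
  by (intro that [of "inverse_fourier (\<lambda>\<xi>. complex_of_real (sqrt (phi_symbol \<beta> \<xi>)) * u \<xi>)"])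
     (auto simp: native_rep_def intro: continuous_inverse_fourier inverse_fourier_L2)

lemma native_rep_linear:
  fixes f g :: "'a \<Rightarrow> complex"
  assumes f: "native_rep \<beta> f u" and g: "native_rep \<beta> g v"
  shows "native_rep \<beta> (\<lambda>x. a * f x + b * g x) (\<lambda>\<xi>. a * u \<xi> + b * v \<xi>)"
proof -
  have "has_L2_fourier (\<lambda>x. a * f x + b * g x)
     (\<lambda>\<xi>. a * (complex_of_real (sqrt (phi_symbol \<beta> \<xi>)) * u \<xi>) + b * (complex_of_real (sqrt (phi_symbol \<beta> \<xi>)) * v \<xi>))"
    using f g unfolding native_rep_def by (intro has_L2_fourier_linear) auto
  then show ?thesis
    using f g unfolding native_rep_def
    by (auto intro!: continuous_intros square_integrable_add square_integrable_cmult simp: algebra_simps)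
qed

text \<open>Inversion, rewritten as the L^2 pairing of \<open>u\<close> with the representative that
  \<open>native_rep_phi\<close> gives to the translate by \<open>y\<close>. This is the reproducing
  property before normalisation.\<close>

lemma native_rep_value:
  fixes f :: "'a \<Rightarrow> complex"
  assumes f: "native_rep \<beta> f u"
  shows "(LINT \<xi>|lborel. u \<xi> * cnj (osc y \<xi> * complex_of_real (sqrt (phi_symbol \<beta> \<xi>)))) =
    complex_of_real ((2 * pi) powr real DIM('a)) * f y"
proof -
  have "fourier_L1 (\<lambda>\<xi>. complex_of_real (sqrt (phi_symbol \<beta> \<xi>)) * u \<xi>) (- y) =
    complex_of_real ((2 * pi) powr real DIM('a)) * f y"
    using f sqrt_symbol_mult unfolding native_rep_def
    by (intro has_L2_fourier_inversion) (auto simp: continuous_on_eq_continuous_at)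
  then show ?thesis
    by (simp add: fourier_L1_osc osc_minus mult_ac)
qed

text \<open>Translation becomes modulation, and the transform is the symbol itself: one square root
  is the factor in \<open>native_rep\<close>, the other remains in the representative.\<close>

lemma native_rep_phi:
  "native_rep \<beta> (\<lambda>x::'a. phi \<beta> (x - y)) (\<lambda>\<xi>. osc y \<xi> * complex_of_real (sqrt (phi_symbol \<beta> \<xi>)))"
proof -
  let ?f = "\<lambda>x::'a. phi \<beta> (x - y)"
  have b0: "\<beta> > 0" using \<beta> by (smt (verit) DIM_positive divide_pos_pos of_nat_0_less_iff)
  have c: "continuous_on UNIV ?f"
    unfolding phi_def
    by (intro continuous_intros) (metis add_pos_nonneg less_irrefl zero_le_power2 zero_less_one)
  then have m [measurable]: "?f \<in> borel_measurable borel" "(phi \<beta> :: 'a \<Rightarrow> complex) \<in> borel_measurable borel"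
    using phi_integrable_fourier(1) [OF \<beta>]
    by (auto intro: borel_measurable_continuous_onI dest: borel_measurable_integrable)
  have i: "integrable lborel ?f"
    using phi_integrable_fourier(1) [OF \<beta>] by (simp add: integral_lborel_shift(2))
  \<comment> \<open>A bound by 1 makes the square smaller than the function, so integrability
    implies square integrability.\<close>
  have le1: "cmod (phi \<beta> x) \<le> 1" for x :: 'a
  proof -
    have "(1 + (norm x)\<^sup>2) powr (- \<beta>) \<le> (1 + (norm x)\<^sup>2) powr 0"
      using b0 by (intro powr_mono) auto
    also have "\<dots> = 1"
      by (simp add: add_pos_nonneg less_imp_neq [symmetric])
    finally show ?thesis by (simp add: phi_def)
  qed
  have sq: "square_integrable ?f"
    unfolding square_integrable_def
  proof
    show "integrable lborel (\<lambda>x. (cmod (?f x))\<^sup>2)"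
    proof (rule Bochner_Integration.integrable_bound [OF i])
      show "AE x in lborel. norm ((cmod (?f x))\<^sup>2) \<le> norm (?f x)"
        using le1 by (auto simp: power2_eq_square mult_left_le)
    qed measurable
  qed (use m in simp)
  have ft: "fourier_L1 ?f \<xi> = complex_of_real (sqrt (phi_symbol \<beta> \<xi>)) * (osc y \<xi> * complex_of_real (sqrt (phi_symbol \<beta> \<xi>)))" for \<xi>
  proof -
    have "fourier_L1 ?f \<xi> = (LINT x|lborel. (\<lambda>x. osc \<xi> (x + y) * phi \<beta> x) (x - y))"
      by (simp add: fourier_L1_osc)
    also have "\<dots> = (LINT x|lborel. osc \<xi> (x + y) * phi \<beta> x)"
      by (rule integral_lborel_shift) measurable
    also have "\<dots> = osc \<xi> y * fourier_L1 (phi \<beta>) \<xi>"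
      by (simp add: osc_add fourier_L1_osc mult_ac flip: integral_mult_right_zero)
    also have "complex_of_real (phi_symbol \<beta> \<xi>) =
        complex_of_real (sqrt (phi_symbol \<beta> \<xi>)) * complex_of_real (sqrt (phi_symbol \<beta> \<xi>))"
      using sqrt_symbol(2) [of \<xi>] by (simp add: power2_eq_square flip: of_real_mult)
    then have "osc \<xi> y * fourier_L1 (phi \<beta>) \<xi> = complex_of_real (sqrt (phi_symbol \<beta> \<xi>)) * (osc y \<xi> * complex_of_real (sqrt (phi_symbol \<beta> \<xi>)))"
      by (simp add: phi_integrable_fourier(2) [OF \<beta>] osc_commute [of y] mult_ac)
    finally show ?thesis .
  qed
  have "square_integrable (\<lambda>\<xi>. osc y \<xi> * complex_of_real (sqrt (phi_symbol \<beta> \<xi>)))"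
    using square_integrable_sqrt_symbol by (simp add: square_integrable_def norm_mult)
  with c sq has_L2_fourier_L1 [OF i sq] show ?thesis
    by (simp add: native_rep_def ft [abs_def])
qed

text \<open>Off the origin the denominator in \<open>Kspace\<close> is a positive constant times the
  symbol, so the integrability condition says that the transform divided by the root of the symbol
  is in L^2.\<close>

lemma Kspace_iff_native_rep:
  fixes f :: "'a \<Rightarrow> complex"
  shows "f \<in> Kspace (\<beta> - real DIM('a) / 2) \<longleftrightarrow> (\<exists>u. native_rep \<beta> f u)"
proof -
  define c where "c = 2 powr (\<beta> - 1 - real DIM('a) / 2) * pi powr (- real DIM('a) / 2) * Gamma \<beta>"
  have b0: "\<beta> > 0" using \<beta> by (smt (verit) DIM_positive divide_pos_pos of_nat_0_less_iff)
  have c: "c > 0" using Gamma_real_pos [OF b0] by (simp add: c_def)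
  have key: "integrable lborel (\<lambda>\<xi>::'a. (cmod (g \<xi>))\<^sup>2 / (BesselK (\<beta> - real DIM('a) / 2) (norm \<xi>) * norm \<xi> powr (\<beta> - real DIM('a) / 2)))
      \<longleftrightarrow> square_integrable (\<lambda>\<xi>. g \<xi> / complex_of_real (sqrt (phi_symbol \<beta> \<xi>)))"
    if g: "has_L2_fourier f g" for g
  proof -
    have [measurable]: "g \<in> borel_measurable borel"
      using g by (simp add: has_L2_fourier_def square_integrable_def)
    \<comment> \<open>At the origin the power of the norm is 0 and division by 0 yields 0, so that
      point needs its own case; it is discarded as a null set afterwards.\<close>
    have e: "(cmod (g \<xi>))\<^sup>2 / (BesselK (\<beta> - real DIM('a) / 2) (norm \<xi>) * norm \<xi> powr (\<beta> - real DIM('a) / 2))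
      = (if \<xi> = 0 then 0 else (1 / c) * (cmod (g \<xi> / complex_of_real (sqrt (phi_symbol \<beta> \<xi>))))\<^sup>2)" for \<xi>
    proof (cases "\<xi> = 0")
      case False
      from phi_symbol_eq_Gfun(2) [OF \<beta> this]
      have "BesselK (\<beta> - real DIM('a) / 2) (norm \<xi>) * norm \<xi> powr (\<beta> - real DIM('a) / 2) = c * phi_symbol \<beta> \<xi>"
        unfolding c_def .
      with False show ?thesis
        using phi_symbol_pos [OF \<beta>, of \<xi>] by (simp add: norm_divide power_divide)
    qed simp
    have "integrable lborel (\<lambda>\<xi>. if \<xi> = 0 then 0 else (1 / c) * (cmod (g \<xi> / complex_of_real (sqrt (phi_symbol \<beta> \<xi>))))\<^sup>2)
      \<longleftrightarrow> integrable lborel (\<lambda>\<xi>. (1 / c) * (cmod (g \<xi> / complex_of_real (sqrt (phi_symbol \<beta> \<xi>))))\<^sup>2)"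
    proof (rule integrable_cong_AE)
      show "AE \<xi> in lborel. (if \<xi> = 0 then 0 else (1 / c) * (cmod (g \<xi> / complex_of_real (sqrt (phi_symbol \<beta> \<xi>))))\<^sup>2)
          = (1 / c) * (cmod (g \<xi> / complex_of_real (sqrt (phi_symbol \<beta> \<xi>))))\<^sup>2"
        using AE_nonzero by eventually_elim simp
    qed measurable
    also have "\<dots> \<longleftrightarrow> integrable lborel (\<lambda>\<xi>. (cmod (g \<xi> / complex_of_real (sqrt (phi_symbol \<beta> \<xi>))))\<^sup>2)"
      using c by (subst integrable_mult_left_iff) auto
    finally show ?thesis
      unfolding e square_integrable_def by simp
  qed
  have div: "complex_of_real (sqrt (phi_symbol \<beta> \<xi>)) * (z / complex_of_real (sqrt (phi_symbol \<beta> \<xi>))) = z"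
    "(complex_of_real (sqrt (phi_symbol \<beta> \<xi>)) * z) / complex_of_real (sqrt (phi_symbol \<beta> \<xi>)) = z" for z and \<xi> :: 'a
    using sqrt_symbol(1) [of \<xi>] by auto
  show ?thesis
  proof
    assume "f \<in> Kspace (\<beta> - real DIM('a) / 2)"
    then obtain g where f: "continuous_on UNIV f" "square_integrable f" and g: "has_L2_fourier f g"
      and i: "integrable lborel (\<lambda>\<xi>::'a. (cmod (g \<xi>))\<^sup>2 / (BesselK (\<beta> - real DIM('a) / 2) (norm \<xi>) * norm \<xi> powr (\<beta> - real DIM('a) / 2)))"
      by (auto simp: Kspace_def)
    have "native_rep \<beta> f (\<lambda>\<xi>. g \<xi> / complex_of_real (sqrt (phi_symbol \<beta> \<xi>)))"
      using f g i key [OF g] unfolding native_rep_def div by blast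
    then show "\<exists>u. native_rep \<beta> f u" by blast
  next
    assume "\<exists>u. native_rep \<beta> f u"
    then obtain u where u: "continuous_on UNIV f" "square_integrable f" "square_integrable u"
      "has_L2_fourier f (\<lambda>\<xi>. complex_of_real (sqrt (phi_symbol \<beta> \<xi>)) * u \<xi>)"
      by (auto simp: native_rep_def)
    with key [OF u(4)] show "f \<in> Kspace (\<beta> - real DIM('a) / 2)"
      unfolding Kspace_def div by blast
  qed
qed

text \<open>The transforms chosen in \<open>fourier_L2\<close> agree almost everywhere with root
  times representative. The two roots cancel against \<open>Gfun\<close>, which is the symbol over
  \<open>K\<close>; this leaves one \<open>K\<close> against the prefactor
  \<open>1 / (K * K)\<close>.\<close>

lemma Kip_native_rep:
  fixes f g :: "'a \<Rightarrow> complex"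
  assumes f: "native_rep \<beta> f u" and g: "native_rep \<beta> g v"
  shows "Kip \<beta> f g = (LINT \<xi>|lborel. u \<xi> * cnj (v \<xi>)) / complex_of_real ((2 * pi) powr real DIM('a))"
proof -
  define K where "K = (2 * pi) powr real DIM('a)"
  have K: "K > 0" by (simp add: K_def)
  have KK: "(2 * pi) powr (- 2 * real DIM('a)) = 1 / (K * K)"
    by (simp add: K_def powr_minus powr_add [symmetric] divide_inverse)
  have [measurable]: "u \<in> borel_measurable borel" "v \<in> borel_measurable borel"
    using f g by (auto simp: native_rep_def square_integrable_def)
  have [measurable]: "fourier_L2 f \<in> borel_measurable borel" "fourier_L2 g \<in> borel_measurable borel"
    using f g has_L2_fourier_fourier_L2
    by (auto simp: native_rep_def has_L2_fourier_def square_integrable_def)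
  \<comment> \<open>Isolating the value at the origin exposes \<open>Gfun\<close> as a measurable
    function of the frequency.\<close>
  have Ge: "Gfun DIM('a) \<beta> (norm \<xi>) = (if \<xi> = 0 then Gfun DIM('a) \<beta> 0 else phi_symbol \<beta> \<xi> / K)" for \<xi> :: 'a
    using phi_symbol_eq_Gfun(1) [OF \<beta>, of \<xi>] by (simp add: K_def)
  have F: "AE \<xi> in lborel. fourier_L2 f \<xi> = complex_of_real (sqrt (phi_symbol \<beta> \<xi>)) * u \<xi>"
    using f by (intro has_L2_fourier_unique [of f] has_L2_fourier_fourier_L2) (auto simp: native_rep_def)
  have G: "AE \<xi> in lborel. fourier_L2 g \<xi> = complex_of_real (sqrt (phi_symbol \<beta> \<xi>)) * v \<xi>"
    using g by (intro has_L2_fourier_unique [of g] has_L2_fourier_fourier_L2) (auto simp: native_rep_def)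
  have "(LINT \<xi>|lborel. fourier_L2 f \<xi> * cnj (fourier_L2 g \<xi>) / complex_of_real (Gfun DIM('a) \<beta> (norm \<xi>)))
     = (LINT \<xi>|lborel. complex_of_real K * (u \<xi> * cnj (v \<xi>)))"
  proof (rule integral_cong_AE)
    show "AE \<xi> in lborel. fourier_L2 f \<xi> * cnj (fourier_L2 g \<xi>) / complex_of_real (Gfun DIM('a) \<beta> (norm \<xi>))
        = complex_of_real K * (u \<xi> * cnj (v \<xi>))"
      using F G AE_nonzero
    proof eventually_elim
      fix \<xi> :: 'a
      assume *: "fourier_L2 f \<xi> = complex_of_real (sqrt (phi_symbol \<beta> \<xi>)) * u \<xi>"
        "fourier_L2 g \<xi> = complex_of_real (sqrt (phi_symbol \<beta> \<xi>)) * v \<xi>" "\<xi> \<noteq> 0"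
      have "complex_of_real (sqrt (phi_symbol \<beta> \<xi>)) * complex_of_real (sqrt (phi_symbol \<beta> \<xi>)) = complex_of_real (phi_symbol \<beta> \<xi>)"
        using sqrt_symbol(2) [of \<xi>] by (simp add: power2_eq_square flip: of_real_mult)
      then have FG: "fourier_L2 f \<xi> * cnj (fourier_L2 g \<xi>) = complex_of_real (phi_symbol \<beta> \<xi>) * (u \<xi> * cnj (v \<xi>))"
        by (simp add: * mult_ac)
      then show "fourier_L2 f \<xi> * cnj (fourier_L2 g \<xi>) / complex_of_real (Gfun DIM('a) \<beta> (norm \<xi>))
        = complex_of_real K * (u \<xi> * cnj (v \<xi>))"
        unfolding Ge FG using *(3) K phi_symbol_pos [OF \<beta>, of \<xi>] by simp
    qed
  qed (unfold Ge, measurable)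
  then show ?thesis
    unfolding Kip_def KK K_def [symmetric] using K by simp
qed

end

section \<open>The reproducing kernel Hilbert space\<close>

text \<open>The representative vanishes only almost everywhere, but \<open>native_rep_value\<close>
  turns this into vanishing of \<open>f\<close> at every point.\<close>

lemma native_rep_zero:
  fixes f :: "'a::euclidean_space \<Rightarrow> complex"
  assumes \<beta>: "\<beta> > real DIM('a) / 2" and f: "native_rep \<beta> f u" and z: "(LINT \<xi>|lborel. (cmod (u \<xi>))\<^sup>2) = 0"
  shows "f = (\<lambda>_. 0)"
proof
  fix y
  have u: "square_integrable u" using f by (simp add: native_rep_def)
  then have [measurable]: "u \<in> borel_measurable borel" by (simp add: square_integrable_def)
  have "AE \<xi> in lborel. u \<xi> = 0"
    by (rule square_integrable_zero_AE [OF u z])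
  then have "(LINT \<xi>|lborel. u \<xi> * cnj (osc y \<xi> * complex_of_real (sqrt (phi_symbol \<beta> \<xi>)))) = (LINT \<xi>|(lborel :: 'a measure). 0)"
    by (intro integral_cong_AE) auto
  with native_rep_value [OF \<beta> f, of y] show "f y = 0"
    by simp
qed

text \<open>Each clause is transported from L^2 along the passage from \<open>f\<close> to its
  representative \<open>u\<close>.\<close>

theorem is_rkhs_Kspace:
  fixes \<beta> :: real
  assumes \<beta>: "\<beta> > real DIM('a::euclidean_space) / 2"
  shows "is_rkhs (Kspace (\<beta> - real DIM('a) / 2) :: ('a \<Rightarrow> complex) set) (Kip \<beta>) (\<lambda>x y. phi \<beta> (x - y))"
proof -
  define K where "K = (2 * pi) powr real DIM('a)"
  have K: "K > 0" by (simp add: K_def)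
  define H where "H = (Kspace (\<beta> - real DIM('a) / 2) :: ('a \<Rightarrow> complex) set)"
  have mem: "f \<in> H \<longleftrightarrow> (\<exists>u. native_rep \<beta> f u)" for f
    unfolding H_def by (rule Kspace_iff_native_rep [OF \<beta>])
  have ip: "Kip \<beta> f g = (LINT \<xi>|lborel. u \<xi> * cnj (v \<xi>)) / complex_of_real K"
    if "native_rep \<beta> f u" "native_rep \<beta> g v" for f g :: "'a \<Rightarrow> complex" and u v
    unfolding K_def by (rule Kip_native_rep [OF \<beta> that])
  have sq: "square_integrable u" if "native_rep \<beta> f u" for f :: "'a \<Rightarrow> complex" and u
    using that by (simp add: native_rep_def)
  have sqc: "square_integrable (\<lambda>\<xi>. cnj (u \<xi>))" if "native_rep \<beta> f u" for f :: "'a \<Rightarrow> complex" and u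
    using sq [OF that] by (auto simp: square_integrable_def)
  have norm: "Kip \<beta> f f = complex_of_real ((LINT \<xi>|lborel. (cmod (u \<xi>))\<^sup>2) / K)" if "native_rep \<beta> f u" for f :: "'a \<Rightarrow> complex" and u
    by (simp add: ip [OF that that] complex_norm_square [symmetric] del: of_real_power)
  have lin: "(\<lambda>x. a * f x + b * g x) \<in> H" if "f \<in> H" "g \<in> H" for f g a b
    using that native_rep_linear [OF \<beta>] unfolding mem by blast
  have ker: "(\<lambda>x. phi \<beta> (x - y)) \<in> H" for y
    using native_rep_phi [OF \<beta>] unfolding mem by blast
  have zero: "(\<lambda>_. 0) \<in> H"
    using lin [OF ker ker, of 0 _ 0] by simp
  have add: "(\<lambda>x. f x + g x) \<in> H" if "f \<in> H" "g \<in> H" for f g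
    using lin [OF that, of 1 1] by simp
  have scale: "(\<lambda>x. c * f x) \<in> H" if "f \<in> H" for f c
    using lin [OF that that, of c 0] by simp
  have ip_lin: "Kip \<beta> (\<lambda>x. a * f x + b * g x) h = a * Kip \<beta> f h + b * Kip \<beta> g h"
    if fgh: "f \<in> H" "g \<in> H" "h \<in> H" for f g h a b
  proof -
    obtain u v w where r: "native_rep \<beta> f u" "native_rep \<beta> g v" "native_rep \<beta> h w"
      using fgh unfolding mem by blast
    have i: "integrable lborel (\<lambda>\<xi>. u \<xi> * cnj (w \<xi>))" "integrable lborel (\<lambda>\<xi>. v \<xi> * cnj (w \<xi>))"
      by (intro square_integrable_mult_integrable sq sqc; fact)+
    have e: "(a * u \<xi> + b * v \<xi>) * cnj (w \<xi>) = a * (u \<xi> * cnj (w \<xi>)) + b * (v \<xi> * cnj (w \<xi>))" for \<xi>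
      by (simp add: algebra_simps)
    show ?thesis
      unfolding ip [OF native_rep_linear [OF \<beta> r(1,2)] r(3)] ip [OF r(1,3)] ip [OF r(2,3)] e
      using i by (simp add: add_divide_distrib)
  qed
  have herm: "Kip \<beta> g f = cnj (Kip \<beta> f g)" if fg: "f \<in> H" "g \<in> H" for f g
  proof -
    obtain u v where r: "native_rep \<beta> f u" "native_rep \<beta> g v"
      using fg unfolding mem by blast
    show ?thesis
      unfolding ip [OF r(2,1)] ip [OF r]
      by (simp add: Bochner_Integration.integral_cnj [symmetric] mult.commute del: Bochner_Integration.integral_cnj)
  qed
  have pos: "Im (Kip \<beta> f f) = 0" "Re (Kip \<beta> f f) \<ge> 0" if f: "f \<in> H" for f
  proof -
    obtain u where r: "native_rep \<beta> f u" using f unfolding mem by blast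
    show "Im (Kip \<beta> f f) = 0" "Re (Kip \<beta> f f) \<ge> 0"
      unfolding norm [OF r] using K by simp_all
  qed
  have definite: "f = (\<lambda>_. 0)" if f: "f \<in> H" and z: "Kip \<beta> f f = 0" for f
  proof -
    obtain u where r: "native_rep \<beta> f u" using f unfolding mem by blast
    show ?thesis
      by (rule native_rep_zero [OF \<beta> r]) (use z K in \<open>simp add: norm [OF r]\<close>)
  qed
  have complete: "\<exists>f\<in>H. (\<lambda>m. Re (Kip \<beta> (\<lambda>x. s m x - f x) (\<lambda>x. s m x - f x))) \<longlonglongrightarrow> 0"
    if s: "\<And>m. s m \<in> H"
      and Cauchy: "\<And>e. e > 0 \<Longrightarrow> \<exists>N. \<forall>m\<ge>N. \<forall>p\<ge>N. Re (Kip \<beta> (\<lambda>x. s m x - s p x) (\<lambda>x. s m x - s p x)) < e"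
    for s
  proof -
    have "\<forall>m. \<exists>u. native_rep \<beta> (s m) u" using s unfolding mem by blast
    then obtain u where u: "\<And>m. native_rep \<beta> (s m) (u m)" by metis
    have diff: "native_rep \<beta> (\<lambda>x. f x - g x) (\<lambda>\<xi>. v \<xi> - w \<xi>)"
      if "native_rep \<beta> f v" "native_rep \<beta> g w" for f g :: "'a \<Rightarrow> complex" and v w
      using native_rep_linear [OF \<beta> that, of 1 "- 1"] by simp
    obtain h where h: "square_integrable h" "(\<lambda>m. LINT x|lborel. (cmod (h x - u m x))\<^sup>2) \<longlonglongrightarrow> 0"
    proof (rule Riesz_Fischer)
      show "square_integrable (u m)" for m by (rule sq [OF u])
      fix e :: real assume "e > 0"
      then have "e / K > 0" using K by simp
      from Cauchy [OF this] obtain N where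
        N: "\<And>m p. m \<ge> N \<Longrightarrow> p \<ge> N \<Longrightarrow> Re (Kip \<beta> (\<lambda>x. s m x - s p x) (\<lambda>x. s m x - s p x)) < e / K"
        by blast
      have "(LINT x|lborel. (cmod (u m x - u p x))\<^sup>2) < e" if "m \<ge> N" "p \<ge> N" for m p
        using N [OF that] K by (simp add: norm [OF diff [OF u u]] divide_less_cancel)
      then show "\<exists>N. \<forall>m\<ge>N. \<forall>p\<ge>N. (LINT x|lborel. (cmod (u m x - u p x))\<^sup>2) < e" by blast
    qed
    obtain f where f: "native_rep \<beta> f h"
      by (rule native_rep_exists [OF \<beta> h(1)])
    have eq: "Re (Kip \<beta> (\<lambda>x. s m x - f x) (\<lambda>x. s m x - f x)) = (LINT x|lborel. (cmod (h x - u m x))\<^sup>2) / K" for m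
      by (simp add: norm [OF diff [OF u f]] norm_minus_commute)
    have "(\<lambda>m. (LINT x|lborel. (cmod (h x - u m x))\<^sup>2) / K) \<longlonglongrightarrow> 0"
      using tendsto_divide [OF h(2) tendsto_const [of K]] K by simp
    moreover have "f \<in> H" using f unfolding mem by blast
    ultimately show ?thesis unfolding eq [symmetric] by blast
  qed
  have repr: "Kip \<beta> f (\<lambda>x. phi \<beta> (x - y)) = f y" if f: "f \<in> H" for f y
  proof -
    obtain u where r: "native_rep \<beta> f u" using f unfolding mem by blast
    show ?thesis
      using native_rep_value [OF \<beta> r, of y] K
      unfolding ip [OF r native_rep_phi [OF \<beta>]] by (simp add: K_def)
  qed
  show ?thesis
    unfolding is_rkhs_def H_def [symmetric]
    by (intro conjI ballI allI impI; (elim conjE)?;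
        (rule zero add scale ip_lin herm pos definite ker repr; assumption)?; rule complete; blast)
qed

lemma is_rkhs_sum:
  assumes H: "is_rkhs H ip k" and F: "finite F" and v: "\<And>j. v j \<in> H"
  shows "(\<lambda>x. \<Sum>j\<in>F. c j * v j x) \<in> H"
    and "h \<in> H \<Longrightarrow> ip (\<lambda>x. \<Sum>j\<in>F. c j * v j x) h = (\<Sum>j\<in>F. c j * ip (v j) h)"
proof -
  have lin: "ip (\<lambda>x. a * f x + b * g x) h = a * ip f h + b * ip g h" if "f \<in> H" "g \<in> H" "h \<in> H" for f g h a b
    using H that unfolding is_rkhs_def by blast
  have sub: "(\<lambda>_. 0) \<in> H" "\<And>f g. f \<in> H \<Longrightarrow> g \<in> H \<Longrightarrow> (\<lambda>x. f x + g x) \<in> H" "\<And>f c. f \<in> H \<Longrightarrow> (\<lambda>x. c * f x) \<in> H"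
    using H unfolding is_rkhs_def by blast+
  have mem: "(\<lambda>x. \<Sum>j\<in>F. c j * v j x) \<in> H" if "finite F" for F
    using that by induction (auto intro!: sub v)
  with F show "(\<lambda>x. \<Sum>j\<in>F. c j * v j x) \<in> H" by blast
  show "ip (\<lambda>x. \<Sum>j\<in>F. c j * v j x) h = (\<Sum>j\<in>F. c j * ip (v j) h)" if h: "h \<in> H"
    using F
  proof induction
    case empty
    show ?case using lin [OF sub(1) sub(1) h, of 0 0] by simp
  next
    case (insert j F)
    then show ?case
      using lin [OF v mem [of F] h, of "c j" j 1] by simp
  qed
qed

text \<open>The reproducing property evaluates one argument of the form; Hermitian symmetry accounts
  for the conjugated kernel values.\<close>

theorem is_rkhs_gram:
  assumes H: "is_rkhs H ip k" and F: "finite F"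
  shows "ip (\<lambda>x. \<Sum>j\<in>F. c j * k x (X j)) (\<lambda>x. \<Sum>j\<in>F. c j * k x (X j)) =
    (\<Sum>i\<in>F. \<Sum>j\<in>F. c i * cnj (c j) * cnj (k (X i) (X j)))"
proof -
  let ?v = "\<lambda>j x. k x (X j)"
  let ?f = "\<lambda>x. \<Sum>j\<in>F. c j * k x (X j)"
  have v: "?v j \<in> H" for j
    using H unfolding is_rkhs_def by blast
  note s = is_rkhs_sum [where v = ?v and c = c, OF H F v]
  have "ip (?v i) ?f = cnj (?f (X i))" for i
  proof -
    have "ip (?v i) ?f = cnj (ip ?f (?v i))"
      using H s(1) v [of i] unfolding is_rkhs_def by blast
    also have "ip ?f (?v i) = ?f (X i)"
      using H s(1) unfolding is_rkhs_def by blast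
    finally show ?thesis .
  qed
  then show ?thesis
    by (simp add: s(2) [OF s(1)] sum_distrib_left mult.assoc)
qed

section \<open>Riesz bounds\<close>

text \<open>Bound \<open>|c i| |c j|\<close> by half the sum of squares; by symmetry of
  \<open>a\<close> both halves are controlled by the same row sums.\<close>

lemma Schur_bound:
  fixes a :: "'i \<Rightarrow> 'i \<Rightarrow> real" and c :: "'i \<Rightarrow> complex"
  assumes sym: "\<And>i j. a i j = a j i" and nn: "\<And>i j. 0 \<le> a i j"
    and row: "\<And>i. i \<in> F \<Longrightarrow> (\<Sum>j\<in>F. a i j) \<le> M"
  shows "\<bar>Re (\<Sum>i\<in>F. \<Sum>j\<in>F. c i * cnj (c j) * complex_of_real (a i j))\<bar> \<le> M * (\<Sum>i\<in>F. (cmod (c i))\<^sup>2)"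
proof -
  have "\<bar>Re (\<Sum>i\<in>F. \<Sum>j\<in>F. c i * cnj (c j) * complex_of_real (a i j))\<bar> \<le>
      cmod (\<Sum>i\<in>F. \<Sum>j\<in>F. c i * cnj (c j) * complex_of_real (a i j))"
    by (rule abs_Re_le_cmod)
  also have "\<dots> \<le> (\<Sum>i\<in>F. \<Sum>j\<in>F. cmod (c i * cnj (c j) * complex_of_real (a i j)))"
    by (intro order.trans [OF norm_sum] sum_mono norm_sum)
  also have "\<dots> \<le> (\<Sum>i\<in>F. \<Sum>j\<in>F. (cmod (c i))\<^sup>2 / 2 * a i j + (cmod (c j))\<^sup>2 / 2 * a j i)"
  proof (intro sum_mono)
    fix i j
    have "cmod (c i) * cmod (c j) * a i j \<le> ((cmod (c i))\<^sup>2 / 2 + (cmod (c j))\<^sup>2 / 2) * a i j"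
      using sum_squares_bound [of "cmod (c i)" "cmod (c j)"] nn by (intro mult_right_mono) auto
    then show "cmod (c i * cnj (c j) * complex_of_real (a i j)) \<le>
        (cmod (c i))\<^sup>2 / 2 * a i j + (cmod (c j))\<^sup>2 / 2 * a j i"
      using nn [of i j] sym [of i j] by (simp add: norm_mult distrib_right)
  qed
  also have "\<dots> = (\<Sum>i\<in>F. \<Sum>j\<in>F. (cmod (c i))\<^sup>2 / 2 * a i j) + (\<Sum>i\<in>F. \<Sum>j\<in>F. (cmod (c j))\<^sup>2 / 2 * a j i)"
    by (simp add: sum.distrib)
  also have "(\<Sum>i\<in>F. \<Sum>j\<in>F. (cmod (c j))\<^sup>2 / 2 * a j i) = (\<Sum>i\<in>F. \<Sum>j\<in>F. (cmod (c i))\<^sup>2 / 2 * a i j)"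
    by (rule sum.swap)
  also have "(\<Sum>i\<in>F. \<Sum>j\<in>F. (cmod (c i))\<^sup>2 / 2 * a i j) + (\<Sum>i\<in>F. \<Sum>j\<in>F. (cmod (c i))\<^sup>2 / 2 * a i j)
     = (\<Sum>i\<in>F. (cmod (c i))\<^sup>2 * (\<Sum>j\<in>F. a i j))"
    unfolding sum.distrib [symmetric] sum_distrib_left by (intro sum.cong refl) simp
  also have "\<dots> \<le> (\<Sum>i\<in>F. (cmod (c i))\<^sup>2 * M)"
    by (intro sum_mono mult_left_mono row) auto
  also have "\<dots> = M * (\<Sum>i\<in>F. (cmod (c i))\<^sup>2)"
    by (simp add: sum_distrib_left mult.commute)
  finally show ?thesis .
qed

text \<open>The easy half of Bochner's theorem: up to a positive factor the form is the integral of
  \<open>|\<Sum>i. c i * osc (X i) \<xi>|^2\<close> against the Gaussian with parameter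
  \<open>1 / (4 * t)\<close>, whose transform is a multiple of \<open>gauss t\<close>.\<close>

lemma gauss_positive_semidefinite:
  fixes X :: "'i \<Rightarrow> 'a::euclidean_space" and c :: "'i \<Rightarrow> complex"
  assumes t: "t > 0"
  shows "0 \<le> Re (\<Sum>i\<in>F. \<Sum>j\<in>F. c i * cnj (c j) * complex_of_real (gauss t (X i - X j)))"
proof -
  define s where "s = 1 / (4 * t)"
  define C where "C = (pi / s) powr (real DIM('a) / 2)"
  have s: "s > 0" "1 / (4 * s) = t" using t by (simp_all add: s_def)
  have C: "C > 0" using s by (simp add: C_def)
  have i: "integrable lborel (\<lambda>\<xi>. osc x \<xi> * complex_of_real (gauss s \<xi>))" for x :: 'a
    by (rule gauss_fourier(1) [OF s(1)])
  have v: "(LINT \<xi>|lborel. osc x \<xi> * complex_of_real (gauss s \<xi>)) = complex_of_real (C * gauss t x)" for x :: 'a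
    using gauss_fourier(2) [OF s(1), of x] by (simp add: s C_def)
  have "complex_of_real C * (\<Sum>i\<in>F. \<Sum>j\<in>F. c i * cnj (c j) * complex_of_real (gauss t (X i - X j)))
     = (\<Sum>i\<in>F. \<Sum>j\<in>F. c i * cnj (c j) * complex_of_real (C * gauss t (X i - X j)))"
    by (simp add: sum_distrib_left mult_ac)
  also have "\<dots> = (LINT \<xi>|lborel. (\<Sum>i\<in>F. \<Sum>j\<in>F. c i * cnj (c j) * (osc (X i - X j) \<xi> * complex_of_real (gauss s \<xi>))))"
    unfolding v [symmetric]
    by (simp add: Bochner_Integration.integral_sum i)
  also have "\<dots> = (LINT \<xi>|lborel. complex_of_real ((cmod (\<Sum>i\<in>F. c i * osc (X i) \<xi>))\<^sup>2 * gauss s \<xi>))"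
  proof (intro Bochner_Integration.integral_cong refl)
    fix \<xi>
    have "(\<Sum>i\<in>F. \<Sum>j\<in>F. c i * cnj (c j) * (osc (X i - X j) \<xi> * complex_of_real (gauss s \<xi>)))
      = (\<Sum>i\<in>F. \<Sum>j\<in>F. (c i * osc (X i) \<xi>) * cnj (c j * osc (X j) \<xi>)) * complex_of_real (gauss s \<xi>)"
      unfolding sum_distrib_right by (intro sum.cong refl) (simp add: osc_diff mult_ac)
    also have "(\<Sum>i\<in>F. \<Sum>j\<in>F. (c i * osc (X i) \<xi>) * cnj (c j * osc (X j) \<xi>))
      = complex_of_real ((cmod (\<Sum>i\<in>F. c i * osc (X i) \<xi>))\<^sup>2)"
      unfolding sum_product [symmetric] cnj_sum [symmetric] complex_norm_square ..
    finally show "(\<Sum>i\<in>F. \<Sum>j\<in>F. c i * cnj (c j) * (osc (X i - X j) \<xi> * complex_of_real (gauss s \<xi>)))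
      = complex_of_real ((cmod (\<Sum>i\<in>F. c i * osc (X i) \<xi>))\<^sup>2 * gauss s \<xi>)"
      by simp
  qed
  also have "\<dots> = complex_of_real (LINT \<xi>|lborel. (cmod (\<Sum>i\<in>F. c i * osc (X i) \<xi>))\<^sup>2 * gauss s \<xi>)"
    by (rule integral_complex_of_real)
  finally have e: "complex_of_real C * (\<Sum>i\<in>F. \<Sum>j\<in>F. c i * cnj (c j) * complex_of_real (gauss t (X i - X j)))
     = complex_of_real (LINT \<xi>|lborel. (cmod (\<Sum>i\<in>F. c i * osc (X i) \<xi>))\<^sup>2 * gauss s \<xi>)" .
  have "C * Re z = I" if "complex_of_real C * z = complex_of_real I" for z I
    using arg_cong [OF that, of Re] by simp
  from this [OF e] have "0 \<le> C * Re (\<Sum>i\<in>F. \<Sum>j\<in>F. c i * cnj (c j) * complex_of_real (gauss t (X i - X j)))"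
    by (simp only: Bochner_Integration.integral_nonneg mult_nonneg_nonneg zero_le_power2 gauss_pos)
  then show ?thesis
    using C by (auto simp only: zero_le_mult_iff)
qed

text \<open>A Peetre type inequality:
  \<open>1 + |y|^2 \<le> 2 * (1 + r^2) * (1 + |x|^2)\<close>.\<close>

lemma phi_slowly_varying:
  fixes x y :: "'a::euclidean_space"
  assumes b: "\<beta> > 0" and xy: "norm (x - y) \<le> r"
  shows "(1 + (norm x)\<^sup>2) powr (- \<beta>) \<le> (2 * (1 + r\<^sup>2)) powr \<beta> * (1 + (norm y)\<^sup>2) powr (- \<beta>)"
proof -
  have r: "0 \<le> r" using xy norm_ge_zero order_trans by blast
  have p: "0 < 1 + (norm z)\<^sup>2" for z :: 'a by (simp add: add_pos_nonneg)
  have pr: "0 < 1 + r\<^sup>2" by (simp add: add_pos_nonneg)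
  have "norm y \<le> norm x + r"
    using norm_triangle_ineq3 [of x y] xy by simp
  then have "(norm y)\<^sup>2 \<le> (norm x + r)\<^sup>2"
    by (intro power_mono) auto
  also have "\<dots> \<le> 2 * (norm x)\<^sup>2 + 2 * r\<^sup>2"
    using sum_squares_bound [of "norm x" r] by (simp add: power2_sum)
  finally have "(norm y)\<^sup>2 \<le> 2 * (norm x)\<^sup>2 + 2 * r\<^sup>2" .
  moreover have "2 * (1 + r\<^sup>2) * (1 + (norm x)\<^sup>2) = 2 + 2 * (norm x)\<^sup>2 + 2 * r\<^sup>2 + 2 * (r\<^sup>2 * (norm x)\<^sup>2)"
    by (simp add: algebra_simps)
  moreover have "0 \<le> r\<^sup>2 * (norm x)\<^sup>2"
    by simp
  ultimately have "1 + (norm y)\<^sup>2 \<le> 2 * (1 + r\<^sup>2) * (1 + (norm x)\<^sup>2)"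
    by linarith
  then have "(1 + (norm y)\<^sup>2) powr \<beta> \<le> (2 * (1 + r\<^sup>2) * (1 + (norm x)\<^sup>2)) powr \<beta>"
    using b p [of y] by (intro powr_mono2) auto
  also have "\<dots> = (2 * (1 + r\<^sup>2)) powr \<beta> * (1 + (norm x)\<^sup>2) powr \<beta>"
    by (rule powr_mult)
  finally show ?thesis
    using p [of x] p [of y] by (simp add: powr_minus field_simps)
qed

text \<open>Packing argument: the balls of radius \<^term>\<open>\<delta> / 2\<close> are disjoint and \<^term>\<open>phi \<beta>\<close> is integrable
  and varies by a bounded factor on each.\<close>
lemma phi_separated_sum_bound:
  fixes X :: "'i \<Rightarrow> 'a::euclidean_space"
  assumes \<beta>: "\<beta> > real DIM('a) / 2" and d: "\<delta> > 0"
    and sep: "\<And>i j. i \<noteq> j \<Longrightarrow> \<delta> \<le> dist (X i) (X j)"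
  obtains M where "\<And>F i. finite F \<Longrightarrow> (\<Sum>j\<in>F. (1 + (norm (X i - X j))\<^sup>2) powr (- \<beta>)) \<le> M"
proof -
  have b0: "\<beta> > 0" using \<beta> by (smt (verit) DIM_positive divide_pos_pos of_nat_0_less_iff)
  define f where "f x = (1 + (norm x)\<^sup>2) powr (- \<beta>)" for x :: 'a
  have fi: "integrable lborel f"
    using phi_integrable_fourier(1) [OF \<beta>]
    by (simp add: phi_def [abs_def] f_def [abs_def] complex_of_real_integrable_eq)
  then have [measurable]: "f \<in> borel_measurable borel"
    by (auto dest: borel_measurable_integrable)
  have f0: "0 \<le> f x" for x by (simp add: f_def)
  \<comment> \<open>The resulting bound is \<open>D\<close> times the integral of \<open>f\<close>
    over the ball volume \<open>V\<close>, where \<open>D\<close> is the variation of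
    \<open>f\<close> over distances up to \<open>r\<close>.\<close>
  define r where "r = \<delta> / 2"
  have r: "r > 0" using d by (simp add: r_def)
  define D where "D = (2 * (1 + r\<^sup>2)) powr \<beta>"
  define V where "V = measure lborel (ball (0::'a) r)"
  have V: "V > 0" unfolding V_def using r by (rule content_ball_pos)
  have Vc: "measure lborel (ball (x::'a) r) = V" for x
    unfolding V_def using r by (simp add: content_ball)
  have "(\<Sum>j\<in>F. f (X i - X j)) \<le> D * (LINT x|lborel. f x) / V" if F: "finite F" for F i
  proof -
    have g: "integrable lborel (\<lambda>y. D * f (X i - y))" "(LINT y|lborel. D * f (X i - y)) = D * (LINT x|lborel. f x)"
    proof -
      have e: "f (X i - y) = f (y - X i)" for y by (simp add: f_def norm_minus_commute)
      show "integrable lborel (\<lambda>y. D * f (X i - y))" "(LINT y|lborel. D * f (X i - y)) = D * (LINT x|lborel. f x)"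
        unfolding e using fi by (simp_all add: integral_lborel_shift)
    qed
    have ib: "integrable lborel (indicator (ball (X j) r) :: 'a \<Rightarrow> real)" for j
      using emeasure_bounded_finite [of "ball (X j) r"] by (simp add: less_top)
    have pt: "(\<Sum>j\<in>F. f (X i - X j) * indicator (ball (X j) r) y) \<le> D * f (X i - y)" for y
    proof (cases "\<exists>k\<in>F. y \<in> ball (X k) r")
      case True
      then obtain k where k: "k \<in> F" "y \<in> ball (X k) r" by blast
      have "y \<notin> ball (X j) r" if "j \<noteq> k" for j
      proof
        assume "y \<in> ball (X j) r"
        then have "dist (X j) (X k) < \<delta>"
          using k dist_triangle2 [of "X j" "X k" y] by (simp add: r_def)
        with sep [OF that] show False by simp
      qed
      then have "(\<Sum>j\<in>F. f (X i - X j) * indicator (ball (X j) r) y) = (\<Sum>j\<in>{k}. f (X i - X j) * indicator (ball (X j) r) y)"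
        using F k by (intro sum.mono_neutral_right) auto
      also have "\<dots> = f (X i - X k)" using k by simp
      also have "\<dots> \<le> D * f (X i - y)"
        unfolding f_def D_def using k by (intro phi_slowly_varying b0) (simp add: dist_norm norm_minus_commute)
      finally show ?thesis .
    next
      case False
      then have "(\<Sum>j\<in>F. f (X i - X j) * indicator (ball (X j) r) y) = 0"
        by (intro sum.neutral) auto
      then show ?thesis by (simp add: f0 D_def)
    qed
    have "V * (\<Sum>j\<in>F. f (X i - X j)) = (\<Sum>j\<in>F. f (X i - X j) * measure lborel (ball (X j) r))"
      by (simp add: Vc sum_distrib_left mult.commute)
    also have "\<dots> = (LINT y|lborel. (\<Sum>j\<in>F. f (X i - X j) * indicator (ball (X j) r) y))"
      using ib by (subst Bochner_Integration.integral_sum) auto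
    also have "\<dots> \<le> (LINT y|lborel. D * f (X i - y))"
      by (intro integral_mono g pt Bochner_Integration.integrable_sum integrable_mult_right ib)
    finally show ?thesis
      using V unfolding g(2) by (simp add: field_simps)
  qed
  then show ?thesis
    by (intro that [of "D * (LINT x|lborel. f x) / V"]) (simp add: f_def)
qed

text \<open>From \<open>ln a \<le> |x|^2\<close> with \<open>a = 1 + |x|^2\<close> the Gaussian is
  at most \<open>a powr (- t)\<close>. Splitting off \<open>a powr (- \<beta>)\<close> leaves a
  factor that decays in \<open>t\<close> uniformly for \<open>|x| \<ge> d\<close>, so the packing
  bound also controls Gaussian row sums.\<close>

lemma gauss_le_phi:
  fixes x :: "'a::euclidean_space"
  assumes t: "\<beta> \<le> t" "0 \<le> \<beta>" and x: "d \<le> norm x" "0 \<le> d"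
  shows "gauss t x \<le> (1 + d\<^sup>2) powr (\<beta> - t) * (1 + (norm x)\<^sup>2) powr (- \<beta>)"
proof -
  define a where "a = 1 + (norm x)\<^sup>2"
  have a: "a > 0" by (simp add: a_def add_pos_nonneg)
  have d: "1 + d\<^sup>2 > 0" "1 + d\<^sup>2 \<le> a" using x by (auto simp: a_def add_pos_nonneg intro!: power_mono)
  have "ln a \<le> (norm x)\<^sup>2"
    unfolding a_def by (rule ln_add_one_self_le_self) simp
  then have "gauss t x \<le> exp (- t * ln a)"
    using t by (auto simp: gauss_def intro!: mult_left_mono)
  also have "\<dots> = a powr (\<beta> - t) * a powr (- \<beta>)"
    using a by (simp add: powr_def flip: exp_add) (simp add: algebra_simps)
  also have "\<dots> \<le> (1 + d\<^sup>2) powr (\<beta> - t) * a powr (- \<beta>)"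
    using d t by (intro mult_right_mono powr_mono2') auto
  finally show ?thesis by (simp add: a_def)
qed


lemma gamma_weight_tail_pos:
  assumes a: "a > 0" and T: "T > 0"
  shows "integrable lborel (\<lambda>t. indicator {T..} t * gamma_weight a t)"
    and "0 < (LINT t|lborel. indicator {T..} t * gamma_weight a t)"
proof -
  let ?f = "\<lambda>t. indicator {T..} t * gamma_weight a t"
  show i: "integrable lborel ?f"
    using integrable_mult_indicator [of "{T..}" lborel "gamma_weight a"] gamma_weight_integral(1) [OF a] by simp
  have "(LINT t|lborel. ?f t) \<noteq> 0"
  proof
    assume "(LINT t|lborel. ?f t) = 0"
    then have "AE t in lborel. ?f t = 0"
      using i by (subst (asm) integral_nonneg_eq_0_iff_AE) auto
    then have "AE t in lborel. t \<notin> {T..T + 1}"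
      by eventually_elim (use T in \<open>auto simp: gamma_weight_pos\<close>)
    then have "{T..T + 1} \<in> null_sets lborel"
      by (subst AE_iff_null_sets) auto
    then show False by (simp add: null_sets_def)
  qed
  moreover have "(LINT t|lborel. ?f t) \<ge> 0" by simp
  ultimately show "(LINT t|lborel. ?f t) > 0" by linarith
qed

text \<open>\<^term>\<open>phi \<beta>\<close> is a mixture of the Gaussians \<^term>\<open>gauss t\<close>, each of which gives a positive
  semidefinite Gram matrix; for large \<^term>\<open>t\<close> this matrix is diagonally dominant. The lower Riesz
  bound comes from those \<^term>\<open>t\<close> alone.\<close>
theorem phi_gram_bounds:
  fixes X :: "'i \<Rightarrow> 'a::euclidean_space"
  assumes \<beta>: "\<beta> > real DIM('a) / 2" and d: "\<delta> > 0"
    and sep: "\<And>i j. i \<noteq> j \<Longrightarrow> \<delta> \<le> dist (X i) (X j)"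
  obtains A B where "0 < A" "A \<le> B"
    "\<forall>F c. finite F \<longrightarrow>
      A * (\<Sum>j\<in>F. (cmod (c j))\<^sup>2) \<le> Re (\<Sum>i\<in>F. \<Sum>j\<in>F. c i * cnj (c j) * phi \<beta> (X i - X j)) \<and>
      Re (\<Sum>i\<in>F. \<Sum>j\<in>F. c i * cnj (c j) * phi \<beta> (X i - X j)) \<le> B * (\<Sum>j\<in>F. (cmod (c j))\<^sup>2)"
proof -
  have b0: "\<beta> > 0" using \<beta> by (smt (verit) DIM_positive divide_pos_pos of_nat_0_less_iff)
  have G: "Gamma \<beta> > 0" using b0 by (rule Gamma_real_pos)
  define f where "f x = (1 + (norm x)\<^sup>2) powr (- \<beta>)" for x :: 'a
  have phi: "phi \<beta> x = complex_of_real (f x)" for x by (simp add: phi_def f_def)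
  obtain M0 where M0: "\<And>F i. finite F \<Longrightarrow> (\<Sum>j\<in>F. f (X i - X j)) \<le> M0"
    using phi_separated_sum_bound [OF \<beta> d, of X] sep unfolding f_def by blast
  \<comment> \<open>The lower bound 1 makes the logarithm in \<open>T\<close> nonnegative, hence
    \<open>T \<ge> \<beta>\<close>.\<close>
  define M where "M = max M0 1"
  have M: "M \<ge> 1" "\<And>F i. finite F \<Longrightarrow> (\<Sum>j\<in>F. f (X i - X j)) \<le> M"
    using M0 by (auto simp: M_def le_max_iff_disj)
  define p where "p = 1 + \<delta>\<^sup>2"
  have p: "p > 1" using d by (simp add: p_def)
  \<comment> \<open>Solves \<open>p powr (\<beta> - T) * M = 1 / 2\<close>, the target for the
    off-diagonal row sums.\<close>
  define T where "T = \<beta> + log p (2 * M)"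
  have "log p (2 * M) \<ge> 0" using M p by (subst zero_le_log_cancel_iff) auto
  then have T: "T > 0" "T \<ge> \<beta>" using b0 by (auto simp: T_def)
  \<comment> \<open>The Gamma probability of \<open>{T..}\<close>, halved because the form loses at
    most half of its diagonal there.\<close>
  define A where "A = (LINT t|lborel. indicator {T..} t * gamma_weight \<beta> t) / (2 * Gamma \<beta>)"
  have A: "A > 0" using gamma_weight_tail_pos(2) [OF b0 T(1)] G by (simp add: A_def)
  have offdiag: "(\<Sum>j\<in>F. if i = j then 0 else gauss t (X i - X j)) \<le> 1 / 2"
    if t: "t \<ge> T" and F: "finite F" for t F i
  proof -
    have "(\<Sum>j\<in>F. if i = j then 0 else gauss t (X i - X j)) \<le> (\<Sum>j\<in>F. p powr (\<beta> - t) * f (X i - X j))"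
    proof (intro sum_mono)
      fix j
      show "(if i = j then 0 else gauss t (X i - X j)) \<le> p powr (\<beta> - t) * f (X i - X j)"
        using sep [of i j] t T(2) b0 d unfolding p_def f_def
        by (auto intro!: gauss_le_phi simp: dist_norm)
    qed
    also have "\<dots> \<le> p powr (\<beta> - t) * M"
      unfolding sum_distrib_left [symmetric] by (intro mult_left_mono M(2) F) simp
    also have "\<dots> \<le> p powr (- log p (2 * M)) * M"
      using t p M by (intro mult_right_mono powr_mono) (auto simp: T_def)
    also have "\<dots> = 1 / 2"
      using p M by (simp add: powr_minus)
    finally show ?thesis .
  qed
  have lower: "A * (\<Sum>j\<in>F. (cmod (c j))\<^sup>2) \<le> Re (\<Sum>i\<in>F. \<Sum>j\<in>F. c i * cnj (c j) * phi \<beta> (X i - X j))"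
    if F: "finite F" for F c
  proof -
    define N where "N = (\<Sum>j\<in>F. (cmod (c j))\<^sup>2)"
    define w where "w i j = Re (c i * cnj (c j))" for i j
    define Q where "Q t = (\<Sum>i\<in>F. \<Sum>j\<in>F. w i j * gauss t (X i - X j))" for t
    have re: "Re (\<Sum>i\<in>F. \<Sum>j\<in>F. c i * cnj (c j) * complex_of_real (a i j)) = (\<Sum>i\<in>F. \<Sum>j\<in>F. w i j * a i j)" for a
      by (simp add: w_def)
    have Q0: "0 \<le> Q t" if "t > 0" for t
      using gauss_positive_semidefinite [OF that, where X = X and F = F and c = c] unfolding re Q_def .
    \<comment> \<open>The diagonal contributes \<open>N\<close>, since \<open>gauss t 0 = 1\<close>;
      by Schur's bound the rest is at most \<open>N / 2\<close> in absolute value.\<close>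
    have QN: "N / 2 \<le> Q t" if t: "t \<ge> T" for t
    proof -
      let ?b = "\<lambda>i j. if i = j then 0 else gauss t (X i - X j)"
      have "\<bar>\<Sum>i\<in>F. \<Sum>j\<in>F. w i j * ?b i j\<bar> \<le> 1 / 2 * N"
        unfolding re [symmetric] N_def
        by (rule Schur_bound) (use offdiag [OF t F] in \<open>auto simp: gauss_diff_commute\<close>)
      moreover have "Q t = N + (\<Sum>i\<in>F. \<Sum>j\<in>F. w i j * ?b i j)"
      proof -
        have "w i j * gauss t (X i - X j) = (if i = j then w i i else 0) + w i j * ?b i j" for i j
          by (simp add: gauss_def)
        then have "Q t = (\<Sum>i\<in>F. w i i) + (\<Sum>i\<in>F. \<Sum>j\<in>F. w i j * ?b i j)"
          unfolding Q_def using F by (simp only: sum.distrib sum.delta' if_True cong: sum.cong)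
        moreover have "w i i = (cmod (c i))\<^sup>2" for i
          by (simp add: w_def complex_norm_square [symmetric] del: of_real_power)
        ultimately show ?thesis by (simp add: N_def)
      qed
      ultimately show ?thesis by linarith
    qed
    have gi: "integrable lborel (\<lambda>t. gamma_weight \<beta> t * gauss t x)" for x :: 'a
      by (rule integrable_gamma_weight_gauss) (use b0 in auto)
    have Qi: "integrable lborel (\<lambda>t. gamma_weight \<beta> t * Q t)"
      "(LINT t|lborel. gamma_weight \<beta> t * Q t) = Gamma \<beta> * (\<Sum>i\<in>F. \<Sum>j\<in>F. w i j * f (X i - X j))"
    proof -
      have e: "gamma_weight \<beta> t * Q t = (\<Sum>i\<in>F. \<Sum>j\<in>F. w i j * (gamma_weight \<beta> t * gauss t (X i - X j)))" for t
        by (simp add: Q_def sum_distrib_left mult_ac)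
      show "integrable lborel (\<lambda>t. gamma_weight \<beta> t * Q t)"
        unfolding e by (intro Bochner_Integration.integrable_sum integrable_mult_right gi)
      show "(LINT t|lborel. gamma_weight \<beta> t * Q t) = Gamma \<beta> * (\<Sum>i\<in>F. \<Sum>j\<in>F. w i j * f (X i - X j))"
      proof -
        have "(LINT t|lborel. gamma_weight \<beta> t * Q t) =
            (\<Sum>i\<in>F. \<Sum>j\<in>F. w i j * (LINT t|lborel. gamma_weight \<beta> t * gauss t (X i - X j)))"
          unfolding e
          by (simp only: Bochner_Integration.integral_sum Bochner_Integration.integrable_sum
              integrable_mult_right gi integral_mult_right_zero)
        then show ?thesis
          by (simp add: phi_gaussian_mixture [OF b0] f_def sum_distrib_left mult_ac)
      qed
    qed
    have "Gamma \<beta> * (A * N) = (LINT t|lborel. N / 2 * (indicator {T..} t * gamma_weight \<beta> t))"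
      using G by (simp add: A_def)
    also have "\<dots> \<le> (LINT t|lborel. gamma_weight \<beta> t * Q t)"
    proof (rule integral_mono)
      show "integrable lborel (\<lambda>t. N / 2 * (indicator {T..} t * gamma_weight \<beta> t))"
        by (intro integrable_mult_right gamma_weight_tail_pos b0 T)
      fix t
      \<comment> \<open>Diagonal dominance for large \<open>t\<close>, semidefiniteness in between,
        and a vanishing weight for \<open>t \<le> 0\<close>.\<close>
      consider "t \<ge> T" | "t < T" "t > 0" | "t \<le> 0" by linarith
      then show "N / 2 * (indicator {T..} t * gamma_weight \<beta> t) \<le> gamma_weight \<beta> t * Q t"
      proof cases
        case 1
        then show ?thesis
          using mult_left_mono [OF QN [OF 1], of "gamma_weight \<beta> t"] by (simp add: mult.commute)
      next
        case 2
        then show ?thesis using Q0 by simp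
      qed simp
    qed (rule Qi)
    also have "\<dots> = Gamma \<beta> * (\<Sum>i\<in>F. \<Sum>j\<in>F. w i j * f (X i - X j))"
      by (rule Qi)
    finally have "A * N \<le> (\<Sum>i\<in>F. \<Sum>j\<in>F. w i j * f (X i - X j))"
      using G by (simp only: mult_le_cancel_left_pos)
    then show ?thesis
      unfolding phi re N_def .
  qed
  have upper: "Re (\<Sum>i\<in>F. \<Sum>j\<in>F. c i * cnj (c j) * phi \<beta> (X i - X j)) \<le> max A M * (\<Sum>j\<in>F. (cmod (c j))\<^sup>2)"
    if F: "finite F" for F c
  proof -
    have "\<bar>Re (\<Sum>i\<in>F. \<Sum>j\<in>F. c i * cnj (c j) * complex_of_real (f (X i - X j)))\<bar> \<le> M * (\<Sum>j\<in>F. (cmod (c j))\<^sup>2)"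
      by (rule Schur_bound) (use M(2) F in \<open>auto simp: f_def norm_minus_commute\<close>)
    also have "\<dots> \<le> max A M * (\<Sum>j\<in>F. (cmod (c j))\<^sup>2)"
      by (intro mult_right_mono sum_nonneg) auto
    finally show ?thesis unfolding phi by linarith
  qed
  show ?thesis
    using A lower upper by (intro that [of A "max A M"]) auto
qed

text \<open>By the reproducing property the squared norm of a finite combination is the Gram form of
  \<open>phi \<beta>\<close>, to which \<open>phi_gram_bounds\<close> applies with the separation
  distance as \<open>\<delta>\<close>.\<close>

theorem riesz_sequence_phi_translates:
  fixes X :: "nat \<Rightarrow> 'a::euclidean_space"
  assumes \<beta>: "\<beta> > real DIM('a) / 2" and sep: "sep_dist X > 0"
  shows "riesz_sequence (Kspace (\<beta> - real DIM('a) / 2)) (Kip \<beta>) (\<lambda>j x. phi \<beta> (x - X j))"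
proof -
  note H = is_rkhs_Kspace [OF \<beta>]
  have d: "sep_dist X \<le> dist (X i) (X j)" if "i \<noteq> j" for i j
    unfolding sep_dist_def using that by (intro cInf_lower bdd_belowI [of _ 0]) auto
  obtain A B where AB: "0 < A" "A \<le> B"
    "\<forall>F c. finite F \<longrightarrow>
      A * (\<Sum>j\<in>F. (cmod (c j))\<^sup>2) \<le> Re (\<Sum>i\<in>F. \<Sum>j\<in>F. c i * cnj (c j) * phi \<beta> (X i - X j)) \<and>
      Re (\<Sum>i\<in>F. \<Sum>j\<in>F. c i * cnj (c j) * phi \<beta> (X i - X j)) \<le> B * (\<Sum>j\<in>F. (cmod (c j))\<^sup>2)"
    by (rule phi_gram_bounds [OF \<beta> sep d])
  \<comment> \<open>The kernel is real, so the conjugate in \<open>is_rkhs_gram\<close>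
    disappears.\<close>
  have gram: "Kip \<beta> (\<lambda>x. \<Sum>j\<in>F. c j * phi \<beta> (x - X j)) (\<lambda>x. \<Sum>j\<in>F. c j * phi \<beta> (x - X j)) =
      (\<Sum>i\<in>F. \<Sum>j\<in>F. c i * cnj (c j) * phi \<beta> (X i - X j))" if "finite F" for F c
    using is_rkhs_gram [OF H that, of c X] by (simp add: phi_def)
  have "(\<lambda>x. phi \<beta> (x - X j)) \<in> Kspace (\<beta> - real DIM('a) / 2)" for j
    using native_rep_phi [OF \<beta>] Kspace_iff_native_rep [OF \<beta>] by blast
  moreover have "A * (\<Sum>j\<in>F. (cmod (c j))\<^sup>2)
      \<le> Re (Kip \<beta> (\<lambda>x. \<Sum>j\<in>F. c j * phi \<beta> (x - X j)) (\<lambda>x. \<Sum>j\<in>F. c j * phi \<beta> (x - X j))) \<and>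
    Re (Kip \<beta> (\<lambda>x. \<Sum>j\<in>F. c j * phi \<beta> (x - X j)) (\<lambda>x. \<Sum>j\<in>F. c j * phi \<beta> (x - X j)))
      \<le> B * (\<Sum>j\<in>F. (cmod (c j))\<^sup>2)" if "finite F" for F c
    unfolding gram [OF that] using AB(3) that by blast
  ultimately show ?thesis
    unfolding riesz_sequence_def using AB(1,2) by blast
qed

theorem theorem6p5:
  fixes \<beta> :: real
  assumes "\<beta> > real CARD('n::finite) / 2"
  shows "is_rkhs (Kspace (\<beta> - real CARD('n) / 2) :: (real^'n \<Rightarrow> complex) set)
            (Kip \<beta>) (\<lambda>x y. phi \<beta> (x - y))
       \<and> (\<forall>X :: nat \<Rightarrow> real^'n.
            inj X \<and> sep_dist X > 0 \<and>
            (CARD('n) \<ge> 2 \<or> sep_dist X > 2 * Beta (\<beta> - 1/2) (1/2))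
            \<longrightarrow> riesz_sequence (Kspace (\<beta> - real CARD('n) / 2)) (Kip \<beta>)
                  (\<lambda>j x. phi \<beta> (x - X j)))"
proof -
  have \<beta>: "\<beta> > real DIM(real^'n) / 2"
    using assms by simp
  show ?thesis
    using is_rkhs_Kspace [OF \<beta>] riesz_sequence_phi_translates [OF \<beta>] by simp
qed

end
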